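(* Let $0<p<q\leq1$ and let $M$ be a (pointed) $q$-metric space. Then $\mathcal F_p(M)$ is $\ell_p$-saturated and, for every $r$ with $p<r\leq1$, contains no isomorphic copy of an infinite-dimensional $r$-Banach space. Moreover, every bounded linear operator from a $p$-Banach space into $\mathcal F_p(M)$ is either compact or fixes a copy of $\ell_p$.
   Context: All vector spaces are real. For $0<s\le 1$, an $s$-Banach space is a complete quasi-normed space $X$ with $\|x+y\|^s\le\|x\|^s+\|y\|^s$ for all $x,y\in X$. For $0<s\le1$, an $s$-metric on a set $M$ is a function $d\colon M\times M\to[0,\infty)$ such that $d^s$ is a metric; topological notions refer to the metric $d^s$. A pointed $s$-metric space is an $s$-metric space with a distinguished base point $0$; a map is pointed if it sends base point to base point (the base point of a vector space being $0$). If $0<p\le q\le1$, every $q$-metric space is a $p$-metric space. For a pointed $p$-metric space $(M,d,0)$, the Lipschitz-free $p$-space $\mathcal F_p(M)$ is the (unique up to linear isometry) $p$-Banach space equipped with an isometric pointed map $\delta_M\colon M\to\mathcal F_p(M)$ whose linear span is dense, such that every pointed Lipschitz map $f\colon M\to Y$ into a $p$-Banach space $Y$ has a unique bounded linear extension $\widehat f\colon\mathcal F_p(M)\to Y$ with $\widehat f\,\delta_M=f$, and $\|\widehat f\|=\operatorname{Lip}(f)$. A $p$-Banach space $X$ is $\ell_p$-saturated if every infinite-dimensional closed subspace of $X$ contains a closed subspace linearly isomorphic to $\ell_p$. A bounded linear operator $T\colon E\to Y$ fixes a copy of $\ell_p$ if there is a closed subspace $E_0\subseteq E$, isomorphic to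 $\ell_p$, such that $T|_{E_0}$ is an isomorphic embedding. $T$ is compact if the image of the unit ball is relatively compact. *)

theory Defs
  imports "HOL-Analysis.Analysis" "HOL-Library.Function_Algebras"
begin

instantiation "fun" :: (type, real_vector) real_vector
begin

definition scaleR_fun_def: "c *\<^sub>R f = (\<lambda>x. c *\<^sub>R f x)"

instance
  by standard (simp_all add: scaleR_fun_def fun_eq_iff scaleR_add_right scaleR_add_left)

end

text \<open>
  Spaces are given by a carrier set together with a distance or quasi-norm whose values off the
  carrier are irrelevant.  The locale \<^locale>\<open>Metric_space\<close> demands symmetry and
  nonnegativity off the carrier too, hence the default value 0 there.
\<close>

definition snowflake :: "real \<Rightarrow> 'a set \<Rightarrow> ('a \<Rightarrow> 'a \<Rightarrow> real) \<Rightarrow> 'a \<Rightarrow> 'a \<Rightarrow> real" where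
  "snowflake s M d x y = (if x \<in> M \<and> y \<in> M then d x y powr s else 0)"

definition s_metric_space :: "real \<Rightarrow> 'a set \<Rightarrow> ('a \<Rightarrow> 'a \<Rightarrow> real) \<Rightarrow> bool" where
  "s_metric_space s M d \<longleftrightarrow>
     0 < s \<and> s \<le> 1 \<and> (\<forall>x\<in>M. \<forall>y\<in>M. 0 \<le> d x y) \<and> Metric_space M (snowflake s M d)"

definition pointed_s_metric_space ::
    "real \<Rightarrow> 'a set \<Rightarrow> ('a \<Rightarrow> 'a \<Rightarrow> real) \<Rightarrow> 'a \<Rightarrow> bool" where
  "pointed_s_metric_space s M d b \<longleftrightarrow> s_metric_space s M d \<and> b \<in> M"

definition quasi_normed_space :: "'a::real_vector set \<Rightarrow> ('a \<Rightarrow> real) \<Rightarrow> bool" where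
  "quasi_normed_space V N \<longleftrightarrow>
     subspace V \<and>
     (\<forall>x\<in>V. 0 \<le> N x) \<and>
     (\<forall>x\<in>V. N x = 0 \<longleftrightarrow> x = 0) \<and>
     (\<forall>c. \<forall>x\<in>V. N (c *\<^sub>R x) = \<bar>c\<bar> * N x) \<and>
     (\<exists>C. \<forall>x\<in>V. \<forall>y\<in>V. N (x + y) \<le> C * (N x + N y))"

definition s_normed_space :: "real \<Rightarrow> 'a::real_vector set \<Rightarrow> ('a \<Rightarrow> real) \<Rightarrow> bool" where
  "s_normed_space s V N \<longleftrightarrow>
     0 < s \<and> s \<le> 1 \<and> quasi_normed_space V N \<and>
     (\<forall>x\<in>V. \<forall>y\<in>V. N (x + y) powr s \<le> N x powr s + N y powr s)"

abbreviation s_norm_dist ::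
    "real \<Rightarrow> 'a::real_vector set \<Rightarrow> ('a \<Rightarrow> real) \<Rightarrow> 'a \<Rightarrow> 'a \<Rightarrow> real" where
  "s_norm_dist s V N \<equiv> snowflake s V (\<lambda>x y. N (x - y))"

abbreviation s_topology :: "real \<Rightarrow> 'a::real_vector set \<Rightarrow> ('a \<Rightarrow> real) \<Rightarrow> 'a topology" where
  "s_topology s V N \<equiv> Metric_space.mtopology V (s_norm_dist s V N)"

lemma s_normed_space_Metric_space:
  assumes "s_normed_space s V N"
  shows "Metric_space V (s_norm_dist s V N)"
proof -
  have V: "subspace V" and s: "0 < s"
    and N0: "\<And>x. x \<in> V \<Longrightarrow> N x = 0 \<longleftrightarrow> x = 0"
    and Ns: "\<And>c x. x \<in> V \<Longrightarrow> N (c *\<^sub>R x) = \<bar>c\<bar> * N x"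
    and Nt: "\<And>x y. x \<in> V \<Longrightarrow> y \<in> V \<Longrightarrow> N (x + y) powr s \<le> N x powr s + N y powr s"
    using assms by (auto simp: s_normed_space_def quasi_normed_space_def)
  have diff: "x - y \<in> V" if "x \<in> V" "y \<in> V" for x y
    using V that by (rule subspace_diff)
  have sym: "N (x - y) = N (y - x)" if "x \<in> V" "y \<in> V" for x y
    using Ns[OF diff[OF that(2,1)], of "-1"] by simp
  show ?thesis
  proof
    fix x y z assume xyz: "x \<in> V" "y \<in> V" "z \<in> V"
    show "s_norm_dist s V N x z \<le> s_norm_dist s V N x y + s_norm_dist s V N y z"
      using Nt[OF diff[OF xyz(1,2)] diff[OF xyz(2,3)]] xyz by (simp add: snowflake_def)
  qed (use sym N0 diff in \<open>auto simp: snowflake_def\<close>)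
qed

definition s_Banach_space :: "real \<Rightarrow> 'a::real_vector set \<Rightarrow> ('a \<Rightarrow> real) \<Rightarrow> bool" where
  "s_Banach_space s V N \<longleftrightarrow>
     s_normed_space s V N \<and> Metric_space.mcomplete V (s_norm_dist s V N)"

definition closed_subspace ::
    "real \<Rightarrow> 'a::real_vector set \<Rightarrow> ('a \<Rightarrow> real) \<Rightarrow> 'a set \<Rightarrow> bool" where
  "closed_subspace s V N W \<longleftrightarrow> subspace W \<and> closedin (s_topology s V N) W"

definition infinite_dimensional :: "'a::real_vector set \<Rightarrow> bool" where
  "infinite_dimensional V \<longleftrightarrow> \<not> (\<exists>B. finite B \<and> span B = V)"

definition bounded_operator ::
    "'a::real_vector set \<Rightarrow> ('a \<Rightarrow> real) \<Rightarrow> 'b::real_vector set \<Rightarrow> ('b \<Rightarrow> real) \<Rightarrow> ('a \<Rightarrow> 'b) \<Rightarrow> bool"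
  where
  "bounded_operator V N W N' T \<longleftrightarrow>
     (\<forall>x\<in>V. T x \<in> W) \<and>
     (\<forall>x\<in>V. \<forall>y\<in>V. T (x + y) = T x + T y) \<and>
     (\<forall>c. \<forall>x\<in>V. T (c *\<^sub>R x) = c *\<^sub>R T x) \<and>
     (\<exists>C. \<forall>x\<in>V. N' (T x) \<le> C * N x)"

definition operator_norm ::
    "'a::real_vector set \<Rightarrow> ('a \<Rightarrow> real) \<Rightarrow> ('b::real_vector \<Rightarrow> real) \<Rightarrow> ('a \<Rightarrow> 'b) \<Rightarrow> real" where
  "operator_norm V N N' T = (SUP x\<in>V. N' (T x) / N x)"

definition isomorphism ::
    "'a::real_vector set \<Rightarrow> ('a \<Rightarrow> real) \<Rightarrow> 'b::real_vector set \<Rightarrow> ('b \<Rightarrow> real) \<Rightarrow> ('a \<Rightarrow> 'b) \<Rightarrow> bool"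
  where
  "isomorphism V N W N' T \<longleftrightarrow>
     bounded_operator V N W N' T \<and> bij_betw T V W \<and>
     bounded_operator W N' V N (inv_into V T)"

definition isomorphic_spaces ::
    "'a::real_vector set \<Rightarrow> ('a \<Rightarrow> real) \<Rightarrow> 'b::real_vector set \<Rightarrow> ('b \<Rightarrow> real) \<Rightarrow> bool" where
  "isomorphic_spaces V N W N' \<longleftrightarrow> (\<exists>T. isomorphism V N W N' T)"

definition isomorphic_embedding ::
    "'a::real_vector set \<Rightarrow> ('a \<Rightarrow> real) \<Rightarrow> 'b::real_vector set \<Rightarrow> ('b \<Rightarrow> real) \<Rightarrow> ('a \<Rightarrow> 'b) \<Rightarrow> bool"
  where
  "isomorphic_embedding V N W N' T \<longleftrightarrow> T ` V \<subseteq> W \<and> isomorphism V N (T ` V) N' T"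

text \<open>The topology of the domain does not enter; \<open>s\<close> is the exponent of the target.\<close>

definition compact_operator ::
    "real \<Rightarrow> 'a::real_vector set \<Rightarrow> ('a \<Rightarrow> real) \<Rightarrow> 'b::real_vector set \<Rightarrow> ('b \<Rightarrow> real) \<Rightarrow> ('a \<Rightarrow> 'b) \<Rightarrow> bool"
  where
  "compact_operator s V N W N' T \<longleftrightarrow>
     compactin (s_topology s W N') (s_topology s W N' closure_of (T ` {x \<in> V. N x \<le> 1}))"

definition lp :: "real \<Rightarrow> (nat \<Rightarrow> real) set" where
  "lp p = {x. summable (\<lambda>n. \<bar>x n\<bar> powr p)}"

definition lp_norm :: "real \<Rightarrow> (nat \<Rightarrow> real) \<Rightarrow> real" where
  "lp_norm p x = (\<Sum>n. \<bar>x n\<bar> powr p) powr (1 / p)"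

definition lp_saturated :: "real \<Rightarrow> 'a::real_vector set \<Rightarrow> ('a \<Rightarrow> real) \<Rightarrow> bool" where
  "lp_saturated p V N \<longleftrightarrow>
     (\<forall>W. closed_subspace p V N W \<and> infinite_dimensional W \<longrightarrow>
        (\<exists>Z. closed_subspace p W N Z \<and> isomorphic_spaces (lp p) (lp_norm p) Z N))"

definition fixes_copy_of_lp ::
    "real \<Rightarrow> 'a::real_vector set \<Rightarrow> ('a \<Rightarrow> real) \<Rightarrow> 'b::real_vector set \<Rightarrow> ('b \<Rightarrow> real) \<Rightarrow> ('a \<Rightarrow> 'b) \<Rightarrow> bool"
  where
  "fixes_copy_of_lp p V N W N' T \<longleftrightarrow>
     (\<exists>Z. closed_subspace p V N Z \<and> isomorphic_spaces (lp p) (lp_norm p) Z N \<and>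
          isomorphic_embedding Z N W N' T)"

definition Lipschitz_map ::
    "'a set \<Rightarrow> ('a \<Rightarrow> 'a \<Rightarrow> real) \<Rightarrow> 'b::real_vector set \<Rightarrow> ('b \<Rightarrow> real) \<Rightarrow> ('a \<Rightarrow> 'b) \<Rightarrow> bool" where
  "Lipschitz_map M d W N f \<longleftrightarrow>
     (\<forall>x\<in>M. f x \<in> W) \<and> (\<exists>L. \<forall>x\<in>M. \<forall>y\<in>M. N (f x - f y) \<le> L * d x y)"

definition Lip ::
    "'a set \<Rightarrow> ('a \<Rightarrow> 'a \<Rightarrow> real) \<Rightarrow> ('b::real_vector \<Rightarrow> real) \<Rightarrow> ('a \<Rightarrow> 'b) \<Rightarrow> real" where
  "Lip M d N f = (SUP (x, y) \<in> M \<times> M. N (f x - f y) / d x y)"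

text \<open>
  \<open>is_Lipschitz_free p M d b F N \<delta>\<close>: the space \<open>(F, N)\<close> together with \<open>\<delta>\<close> is the Lipschitz-free
  p-space of the p-metric space \<open>(M, d)\<close> with base point \<open>b\<close>.

  A definition cannot quantify over all types, so the target \<open>Y\<close> of the universal property ranges
  over all p-Banach spaces carried by a linear subspace of the fixed type
  \<^typ>\<open>nat \<Rightarrow> 'a \<Rightarrow> real\<close>.  This loses nothing: that type holds all sequences of finitely
  supported functions on \<open>M\<close>, so a complement of the null sequences in the space of Cauchy
  sequences is a copy in it of the completion of the free vector space over \<open>M\<close> (with the base
  point identified with 0), which is the usual construction of the free p-space.  Comparing with
  this copy through the restricted universal property determines \<open>(F, N)\<close> and \<open>\<delta>\<close> up to linear
  isometry, and hence gives the universal property for targets of every type.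
\<close>

definition is_Lipschitz_free ::
    "real \<Rightarrow> 'a set \<Rightarrow> ('a \<Rightarrow> 'a \<Rightarrow> real) \<Rightarrow> 'a \<Rightarrow>
     'f::real_vector set \<Rightarrow> ('f \<Rightarrow> real) \<Rightarrow> ('a \<Rightarrow> 'f) \<Rightarrow> bool" where
  "is_Lipschitz_free p M d b F N \<delta> \<longleftrightarrow>
     s_Banach_space p F N \<and>
     (\<forall>x\<in>M. \<delta> x \<in> F) \<and> \<delta> b = 0 \<and>
     (\<forall>x\<in>M. \<forall>y\<in>M. N (\<delta> x - \<delta> y) = d x y) \<and>
     s_topology p F N closure_of span (\<delta> ` M) = F \<and>
     (\<forall>(Y :: (nat \<Rightarrow> 'a \<Rightarrow> real) set) NY f.
        s_Banach_space p Y NY \<and> Lipschitz_map M d Y NY f \<and> f b = 0 \<longrightarrow>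
        (\<exists>T. bounded_operator F N Y NY T \<and> (\<forall>x\<in>M. T (\<delta> x) = f x) \<and>
             operator_norm F N NY T = Lip M d NY f \<and>
             (\<forall>T'. bounded_operator F N Y NY T' \<and> (\<forall>x\<in>M. T' (\<delta> x) = f x) \<longrightarrow>
                   (\<forall>v\<in>F. T' v = T v))))"

end

theory Submission
  imports Defs "HOL-Real_Asymp.Real_Asymp"
begin

text \<open>
  By the universal property, the \<open>p\<close>-th power of the norm of \<open>\<F>\<^sub>p(M)\<close> on the span of \<open>\<delta>(M)\<close> is the
  transport cost \<open>inf \<Sum> \<bar>a\<^sub>i\<bar>\<^sup>p d(x\<^sub>i, y\<^sub>i)\<^sup>p\<close> over all representations
  \<open>\<Sum> a\<^sub>i (\<delta>(x\<^sub>i) - \<delta>(y\<^sub>i))\<close>.  Since \<open>d\<^sup>q\<close> is a metric and \<open>p < q\<close>, the metric \<open>d\<^sup>p\<close> is a snowflake,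
  comparable to the sum over all \<open>k \<in> \<int>\<close> of the truncated metrics
  \<open>min (2\<^bsup>k(p - q)\<^esup> d\<^sup>q) 2\<^bsup>kp\<^esup>\<close>.  The transport cost of \<open>d\<^sup>p\<close> is likewise comparable to the sum of the
  truncated transport costs: an optimal flow for a concave cost is a forest, and a forest can be cut at
  random levels into pieces of prescribed diameter.

  A bounded separated sequence in \<open>\<F>\<^sub>p(M)\<close> therefore either has mass escaping to ever new scales \<open>k\<close>,
  or is separated for a bounded metric which is a finite sum of truncated ones, and then has mass
  escaping from neighbourhoods of finite subsets of \<open>M\<close>.  In both cases there are seminorms, with
  \<open>p\<close>-th powers summing to at most a multiple of that of the norm, each of which is bounded below on one
  member of the sequence, so that Rosenthal's disjointification lemma yields a subsequence satisfying
  a lower \<open>p\<close>-estimate.  A bounded operator into \<open>\<F>\<^sub>p(M)\<close> that is not compact maps a bounded sequence to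
  a separated one, hence fixes a copy of \<open>\<ell>\<^sub>p\<close>; the other assertions follow by applying this to
  embeddings.
\<close>

section \<open>Flows and transport costs\<close>

text \<open>For \<open>p < 1\<close> transport costs are not dual to Lipschitz functions, and a
  p-Banach space may have too few functionals to provide lower bounds. Transport costs for smaller
  gauges take their place. They come with additivity for free: a flow for a sum of gauges competes
  for each of them, so gauges summing to at most a multiple of \<open>\<rho>\<close> give seminorms
  whose p-th powers sum to at most that multiple of the p-th power of the norm. Not free is the
  converse, that the scales together recover the norm: near-optimal flows for different truncated
  gauges are unrelated, and forests are what glues them.

  The strict inequality \<open>p < q\<close> enters twice: it makes the sum over scales converge,
  and it makes the short edges of a flow of bounded cost negligible for any finite sum of truncated
  gauges, so that bounded sequences have approximants of bounded mass. For \<open>p = q = 1\<close>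
  and the unit interval the free space is L_1, where saturation fails.\<close>

lemma powr_subadditive:
  fixes a b p :: real
  assumes "0 < p" "p \<le> 1" "0 \<le> a" "0 \<le> b"
  shows "(a + b) powr p \<le> a powr p + b powr p"
proof (cases "a = 0 \<or> b = 0")
  case False
  then have ab: "a > 0" "b > 0" using assms by auto
  have split: "x powr p = x * x powr (p - 1)" if "x > 0" for x :: real
    using that by (simp add: powr_diff)
  have mono: "(a + b) powr (p - 1) \<le> x powr (p - 1)" if "x > 0" "x \<le> a + b" for x
    using that ab assms by (intro powr_mono2') auto
  have "(a + b) powr p = a * (a + b) powr (p - 1) + b * (a + b) powr (p - 1)"
    using split[of "a + b"] ab by (simp add: algebra_simps)
  also have "\<dots> \<le> a * a powr (p - 1) + b * b powr (p - 1)"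
    using ab by (intro add_mono mult_left_mono mono) auto
  finally show ?thesis using split ab by simp
qed auto

lemma abs_powr_triangle:
  fixes a b p :: real
  assumes "0 < p" "p \<le> 1"
  shows "\<bar>a + b\<bar> powr p \<le> \<bar>a\<bar> powr p + \<bar>b\<bar> powr p"
proof -
  have "\<bar>a + b\<bar> powr p \<le> (\<bar>a\<bar> + \<bar>b\<bar>) powr p" using assms by (intro powr_mono2) auto
  also have "\<dots> \<le> \<bar>a\<bar> powr p + \<bar>b\<bar> powr p" using assms by (intro powr_subadditive) auto
  finally show ?thesis .
qed

lemma powr_concave:
  fixes x y u v p :: real
  assumes p: "0 < p" "p \<le> 1" and "0 \<le> x" "0 \<le> y" and uv: "0 \<le> u" "0 \<le> v" "u + v = 1"
  shows "u * x powr p + v * y powr p \<le> (u * x + v * y) powr p"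
proof (cases "u * x + v * y = 0")
  case True
  then have "u * x = 0 \<and> v * y = 0" using assms by (simp add: add_nonneg_eq_0_iff)
  then show ?thesis by auto
next
  case False
  define z where "z = u * x + v * y"
  have z: "z > 0" using False assms unfolding z_def by (simp add: order_less_le)
  \<comment> \<open>The graph of the power lies below its tangent at \<open>z\<close>: weighted
    AM-GM for \<open>t / z\<close> and 1 with weights \<open>p\<close> and \<open>1 - p\<close>. The
    tangent is affine, so averaging it over \<open>x\<close> and \<open>y\<close> gives its value at
    \<open>z\<close>.\<close>
  have tan: "t powr p \<le> z powr p * (p * (t / z) + (1 - p))" if "t \<ge> 0" for t
  proof -
    have "(t / z) powr p * 1 powr (1 - p) \<le> p * (t / z) + (1 - p) * 1"
      by (cases "p = 1"; cases "t = 0") (use p that z Youngs_inequality_0[of p "1 - p" "t / z" 1] in auto)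
    then have "t powr p / z powr p \<le> p * (t / z) + (1 - p)" using that z by (simp add: powr_divide)
    then show ?thesis using z by (simp add: field_simps)
  qed
  have "u * x powr p + v * y powr p
      \<le> u * (z powr p * (p * (x / z) + (1 - p))) + v * (z powr p * (p * (y / z) + (1 - p)))"
    by (intro add_mono mult_left_mono tan) (use assms in auto)
  also have "\<dots> = z powr p * (p * ((u * x + v * y) / z) + (1 - p) * (u + v))"
    by (simp add: algebra_simps add_divide_distrib)
  also have "\<dots> = z powr p" using z uv by (simp flip: z_def)
  finally show ?thesis by (simp add: z_def)
qed

text \<open>A formal sum of weighted edges, kept as a list with repetitions: concatenation then adds
  boundaries and costs exactly, and induction over edges is available. Merging parallel edges could
  only lower a cost, so infima are not affected.\<close>

type_synonym 'a flow = "(real \<times> 'a \<times> 'a) list"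

definition point_mass :: "'a \<Rightarrow> 'a \<Rightarrow> real" where
  "point_mass x = (\<lambda>z. of_bool (z = x))"

definition boundary :: "'a flow \<Rightarrow> 'a \<Rightarrow> real" where
  "boundary l = (\<Sum>(a, x, y)\<leftarrow>l. a *\<^sub>R (point_mass x - point_mass y))"

text \<open>The weight is raised to the power \<open>p\<close> but the gauge is not:
  \<open>c\<close> stands for the p-th power of a distance, and the cost for the p-th power of a
  norm.\<close>

fun cost :: "real \<Rightarrow> ('a \<Rightarrow> 'a \<Rightarrow> real) \<Rightarrow> 'a flow \<Rightarrow> real" where
  "cost p c [] = 0"
| "cost p c ((a, x, y) # l) = \<bar>a\<bar> powr p * c x y + cost p c l"

definition scale_flow :: "real \<Rightarrow> 'a flow \<Rightarrow> 'a flow" where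
  "scale_flow t l = map (\<lambda>(a, x, y). (t * a, x, y)) l"

definition map_flow :: "('a \<Rightarrow> 'b) \<Rightarrow> 'a flow \<Rightarrow> 'b flow" where
  "map_flow f l = map (\<lambda>(a, x, y). (a, f x, f y)) l"

definition nonneg_cost :: "('a \<Rightarrow> 'a \<Rightarrow> real) \<Rightarrow> bool" where
  "nonneg_cost c \<longleftrightarrow> (\<forall>x y. 0 \<le> c x y)"

text \<open>For infinite support the sum is 0 by convention; the functions of interest have finite
  support.\<close>

definition linear_extension :: "('a \<Rightarrow> 'v::real_vector) \<Rightarrow> ('a \<Rightarrow> real) \<Rightarrow> 'v" where
  "linear_extension f m = (\<Sum>x | m x \<noteq> 0. m x *\<^sub>R f x)"

text \<open>Off \<open>range boundary\<close> this is the unspecified infimum of the empty set.\<close>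

definition transport_cost :: "real \<Rightarrow> ('a \<Rightarrow> 'a \<Rightarrow> real) \<Rightarrow> ('a \<Rightarrow> real) \<Rightarrow> real" where
  "transport_cost p c m = Inf (cost p c ` {l. boundary l = m})"

section \<open>Calculus of boundaries and costs\<close>

lemma flow_induct [case_names Nil Cons]:
  assumes "P []" and "\<And>a x y l. P l \<Longrightarrow> P ((a, x, y) # l)"
  shows "P l"
proof (induction l)
  case (Cons e l)
  then show ?case using assms(2) by (cases e) auto
qed (rule assms(1))

lemma boundary_Nil [simp]: "boundary [] = 0"
  by (simp add: boundary_def)

lemma boundary_Cons [simp]:
  "boundary ((a, x, y) # l) = a *\<^sub>R (point_mass x - point_mass y) + boundary l"
  by (simp add: boundary_def)

lemma boundary_Cons_apply:
  "boundary ((a, x, y) # l) z = a * (of_bool (z = x) - of_bool (z = y)) + boundary l z"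
  by (simp add: point_mass_def scaleR_fun_def)

lemma boundary_append [simp]: "boundary (l @ l') = boundary l + boundary l'"
  by (induction l rule: flow_induct) (auto simp: fun_eq_iff)

lemma cost_append [simp]: "cost p c (l @ l') = cost p c l + cost p c l'"
  by (induction l rule: flow_induct) auto

lemma boundary_scale_flow [simp]: "boundary (scale_flow t l) = t *\<^sub>R boundary l"
  by (induction l rule: flow_induct)
    (auto simp: scale_flow_def scaleR_fun_def fun_eq_iff algebra_simps)

lemma cost_scale_flow [simp]: "cost p c (scale_flow t l) = \<bar>t\<bar> powr p * cost p c l"
  by (induction l rule: flow_induct)
    (auto simp: scale_flow_def powr_mult abs_mult algebra_simps)

lemma boundary_filter:
  "boundary (filter P l) + boundary (filter (\<lambda>e. \<not> P e) l) = boundary l"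
  by (induction l rule: flow_induct) (auto simp: fun_eq_iff)

lemma cost_filter: "cost p c (filter P l) + cost p c (filter (\<lambda>e. \<not> P e) l) = cost p c l"
  by (induction l rule: flow_induct) auto

lemma cost_mono:
  assumes "\<And>a x y. (a, x, y) \<in> set l \<Longrightarrow> c x y \<le> c' x y"
  shows "cost p c l \<le> cost p c' l"
  using assms by (induction l rule: flow_induct) (auto intro!: add_mono mult_left_mono)

lemma nonneg_costD: "nonneg_cost c \<Longrightarrow> 0 \<le> c x y"
  by (simp add: nonneg_cost_def)

lemma cost_nonneg:
  assumes "nonneg_cost c"
  shows "0 \<le> cost p c l"
  using assms by (induction l rule: flow_induct) (auto simp: nonneg_cost_def)

lemma cost_filter_le:
  assumes "nonneg_cost c"
  shows "cost p c (filter P l) \<le> cost p c l"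
  using cost_filter[of p c P l] cost_nonneg[OF assms, of p "filter (\<lambda>e. \<not> P e) l"] by simp

lemma cost_cmult: "cost p (\<lambda>x y. k * c x y) l = k * cost p c l"
  by (induction l rule: flow_induct) (auto simp: algebra_simps)

lemma cost_add: "cost p (\<lambda>x y. c x y + c' x y) l = cost p c l + cost p c' l"
  by (induction l rule: flow_induct) (auto simp: algebra_simps)

lemma cost_map_flow: "cost p c (map_flow f l) = cost p (\<lambda>x y. c (f x) (f y)) l"
  by (induction l rule: flow_induct) (auto simp: map_flow_def)

lemma cost_sum: "cost p (\<lambda>x y. \<Sum>j\<in>J. c j x y) l = (\<Sum>j\<in>J. cost p (c j) l)"
proof (induction l)
  case (Cons e l)
  then show ?case by (cases e) (simp add: sum_distrib_left sum.distrib)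
qed auto

lemma boundary_eq_0:
  assumes "z \<notin> (\<Union>(a, x, y)\<in>set l. {x, y})"
  shows "boundary l z = 0"
  using assms by (induction l rule: flow_induct) (auto simp: point_mass_def scaleR_fun_def)

lemma finite_support_boundary: "finite {z. boundary l z \<noteq> 0}"
  by (rule finite_subset[of _ "\<Union>(a, x, y)\<in>set l. {x, y}"])
    (use boundary_eq_0 in fastforce)+

lemma linear_extension_eq_sum:
  assumes "finite A" "{x. m x \<noteq> 0} \<subseteq> A"
  shows "linear_extension f m = (\<Sum>x\<in>A. m x *\<^sub>R f x)"
  unfolding linear_extension_def using assms by (intro sum.mono_neutral_left) auto

lemma linear_extension_add:
  assumes "finite {x. m x \<noteq> 0}" "finite {x. m' x \<noteq> 0}"
  shows "linear_extension f (m + m') = linear_extension f m + linear_extension f m'"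
proof -
  let ?A = "{x. m x \<noteq> 0} \<union> {x. m' x \<noteq> 0}"
  have "linear_extension f n = (\<Sum>x\<in>?A. n x *\<^sub>R f x)" if "{x. n x \<noteq> 0} \<subseteq> ?A" for n
    by (rule linear_extension_eq_sum) (use assms that in auto)
  from this[of m] this[of m'] this[of "m + m'"] show ?thesis
    by (fastforce simp: scaleR_add_left sum.distrib)
qed

lemma linear_extension_scaleR:
  "linear_extension f (t *\<^sub>R m) = t *\<^sub>R linear_extension f m"
  unfolding linear_extension_def by (cases "t = 0") (auto simp: scaleR_fun_def scaleR_sum_right)

lemma linear_extension_point_mass: "linear_extension f (point_mass x) = f x"
  by (simp add: linear_extension_def point_mass_def)

lemma finite_support_point_mass: "finite {z. (t *\<^sub>R (point_mass x - point_mass y)) z \<noteq> 0}"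
  by (rule finite_subset[of _ "{x, y}"]) (auto simp: point_mass_def scaleR_fun_def)

lemma linear_extension_diff_point_mass:
  "linear_extension f (point_mass x - point_mass y) = f x - f y"
proof -
  have "linear_extension f (point_mass x + (-1) *\<^sub>R point_mass y) = f x + (-1) *\<^sub>R f y"
    by (subst linear_extension_add)
      (auto simp only: linear_extension_scaleR linear_extension_point_mass,
       auto simp: point_mass_def scaleR_fun_def)
  then show ?thesis by simp
qed

lemma linear_extension_boundary:
  "linear_extension f (boundary l) = (\<Sum>(a, x, y)\<leftarrow>l. a *\<^sub>R (f x - f y))"
proof (induction l)
  case (Cons e l)
  obtain a x y where e: "e = (a, x, y)" by (cases e)
  have "linear_extension f (boundary (e # l))
      = linear_extension f (a *\<^sub>R (point_mass x - point_mass y)) + linear_extension f (boundary l)"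
    unfolding e boundary_Cons
    by (rule linear_extension_add[OF finite_support_point_mass finite_support_boundary])
  then show ?case
    unfolding Cons e linear_extension_scaleR linear_extension_diff_point_mass
    by (simp only: list.map sum_list.Cons case_prod_conv)
qed (simp add: linear_extension_def)

lemma linear_extension_boundary_point_mass:
  "linear_extension (\<lambda>x. point_mass (f x)) (boundary l) = boundary (map_flow f l)"
  unfolding linear_extension_boundary
  by (simp add: boundary_def map_flow_def comp_def case_prod_unfold)

text \<open>On boundaries, pushing a flow forward is the linear extension of point masses, hence
  depends on the boundary alone. So after a common map a flow may be replaced by another one of the
  same boundary that is cheap for a different reason.\<close>

lemma boundary_map_flow_cong:
  "boundary l = boundary l' \<Longrightarrow> boundary (map_flow f l) = boundary (map_flow f l')"
  by (metis linear_extension_boundary_point_mass)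

lemma sum_boundary_eq_0:
  assumes "finite A" "{x. boundary l x \<noteq> 0} \<subseteq> A"
  shows "(\<Sum>x\<in>A. boundary l x) = 0"
proof -
  have "(\<Sum>x\<in>A. boundary l x) = linear_extension (\<lambda>_. 1 :: real) (boundary l)"
    using linear_extension_eq_sum[OF assms, of "\<lambda>_. 1 :: real"] by simp
  also have "\<dots> = 0" unfolding linear_extension_boundary by (induction l) auto
  finally show ?thesis .
qed

lemma range_boundary_add: "m \<in> range boundary \<Longrightarrow> m' \<in> range boundary \<Longrightarrow> m + m' \<in> range boundary"
  by (elim rangeE) (simp only: boundary_append[symmetric] rangeI)

lemma range_boundary_scaleR: "m \<in> range boundary \<Longrightarrow> t *\<^sub>R m \<in> range boundary"
  by (elim rangeE) (simp only: boundary_scale_flow[symmetric] rangeI)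

lemma subspace_range_boundary: "subspace (range boundary)"
  unfolding subspace_def
  using range_boundary_add range_boundary_scaleR by (metis boundary_Nil rangeI)

section \<open>Transport cost as the p-th power of a seminorm\<close>

lemma bdd_below_cost: "nonneg_cost c \<Longrightarrow> bdd_below (cost p c ` S)"
  by (intro bdd_belowI[of _ 0]) (auto intro: cost_nonneg)

lemma transport_cost_le:
  assumes "nonneg_cost c"
  shows "transport_cost p c (boundary l) \<le> cost p c l"
  unfolding transport_cost_def using assms by (intro cINF_lower bdd_below_cost) auto

lemma transport_cost_less_iff:
  assumes "nonneg_cost c" and "m \<in> range boundary"
  shows "transport_cost p c m < t \<longleftrightarrow> (\<exists>l. boundary l = m \<and> cost p c l < t)"
  unfolding transport_cost_def using assms
  by (subst cINF_less_iff) (auto intro: bdd_below_cost)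

lemma transport_cost_nonneg:
  assumes "nonneg_cost c" and "m \<in> range boundary"
  shows "0 \<le> transport_cost p c m"
  unfolding transport_cost_def using assms by (intro cINF_greatest) (auto intro: cost_nonneg)

lemma transport_cost_add:
  assumes c: "nonneg_cost c" and m: "m \<in> range boundary" "m' \<in> range boundary"
  shows "transport_cost p c (m + m') \<le> transport_cost p c m + transport_cost p c m'"
proof (rule field_le_epsilon)
  fix e :: real assume "e > 0"
  then have e: "transport_cost p c n < transport_cost p c n + e / 2" for n by simp
  from e[of m] obtain l where l: "boundary l = m" "cost p c l < transport_cost p c m + e / 2"
    using transport_cost_less_iff[OF c m(1)] by blast
  from e[of m'] obtain l' where l': "boundary l' = m'" "cost p c l' < transport_cost p c m' + e / 2"
    using transport_cost_less_iff[OF c m(2)] by blast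
  show "transport_cost p c (m + m') \<le> transport_cost p c m + transport_cost p c m' + e"
    using transport_cost_le[OF c, of p "l @ l'"] l l' by simp
qed

lemma transport_cost_zero:
  assumes "nonneg_cost c"
  shows "transport_cost p c 0 = 0"
  using transport_cost_le[of c p "[]"] transport_cost_nonneg[of c 0 p] assms
  by (metis antisym boundary_Nil cost.simps(1) rangeI)

lemma transport_cost_scaleR_le:
  assumes c: "nonneg_cost c" and m: "m \<in> range boundary" and "t \<noteq> 0"
  shows "transport_cost p c (t *\<^sub>R m) \<le> \<bar>t\<bar> powr p * transport_cost p c m"
proof -
  have "transport_cost p c (t *\<^sub>R m) / \<bar>t\<bar> powr p \<le> transport_cost p c m"
    unfolding transport_cost_def[of p c m]
  proof (rule cINF_greatest)
    fix l assume "l \<in> {l. boundary l = m}"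
    then show "transport_cost p c (t *\<^sub>R m) / \<bar>t\<bar> powr p \<le> cost p c l"
      using transport_cost_le[OF c, of p "scale_flow t l"] \<open>t \<noteq> 0\<close> by (simp add: field_simps)
  qed (use m in auto)
  then show ?thesis using \<open>t \<noteq> 0\<close> by (simp add: field_simps)
qed

lemma transport_cost_scaleR:
  assumes c: "nonneg_cost c" and m: "m \<in> range boundary"
  shows "transport_cost p c (t *\<^sub>R m) = \<bar>t\<bar> powr p * transport_cost p c m"
proof (cases "t = 0")
  case False
  have "transport_cost p c (inverse t *\<^sub>R t *\<^sub>R m)
      \<le> \<bar>inverse t\<bar> powr p * transport_cost p c (t *\<^sub>R m)"
    by (rule transport_cost_scaleR_le) (use c m False range_boundary_scaleR in auto)
  then have "transport_cost p c m \<le> transport_cost p c (t *\<^sub>R m) / \<bar>t\<bar> powr p"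
    using False by (simp add: powr_divide inverse_eq_divide)
  then show ?thesis
    using transport_cost_scaleR_le[OF c m False, of p] False by (simp add: field_simps)
qed (use c in \<open>simp add: transport_cost_zero\<close>)

lemma transport_cost_minus:
  assumes c: "nonneg_cost c" and m: "m \<in> range boundary"
  shows "transport_cost p c (- m) = transport_cost p c m"
  using transport_cost_scaleR[OF assms, of p "-1"] by simp

lemma range_boundary_diff: "m \<in> range boundary \<Longrightarrow> m' \<in> range boundary \<Longrightarrow> m - m' \<in> range boundary"
  using subspace_diff[OF subspace_range_boundary] .

lemma range_boundary_sum: "(\<And>i. i \<in> I \<Longrightarrow> m i \<in> range boundary) \<Longrightarrow> sum m I \<in> range boundary"
  using subspace_sum[OF subspace_range_boundary] .

lemma transport_cost_diff:
  assumes c: "nonneg_cost c" and m: "m \<in> range boundary" "m' \<in> range boundary"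
  shows "transport_cost p c (m - m') \<le> transport_cost p c m + transport_cost p c m'"
proof -
  have "- m' \<in> range boundary" using m by (metis range_boundary_scaleR scaleR_minus1_left)
  then show ?thesis
    using transport_cost_add[OF c m(1), of "- m'" p] transport_cost_minus[OF c m(2), of p] by simp
qed

lemma transport_cost_mono:
  assumes c: "nonneg_cost c" "\<And>x y. c x y \<le> c' x y" and m: "m \<in> range boundary"
  shows "transport_cost p c m \<le> transport_cost p c' m"
  unfolding transport_cost_def[of p c' m]
proof (rule cINF_greatest)
  fix l assume "l \<in> {l. boundary l = m}"
  then show "transport_cost p c m \<le> cost p c' l"
    using transport_cost_le[OF c(1), of p l] cost_mono[of l c c' p] c by auto
qed (use m in auto)

lemma transport_cost_cmult:
  assumes c: "nonneg_cost c" and m: "m \<in> range boundary" and "0 \<le> k"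
  shows "transport_cost p (\<lambda>x y. k * c x y) m \<le> k * transport_cost p c m"
proof (cases "k = 0")
  case True
  obtain l where "boundary l = m" using m by auto
  then show ?thesis using True transport_cost_le[of "\<lambda>_ _. 0" p l] cost_cmult[of p 0 c l]
    by (auto simp: nonneg_cost_def)
next
  case False
  then have k: "k > 0" using assms by simp
  have "transport_cost p (\<lambda>x y. k * c x y) m / k \<le> transport_cost p c m"
    unfolding transport_cost_def[of p c m]
  proof (rule cINF_greatest)
    fix l assume "l \<in> {l. boundary l = m}"
    then show "transport_cost p (\<lambda>x y. k * c x y) m / k \<le> cost p c l"
      using transport_cost_le[of "\<lambda>x y. k * c x y" p l] c k cost_cmult[of p k c l]
      by (simp add: field_simps nonneg_cost_def)
  qed (use m in auto)
  then show ?thesis using k by (simp add: field_simps)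
qed

text \<open>A single flow competes for all gauges at once. This easy inequality is behind every
  lower estimate: gauges with a sum controlled by \<open>\<rho>\<close> act like
  coordinates.\<close>

lemma transport_cost_sum_gauges:
  assumes c: "\<And>j. nonneg_cost (c j)" and m: "m \<in> range boundary"
  shows "(\<Sum>j\<in>J. transport_cost p (c j) m) \<le> transport_cost p (\<lambda>x y. \<Sum>j\<in>J. c j x y) m"
  unfolding transport_cost_def[of p "\<lambda>x y. \<Sum>j\<in>J. c j x y"]
proof (rule cINF_greatest)
  fix l assume "l \<in> {l. boundary l = m}"
  then have "(\<Sum>j\<in>J. transport_cost p (c j) m) \<le> (\<Sum>j\<in>J. cost p (c j) l)"
    using transport_cost_le[OF c, of p _ l] by (auto intro: sum_mono)
  then show "(\<Sum>j\<in>J. transport_cost p (c j) m) \<le> cost p (\<lambda>x y. \<Sum>j\<in>J. c j x y) l"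
    by (simp add: cost_sum)
qed (use m in auto)

lemma transport_cost_sum:
  assumes c: "nonneg_cost c" and "finite I" and "\<And>i. i \<in> I \<Longrightarrow> m i \<in> range boundary"
  shows "transport_cost p c (\<Sum>i\<in>I. m i) \<le> (\<Sum>i\<in>I. transport_cost p c (m i))"
  using assms(2,3)
proof (induction I rule: finite_induct)
  case (insert i I)
  then have "transport_cost p c (m i + sum m I) \<le> transport_cost p c (m i) + transport_cost p c (sum m I)"
    by (intro transport_cost_add c range_boundary_sum) auto
  moreover have "transport_cost p c (sum m I) \<le> (\<Sum>i\<in>I. transport_cost p c (m i))"
    using insert by blast
  ultimately show ?case unfolding sum.insert[OF insert(1,2)] by linarith
qed (simp add: transport_cost_zero c)

section \<open>Reduction of flows to forests\<close>

definition pseudo_metric :: "('a \<Rightarrow> 'a \<Rightarrow> real) \<Rightarrow> bool" where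
  "pseudo_metric c \<longleftrightarrow> (\<forall>x y. 0 \<le> c x y) \<and> (\<forall>x. c x x = 0) \<and> (\<forall>x y. c x y = c y x) \<and>
     (\<forall>x y z. c x z \<le> c x y + c y z)"

lemma pseudo_metricI:
  assumes "\<And>x y. 0 \<le> c x y" "\<And>x. c x x = 0" "\<And>x y. c x y = c y x" "\<And>x y z. c x z \<le> c x y + c y z"
  shows "pseudo_metric c"
  using assms unfolding pseudo_metric_def by blast

lemma pseudo_metricD:
  assumes "pseudo_metric c"
  shows "0 \<le> c x y" "c x x = 0" "c x y = c y x" "c x z \<le> c x y + c y z"
  using assms unfolding pseudo_metric_def by blast+

lemma pseudo_metric_imp_nonneg_cost: "pseudo_metric c \<Longrightarrow> nonneg_cost c"
  by (auto simp: pseudo_metric_def nonneg_cost_def)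

lemma pseudo_metric_powr:
  assumes c: "pseudo_metric c" and r: "0 < r" "r \<le> 1"
  shows "pseudo_metric (\<lambda>x y. c x y powr r)"
proof (rule pseudo_metricI)
  fix x y z
  have "c x z powr r \<le> (c x y + c y z) powr r"
    using pseudo_metricD(1,4)[OF c] r by (intro powr_mono2) auto
  also have "\<dots> \<le> c x y powr r + c y z powr r"
    using pseudo_metricD[OF c] r by (intro powr_subadditive) auto
  finally show "c x z powr r \<le> c x y powr r + c y z powr r" .
qed (use pseudo_metricD[OF c] in auto)

section \<open>Concave costs along a line\<close>

lemma abs_add_same_sign:
  fixes A B \<alpha> \<beta> :: real
  assumes "0 \<le> A * B" "0 \<le> \<alpha>" "0 \<le> \<beta>"
  shows "\<alpha> * \<bar>A\<bar> + \<beta> * \<bar>B\<bar> = \<bar>\<alpha> * A + \<beta> * B\<bar>"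
proof -
  consider "0 \<le> A" "0 \<le> B" | "A \<le> 0" "B \<le> 0" using assms(1) by (auto simp: zero_le_mult_iff)
  then show ?thesis
  proof cases
    case 1
    then have "0 \<le> \<alpha> * A" "0 \<le> \<beta> * B" using assms by auto
    then show ?thesis using 1 by simp
  next
    case 2
    then have "\<alpha> * A \<le> 0" "\<beta> * B \<le> 0" using assms by (auto intro: mult_nonneg_nonpos)
    then show ?thesis using 2 by simp
  qed
qed

text \<open>
  The cost is concave on each orthant, so along a line it can be decreased until a coordinate
  vanishes.
\<close>

lemma concave_cost_shift:
  fixes a t w :: "'i \<Rightarrow> real"
  assumes p: "0 < p" "p \<le> 1" and I: "finite I" "i0 \<in> I" "t i0 \<noteq> 0" and w: "\<And>i. i \<in> I \<Longrightarrow> 0 \<le> w i"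
  obtains k where "\<exists>i\<in>I. a i + k * t i = 0"
    "(\<Sum>i\<in>I. w i * \<bar>a i + k * t i\<bar> powr p) \<le> (\<Sum>i\<in>I. w i * \<bar>a i\<bar> powr p)"
proof -
  \<comment> \<open>The parameters at which a moving coordinate vanishes; \<open>k\<close> is always
    taken among them.\<close>
  define Z where "Z = (\<lambda>i. - a i / t i) ` {i\<in>I. t i \<noteq> 0}"
  define \<phi> where "\<phi> k = (\<Sum>i\<in>I. w i * \<bar>a i + k * t i\<bar> powr p)" for k
  have fin: "finite Z" and ne: "Z \<noteq> {}" unfolding Z_def using I by auto
  have zero: "\<exists>i\<in>I. a i + k * t i = 0" if "k \<in> Z" for k
    using that unfolding Z_def by force
  have eq: "a i + k * t i = t i * (k - (- a i / t i))" if "t i \<noteq> 0" for i k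
    using that by (simp add: field_simps)
  \<comment> \<open>If all zeros lie on one side of 0, going to the nearest one increases no
    coordinate in absolute value. Otherwise 0 lies between neighbouring zeros \<open>u\<close> and
    \<open>v\<close>, no coordinate changes sign in between, and by concavity one of the two ends is
    at least as good as 0.\<close>
  have "\<exists>k\<in>Z. \<phi> k \<le> \<phi> 0"
  proof (cases "\<exists>u\<in>Z. \<exists>v\<in>Z. u \<le> 0 \<and> 0 \<le> v")
    case False
    then consider "\<forall>z\<in>Z. z > 0" | "\<forall>z\<in>Z. z < 0" using ne by (metis linorder_le_less_linear)
    then obtain k where k: "k \<in> Z" "\<forall>z\<in>Z. \<bar>k - z\<bar> \<le> \<bar>z\<bar>"
    proof cases
      case 1
      have "\<bar>Min Z - z\<bar> \<le> \<bar>z\<bar>" if "z \<in> Z" for z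
        using 1 that Min_le[OF fin that] Min_in[OF fin ne] by force
      then show ?thesis using that Min_in[OF fin ne] by blast
    next
      case 2
      have "\<bar>Max Z - z\<bar> \<le> \<bar>z\<bar>" if "z \<in> Z" for z
        using 2 that Max_ge[OF fin that] Max_in[OF fin ne] by force
      then show ?thesis using that Max_in[OF fin ne] by blast
    qed
    have "\<bar>a i + k * t i\<bar> \<le> \<bar>a i + 0 * t i\<bar>" if "i \<in> I" for i
    proof (cases "t i = 0")
      case False
      then have "- a i / t i \<in> Z" using that unfolding Z_def by blast
      then have "\<bar>k - (- a i / t i)\<bar> \<le> \<bar>0 - (- a i / t i)\<bar>" using k(2) by auto
      then show ?thesis
        unfolding eq[OF False, of k] eq[OF False, of 0] abs_mult by (intro mult_left_mono) auto
    qed simp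
    then have "\<phi> k \<le> \<phi> 0"
      unfolding \<phi>_def using w p by (intro sum_mono mult_left_mono powr_mono2) auto
    then show ?thesis using k(1) by blast
  next
    case True
    define u v where "u = Max {z\<in>Z. z \<le> 0}" and "v = Min {z\<in>Z. 0 \<le> z}"
    have "u \<in> {z\<in>Z. z \<le> 0}" unfolding u_def using True fin by (intro Max_in) auto
    then have u: "u \<in> Z" "u \<le> 0" by auto
    have "v \<in> {z\<in>Z. 0 \<le> z}" unfolding v_def using True fin by (intro Min_in) auto
    then have v: "v \<in> Z" "0 \<le> v" by auto
    have gap: "z \<le> u \<or> v \<le> z" if "z \<in> Z" for z
    proof (cases "z \<le> 0")
      case True
      then show ?thesis unfolding u_def using that fin by (intro disjI1 Max_ge) auto
    next
      case False
      then show ?thesis unfolding v_def using that fin by (intro disjI2 Min_le) auto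
    qed
    show ?thesis
    proof (cases "u = 0 \<or> v = 0")
      case False
      then have uv: "u < 0" "0 < v" using u v by auto
      define \<alpha> \<beta> where "\<alpha> = v / (v - u)" and "\<beta> = - u / (v - u)"
      have ab: "0 \<le> \<alpha>" "0 \<le> \<beta>" "\<alpha> + \<beta> = 1" "\<alpha> * u + \<beta> * v = 0"
        unfolding \<alpha>_def \<beta>_def using uv
        by (auto simp: divide_nonpos_pos simp flip: diff_divide_distrib)
      have "\<alpha> * \<bar>a i + u * t i\<bar> powr p + \<beta> * \<bar>a i + v * t i\<bar> powr p \<le> \<bar>a i\<bar> powr p" if "i \<in> I" for i
      proof -
        have "0 \<le> (a i + u * t i) * (a i + v * t i)"
        proof (cases "t i = 0")
          case False
          then have "- a i / t i \<in> Z" using that unfolding Z_def by blast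
          then have "- a i / t i \<le> u \<or> v \<le> - a i / t i" by (rule gap)
          then have "0 \<le> (u - (- a i / t i)) * (v - (- a i / t i))"
            using uv by (auto intro: mult_nonneg_nonneg mult_nonpos_nonpos)
          then have "0 \<le> (t i * t i) * ((u - (- a i / t i)) * (v - (- a i / t i)))"
            by (rule mult_nonneg_nonneg[OF zero_le_square])
          also have "\<dots> = (a i + u * t i) * (a i + v * t i)"
            unfolding eq[OF False, of u] eq[OF False, of v] by (simp only: mult_ac)
          finally show ?thesis .
        qed simp
        then have "\<alpha> * \<bar>a i + u * t i\<bar> + \<beta> * \<bar>a i + v * t i\<bar>
            = \<bar>\<alpha> * (a i + u * t i) + \<beta> * (a i + v * t i)\<bar>"
          using ab(1,2) by (rule abs_add_same_sign)
        also have "\<alpha> * (a i + u * t i) + \<beta> * (a i + v * t i)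
            = (\<alpha> + \<beta>) * a i + (\<alpha> * u + \<beta> * v) * t i" by (simp add: algebra_simps)
        also have "\<dots> = a i" by (simp add: ab)
        finally have "(\<alpha> * \<bar>a i + u * t i\<bar> + \<beta> * \<bar>a i + v * t i\<bar>) powr p = \<bar>a i\<bar> powr p" by simp
        with powr_concave[OF p, of "\<bar>a i + u * t i\<bar>" "\<bar>a i + v * t i\<bar>" \<alpha> \<beta>] ab show ?thesis by simp
      qed
      then have "(\<Sum>i\<in>I. w i * (\<alpha> * \<bar>a i + u * t i\<bar> powr p + \<beta> * \<bar>a i + v * t i\<bar> powr p))
          \<le> (\<Sum>i\<in>I. w i * \<bar>a i\<bar> powr p)"
        using w by (intro sum_mono mult_left_mono) auto
      then have le: "\<alpha> * \<phi> u + \<beta> * \<phi> v \<le> \<phi> 0"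
        unfolding \<phi>_def by (simp add: sum_distrib_left algebra_simps sum.distrib)
      have "\<phi> u \<le> \<phi> 0 \<or> \<phi> v \<le> \<phi> 0"
      proof (rule ccontr)
        assume "\<not> ?thesis"
        then have "\<alpha> * \<phi> 0 \<le> \<alpha> * \<phi> u" "\<beta> * \<phi> 0 \<le> \<beta> * \<phi> v" and gt: "\<phi> 0 < \<phi> u" "\<phi> 0 < \<phi> v"
          using ab by (auto intro: mult_left_mono)
        moreover have "0 < \<alpha>" unfolding \<alpha>_def using uv by simp
        ultimately have "\<alpha> * \<phi> 0 < \<alpha> * \<phi> u" by simp
        with \<open>\<beta> * \<phi> 0 \<le> \<beta> * \<phi> v\<close> have "(\<alpha> + \<beta>) * \<phi> 0 < \<alpha> * \<phi> u + \<beta> * \<phi> v"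
          by (simp add: distrib_right)
        with le ab show False by simp
      qed
      then show ?thesis using u v by blast
    qed (use u v in auto)
  qed
  then obtain k where "k \<in> Z" "\<phi> k \<le> \<phi> 0" by blast
  with zero show ?thesis by (intro that[of k]) (auto simp: \<phi>_def)
qed

definition verts :: "'a flow \<Rightarrow> 'a set" where
  "verts l = (\<Union>(a, x, y)\<in>set l. {x, y})"

lemma verts_Nil [simp]: "verts [] = {}"
  and verts_Cons [simp]: "verts ((a, x, y) # l) = insert x (insert y (verts l))"
  and verts_append [simp]: "verts (l @ l') = verts l \<union> verts l'"
  by (auto simp: verts_def)

text \<open>
  Leaves come first: the first endpoint of each edge does not occur in the rest of the list.
\<close>

fun forest :: "'a flow \<Rightarrow> bool" where
  "forest [] \<longleftrightarrow> True"
| "forest ((a, x, y) # l) \<longleftrightarrow> x \<noteq> y \<and> x \<notin> verts l \<and> forest l"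

lemma boundary_map_upt:
  "boundary (map (\<lambda>i. (a i, x i, y i)) [0..<n]) = (\<Sum>i<n. a i *\<^sub>R (point_mass (x i) - point_mass (y i)))"
proof (induction n)
  case (Suc n)
  then show ?case by (simp only: upt_Suc_append zero_le map_append boundary_append sum.lessThan_Suc
      list.map boundary_Cons boundary_Nil add_0_right)
qed simp

lemma cost_map_upt:
  "cost p c (map (\<lambda>i. (a i, x i, y i)) [0..<n]) = (\<Sum>i<n. c (x i) (y i) * \<bar>a i\<bar> powr p)"
  by (induction n) (auto simp: mult.commute)

lemma verts_map_upt: "verts (map (\<lambda>i. (a i, x i, y i)) [0..<n]) = x ` {..<n} \<union> y ` {..<n}"
  by (auto simp: verts_def)

lemma boundary_filter_nonzero: "boundary (filter (\<lambda>(a, x, y). a \<noteq> 0) l) = boundary l"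
  by (induction l rule: flow_induct) auto

lemma cost_filter_nonzero: "cost p c (filter (\<lambda>(a, x, y). a \<noteq> 0) l) = cost p c l"
  by (induction l rule: flow_induct) auto

text \<open>Every vertex meets at least two edges, so counting incidences gives no more vertices
  than edges. The \<open>n\<close> edge vectors lie in the span of the differences to one fixed
  vertex, of dimension below \<open>n\<close>, and are therefore dependent.\<close>

lemma circulation_exists:
  fixes x y :: "nat \<Rightarrow> 'a"
  assumes n: "0 < n" and xy: "\<And>i. i < n \<Longrightarrow> x i \<noteq> y i"
    and deg: "\<And>i v. i < n \<Longrightarrow> v = x i \<or> v = y i \<Longrightarrow> \<exists>j<n. j \<noteq> i \<and> (v = x j \<or> v = y j)"
  obtains t i where "i < n" "t i \<noteq> 0" "(\<Sum>i<n. t i *\<^sub>R (point_mass (x i) - point_mass (y i))) = 0"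
proof -
  define V where "V = x ` {..<n} \<union> y ` {..<n}"
  define f where "f i = point_mass (x i) - point_mass (y i)" for i
  have V: "finite V" unfolding V_def by auto
  have "2 * card V = (\<Sum>v\<in>V. 2)" by simp
  also have "\<dots> \<le> (\<Sum>v\<in>V. card {i\<in>{..<n}. v = x i \<or> v = y i})"
  proof (rule sum_mono)
    fix v assume "v \<in> V"
    then obtain i where i: "i < n" "v = x i \<or> v = y i" unfolding V_def by auto
    from deg[OF this] obtain j where j: "j < n" "j \<noteq> i" "v = x j \<or> v = y j" by blast
    have "card {i, j} \<le> card {i\<in>{..<n}. v = x i \<or> v = y i}"
      using i j by (intro card_mono) auto
    then show "2 \<le> card {i\<in>{..<n}. v = x i \<or> v = y i}" using j by simp
  qed
  also have "\<dots> = (\<Sum>v\<in>V. \<Sum>i<n. of_bool (v = x i \<or> v = y i))"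
    by (subst sum_of_bool_eq) (auto simp: Int_def)
  also have "\<dots> = (\<Sum>i<n. \<Sum>v\<in>V. of_bool (v = x i \<or> v = y i))" by (rule sum.swap)
  also have "\<dots> = (\<Sum>i<n. card {x i, y i})"
  proof (rule sum.cong)
    fix i assume "i \<in> {..<n}"
    then have "V \<inter> {v. v = x i \<or> v = y i} = {x i, y i}" unfolding V_def by auto
    then show "(\<Sum>v\<in>V. of_bool (v = x i \<or> v = y i)) = card {x i, y i}"
      using V by (subst sum_of_bool_eq) auto
  qed simp
  also have "\<dots> = (\<Sum>i<n. 2)" using xy by (intro sum.cong) auto
  finally have card_V: "card V \<le> n" by simp
  show ?thesis
  \<comment> \<open>Linear dependence is a property of sets, so coinciding edge vectors are treated
    apart; they give the relation with coefficients 1 and -1.\<close>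
  proof (cases "inj_on f {..<n}")
    case False
    then obtain i j where ij: "i < n" "j < n" "i \<noteq> j" "f i = f j" unfolding inj_on_def by auto
    define t where "t k = (if k = i then 1 else if k = j then - 1 else 0 :: real)" for k
    have "(\<Sum>k<n. t k *\<^sub>R f k) = (\<Sum>k\<in>{i, j}. t k *\<^sub>R f k)"
      using ij by (intro sum.mono_neutral_right) (auto simp: t_def)
    also have "\<dots> = t i *\<^sub>R f i + t j *\<^sub>R f j" using ij(3) by (subst sum.insert) auto
    also have "\<dots> = 0" unfolding ij(4) scaleR_add_left[symmetric] using ij(3) by (simp add: t_def)
    finally show ?thesis using that[of i t] ij by (simp add: t_def f_def)
  next
    case True
    define T where "T = (\<lambda>v. point_mass v - point_mass (x 0)) ` (V - {x 0})"
    have x0: "x 0 \<in> V" unfolding V_def using n by auto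
    have "card T \<le> card (V - {x 0})" unfolding T_def using V by (intro card_image_le) auto
    also have "\<dots> < card V" using V x0 by (rule card_Diff1_less)
    finally have T: "card T < n" "finite T" using card_V V by (auto simp: T_def)
    have mem: "point_mass v - point_mass (x 0) \<in> span T" if "v \<in> V" for v
    proof (cases "v = x 0")
      case True
      then show ?thesis by (simp only: diff_self span_zero)
    next
      case False
      then show ?thesis using that unfolding T_def by (intro span_base) auto
    qed
    have "f ` {..<n} \<subseteq> span T"
    proof
      fix g assume "g \<in> f ` {..<n}"
      then obtain i where i: "i < n" "g = f i" by auto
      have "(point_mass (x i) - point_mass (x 0)) - (point_mass (y i) - point_mass (x 0)) \<in> span T"
        using i by (intro span_diff mem) (auto simp: V_def)
      then show "g \<in> span T" unfolding i f_def by (simp only: diff_diff_eq2 diff_add_cancel)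
    qed
    moreover have "card (f ` {..<n}) = n" using True by (simp add: card_image)
    ultimately have "dependent (f ` {..<n})"
      using independent_span_bound[OF T(2), of "f ` {..<n}"] T(1) by auto
    then obtain u where u: "\<exists>v\<in>f ` {..<n}. u v \<noteq> 0" "(\<Sum>v\<in>f ` {..<n}. u v *\<^sub>R v) = 0"
      by (subst (asm) dependent_finite) auto
    have "(\<Sum>i<n. u (f i) *\<^sub>R f i) = 0"
      using u(2) by (subst (asm) sum.reindex[OF True]) (simp add: comp_def)
    moreover obtain i where "i < n" "u (f i) \<noteq> 0" using u(1) by auto
    ultimately show ?thesis using that[of i "\<lambda>i. u (f i)"] by (simp add: f_def)
  qed
qed

text \<open>Loops are dropped and edges with a leaf are split off, reversed by symmetry of
  \<open>c\<close> if the leaf is the second endpoint. A list without such edges carries a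
  circulation, along which the concave cost allows some weight to be driven to 0. Tracking
  \<open>verts\<close> ensures that a leaf split off does not reappear in the forest made from the
  rest.\<close>

lemma forest_exists:
  assumes p: "0 < p" "p \<le> 1" and c: "nonneg_cost c" and sym: "\<And>x y. c x y = c y x"
  shows "\<exists>l'. forest l' \<and> boundary l' = boundary l \<and> cost p c l' \<le> cost p c l \<and> verts l' \<subseteq> verts l"
proof (induction "length l" arbitrary: l rule: less_induct)
  case less
  show ?case
  proof (cases "\<exists>l1 l2 a x y. l = l1 @ (a, x, y) # l2 \<and> (x = y \<or> x \<notin> verts (l1 @ l2) \<or> y \<notin> verts (l1 @ l2))")
    case True
    then obtain l1 l2 a x y where l: "l = l1 @ (a, x, y) # l2"
      and xy: "x = y \<or> x \<notin> verts (l1 @ l2) \<or> y \<notin> verts (l1 @ l2)" by blast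
    from less[of "l1 @ l2"] l obtain l' where l': "forest l'" "boundary l' = boundary (l1 @ l2)"
      "cost p c l' \<le> cost p c (l1 @ l2)" "verts l' \<subseteq> verts (l1 @ l2)" by auto
    have bd: "boundary l = a *\<^sub>R (point_mass x - point_mass y) + boundary l'"
      unfolding l l'(2) boundary_append boundary_Cons by (simp only: add_ac)
    have cost_l: "cost p c l = \<bar>a\<bar> powr p * c x y + cost p c (l1 @ l2)" unfolding l by simp
    have vl: "verts l = {x, y} \<union> verts (l1 @ l2)" unfolding l by auto
    show ?thesis
    proof (cases "x = y")
      case True
      have "boundary l' = boundary l"
        unfolding bd True by (simp only: diff_self scaleR_zero_right add_0_left)
      moreover have "0 \<le> \<bar>a\<bar> powr p * c x y" using nonneg_costD[OF c] by simp
      then have "cost p c l' \<le> cost p c l" using l'(3) cost_l by simp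
      ultimately show ?thesis using l' vl by blast
    next
      case False
      show ?thesis
      proof (cases "x \<in> verts (l1 @ l2)")
        case out: False
        have "forest ((a, x, y) # l') \<and> boundary ((a, x, y) # l') = boundary l \<and>
            cost p c ((a, x, y) # l') \<le> cost p c l \<and> verts ((a, x, y) # l') \<subseteq> verts l"
          unfolding bd boundary_Cons using out False l' cost_l vl by auto
        then show ?thesis by blast
      next
        case True
        then have y: "y \<notin> verts (l1 @ l2)" using xy False by blast
        have "(- a) *\<^sub>R (point_mass y - point_mass x) = a *\<^sub>R (point_mass x - point_mass y)"
          by (simp only: scaleR_minus_left scaleR_minus_right[symmetric] minus_diff_eq)
        then have "forest ((- a, y, x) # l') \<and> boundary ((- a, y, x) # l') = boundary l \<and>
            cost p c ((- a, y, x) # l') \<le> cost p c l \<and> verts ((- a, y, x) # l') \<subseteq> verts l"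
          unfolding bd boundary_Cons using y False l' cost_l vl sym[of x y] by auto
        then show ?thesis by blast
      qed
    qed
  next
    case False
    show ?thesis
    proof (cases "l = []")
      case l_ne: False
      have core: "x \<noteq> y \<and> x \<in> verts (l1 @ l2) \<and> y \<in> verts (l1 @ l2)"
        if "l = l1 @ (a, x, y) # l2" for l1 l2 a x y
        using False that by blast
      define n where "n = length l"
      define a x y where "a i = fst (l ! i)" and "x i = fst (snd (l ! i))" and "y i = snd (snd (l ! i))" for i
      have l: "l = map (\<lambda>i. (a i, x i, y i)) [0..<n]"
        by (rule nth_equalityI) (auto simp: n_def a_def x_def y_def)
      have split: "l = take i l @ (a i, x i, y i) # drop (Suc i) l" if "i < n" for i
        using that id_take_nth_drop[of i l] by (simp add: n_def a_def x_def y_def)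
      have in_verts: "\<exists>j<n. j \<noteq> i \<and> (v = x j \<or> v = y j)"
        if i: "i < n" and v: "v \<in> verts (take i l @ drop (Suc i) l)" for i v
      proof -
        obtain e where e: "e \<in> set (take i l) \<or> e \<in> set (drop (Suc i) l)" "v = fst (snd e) \<or> v = snd (snd e)"
          using v unfolding verts_def by fastforce
        from e(1) obtain j where "j < n" "j \<noteq> i" "e = l ! j"
        proof
          assume "e \<in> set (take i l)"
          then obtain j where "j < i" "e = l ! j" by (auto simp: in_set_conv_nth)
          then show ?thesis using that[of j] i by simp
        next
          assume "e \<in> set (drop (Suc i) l)"
          then obtain j where "j < length l - Suc i" "e = l ! (Suc i + j)"
            by (auto simp: in_set_conv_nth)
          then have "Suc i + j < length l" "e = l ! (Suc i + j)" by auto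
          then show ?thesis using that[of "Suc i + j"] by (simp add: n_def)
        qed
        then show ?thesis using e(2) unfolding x_def y_def by blast
      qed
      obtain t i0 where t: "i0 < n" "t i0 \<noteq> 0" "(\<Sum>i<n. t i *\<^sub>R (point_mass (x i) - point_mass (y i))) = 0"
      proof (rule circulation_exists[of n x y])
        show "0 < n" using l_ne by (simp add: n_def)
        show "x i \<noteq> y i" if "i < n" for i using core[OF split[OF that]] by (rule conjunct1)
        show "\<exists>j<n. j \<noteq> i \<and> (v = x j \<or> v = y j)" if "i < n" "v = x i \<or> v = y i" for i v
        proof -
          have "v \<in> verts (take i l @ drop (Suc i) l)" using core[OF split[OF that(1)]] that(2) by auto
          then show ?thesis by (rule in_verts[OF that(1)])
        qed
      qed
      obtain k where k: "\<exists>i\<in>{..<n}. a i + k * t i = 0"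
        "(\<Sum>i<n. c (x i) (y i) * \<bar>a i + k * t i\<bar> powr p) \<le> (\<Sum>i<n. c (x i) (y i) * \<bar>a i\<bar> powr p)"
        using concave_cost_shift[of p "{..<n}" i0 t "\<lambda>i. c (x i) (y i)" a] p t nonneg_costD[OF c] by auto
      define l1 where "l1 = map (\<lambda>i. (a i + k * t i, x i, y i)) [0..<n]"
      \<comment> \<open>Here the list becomes shorter: an edge whose weight has become 0 is removed,
        which changes neither boundary nor cost.\<close>
      define l2 where "l2 = filter (\<lambda>(a, x, y). a \<noteq> 0) l1"
      have "boundary l1 = (\<Sum>i<n. a i *\<^sub>R (point_mass (x i) - point_mass (y i)) +
          k *\<^sub>R (t i *\<^sub>R (point_mass (x i) - point_mass (y i))))"
        unfolding l1_def boundary_map_upt by (simp only: scaleR_add_left scaleR_scaleR)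
      also have "\<dots> = boundary l"
        unfolding sum.distrib scaleR_sum_right[symmetric] t(3) l boundary_map_upt
        by (simp only: scaleR_zero_right add_0_right)
      finally have bd: "boundary l2 = boundary l" unfolding l2_def boundary_filter_nonzero .
      have "cost p c l1 \<le> cost p c l" using k(2) unfolding l1_def l cost_map_upt .
      then have cost2: "cost p c l2 \<le> cost p c l" unfolding l2_def cost_filter_nonzero .
      have "verts l2 \<subseteq> verts l1" unfolding l2_def verts_def by auto
      also have "verts l1 = verts l" unfolding l1_def l verts_map_upt ..
      finally have verts2: "verts l2 \<subseteq> verts l" .
      obtain i where i: "i < n" "a i + k * t i = 0" using k(1) by auto
      have "(a i + k * t i, x i, y i) \<in> set l1" unfolding l1_def using i(1) by auto
      then have "length l2 < length l1"
        unfolding l2_def by (rule length_filter_less) (simp add: i(2))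
      then have "length l2 < length l" by (simp add: l1_def l)
      then obtain l' where "forest l'" "boundary l' = boundary l2" "cost p c l' \<le> cost p c l2"
        "verts l' \<subseteq> verts l2" using less by blast
      then show ?thesis using bd cost2 verts2 by (intro exI[of _ l']) auto
    qed (auto intro!: exI[of _ "[]"])
  qed
qed

section \<open>Snowflakes\<close>

text \<open>First moment argument: the integral over the interval of the total weight of the sets
  containing \<open>t\<close> is at most the sum of \<open>w e * len e\<close>, so some
  \<open>t\<close> does not exceed the mean. The open interval matters later, where levels must be
  strictly positive.\<close>

lemma exists_le_average:
  fixes w len :: "'e \<Rightarrow> real" and A :: "'e \<Rightarrow> real set"
  assumes uv: "u < v" and w: "\<And>e. e \<in> set l \<Longrightarrow> 0 \<le> w e"
    and A: "\<And>e. e \<in> set l \<Longrightarrow> A e \<in> sets lborel"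
    and len: "\<And>e. e \<in> set l \<Longrightarrow> measure lborel (A e \<inter> {u<..<v}) \<le> len e"
  shows "\<exists>t. u < t \<and> t < v \<and> (\<Sum>e\<leftarrow>l. w e * indicator (A e) t) \<le> (\<Sum>e\<leftarrow>l. w e * len e) / (v - u)"
proof (rule ccontr)
  assume contra: "\<not> ?thesis"
  define I where "I = {u<..<v}"
  define k where "k = (\<Sum>e\<leftarrow>l. w e * len e) / (v - u)"
  define G where "G t = (\<Sum>i<length l. w (l ! i) * indicator (A (l ! i) \<inter> I) t)" for t
  have G: "k < G t" if "t \<in> I" for t
    using contra that unfolding k_def G_def I_def
    by (auto simp: sum_list_sum_nth atLeast0LessThan indicator_inter_arith not_le)
  have I: "I \<in> sets lborel" "emeasure lborel I < \<infinity>" "measure lborel I = v - u" "emeasure lborel I \<noteq> 0"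
    unfolding I_def using uv by auto
  have AI: "A (l ! i) \<inter> I \<in> sets lborel" "emeasure lborel (A (l ! i) \<inter> I) < \<infinity>" if "i < length l" for i
  proof -
    show *: "A (l ! i) \<inter> I \<in> sets lborel" using A[of "l ! i"] that I(1) by auto
    have "emeasure lborel (A (l ! i) \<inter> I) \<le> emeasure lborel I"
      using I(1) by (intro emeasure_mono) auto
    then show "emeasure lborel (A (l ! i) \<inter> I) < \<infinity>" using I(2) by (rule order_le_less_trans)
  qed
  have int: "integrable lborel (\<lambda>t. w (l ! i) * indicator (A (l ! i) \<inter> I) t)" if "i < length l" for i
    using AI[OF that] by (intro integrable_mult_right integrable_real_indicator)
  have "integral\<^sup>L lborel G = (\<Sum>i<length l. w (l ! i) * measure lborel (A (l ! i) \<inter> I))"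
    unfolding G_def using int by (subst Bochner_Integration.integral_sum) auto
  also have "\<dots> \<le> (\<Sum>i<length l. w (l ! i) * len (l ! i))"
    using w len unfolding I_def by (intro sum_mono mult_left_mono) auto
  also have "\<dots> = k * (v - u)"
    unfolding k_def using uv by (simp add: sum_list_sum_nth atLeast0LessThan)
  also have "\<dots> = integral\<^sup>L lborel (\<lambda>t. k * indicator I t)" using I by simp
  finally have le: "integral\<^sup>L lborel G \<le> integral\<^sup>L lborel (\<lambda>t. k * indicator I t)" .
  have intI: "integrable lborel (\<lambda>t. k * indicator I t)"
    using I by (intro integrable_mult_right integrable_real_indicator)
  have intG: "integrable lborel G"
    unfolding G_def using int by (intro Bochner_Integration.integrable_sum) auto
  have G0: "G t = 0" if "t \<notin> I" for t unfolding G_def using that by simp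
  have nonneg: "0 \<le> G t - k * indicator I t" for t
    using G[of t] G0[of t] by (cases "t \<in> I") auto
  have "integral\<^sup>L lborel (\<lambda>t. G t - k * indicator I t) \<le> 0"
    using le intI intG by simp
  moreover have "0 \<le> integral\<^sup>L lborel (\<lambda>t. G t - k * indicator I t)"
    using nonneg by (intro integral_nonneg_AE AE_I2)
  \<comment> \<open>Strict excess at every point of the interval contradicts the bound on the
    integral only through null sets: a nonnegative function with integral 0 vanishes almost
    everywhere.\<close>
  ultimately have "AE t in lborel. G t - k * indicator I t = 0"
    using integral_nonneg_eq_0_iff_AE[of lborel "\<lambda>t. G t - k * indicator I t"] intI intG nonneg by auto
  then have "AE t in lborel. t \<notin> I" using G by (elim eventually_mono) force
  then show False using I(1,4) by (simp add: AE_iff_measurable[of I lborel])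
qed

text \<open>
  The function \<open>h\<close> is the depth in the forest; cutting the edges whose depths are separated by the
  levels \<open>\<tau> + s\<int>\<close> leaves pieces of diameter at most \<open>s\<close>, and \<open>\<pi>\<close> sends a vertex to the top of its
  piece.
\<close>

lemma forest_partition:
  assumes c: "pseudo_metric c" and s: "0 < s" and "forest l"
  shows "\<exists>h. (\<forall>(a, x, y)\<in>set l. h x = h y + c x y) \<and>
    (\<forall>\<tau>. \<exists>\<pi>. (\<forall>x. c x (\<pi> x) \<le> s) \<and>
      (\<forall>(a, x, y)\<in>set l. \<lfloor>(h x - \<tau>) / s\<rfloor> = \<lfloor>(h y - \<tau>) / s\<rfloor> \<longrightarrow> \<pi> x = \<pi> y))"
proof -
  \<comment> \<open>Strengthened for the induction: \<open>\<pi> x\<close> lies above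
    \<open>x\<close> in the same slab, so its distance is bounded by a difference of depths, which
    is below \<open>s\<close>. The clauses about \<open>verts\<close> keep a new leaf out of the
    range of the old \<open>\<pi>\<close> on the other points.\<close>
  have "\<exists>h. (\<forall>(a, x, y)\<in>set l. h x = h y + c x y) \<and>
    (\<forall>\<tau>. \<exists>\<pi>. (\<forall>x. c x (\<pi> x) \<le> h x - h (\<pi> x) \<and> \<lfloor>(h x - \<tau>) / s\<rfloor> = \<lfloor>(h (\<pi> x) - \<tau>) / s\<rfloor> \<and>
        (x \<in> verts l \<longrightarrow> \<pi> x \<in> verts l) \<and> (x \<notin> verts l \<longrightarrow> \<pi> x = x)) \<and>
      (\<forall>(a, x, y)\<in>set l. \<lfloor>(h x - \<tau>) / s\<rfloor> = \<lfloor>(h y - \<tau>) / s\<rfloor> \<longrightarrow> \<pi> x = \<pi> y))"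
    using assms(3)
  proof (induction l rule: flow_induct)
    case Nil
    show ?case by (intro exI[of _ "\<lambda>_. 0"] conjI allI exI[of _ id]) (use pseudo_metricD[OF c] in auto)
  next
    case (Cons a v w l)
    then have vw: "v \<noteq> w" "v \<notin> verts l" by auto
    from Cons obtain h where h: "\<forall>(a, x, y)\<in>set l. h x = h y + c x y"
      and part: "\<And>\<tau>. \<exists>\<pi>. (\<forall>x. c x (\<pi> x) \<le> h x - h (\<pi> x) \<and> \<lfloor>(h x - \<tau>) / s\<rfloor> = \<lfloor>(h (\<pi> x) - \<tau>) / s\<rfloor> \<and>
        (x \<in> verts l \<longrightarrow> \<pi> x \<in> verts l) \<and> (x \<notin> verts l \<longrightarrow> \<pi> x = x)) \<and>
      (\<forall>(a, x, y)\<in>set l. \<lfloor>(h x - \<tau>) / s\<rfloor> = \<lfloor>(h y - \<tau>) / s\<rfloor> \<longrightarrow> \<pi> x = \<pi> y)" by auto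
    \<comment> \<open>The leaf is hung below its neighbour; it occurs in no other edge, so the
      remaining depths stay valid.\<close>
    define h' where "h' = h(v := h w + c v w)"
    have verts_l: "x \<in> verts l \<and> y \<in> verts l" if "(a, x, y) \<in> set l" for a x y
      using that unfolding verts_def by force
    have h'_eq: "h' x = h x" if "x \<noteq> v" for x using that by (simp add: h'_def)
    have edges: "\<forall>(a, x, y)\<in>set l. h' x = h x \<and> h' y = h y" using verts_l vw h'_eq by fast
    have "\<exists>\<pi>. (\<forall>x. c x (\<pi> x) \<le> h' x - h' (\<pi> x) \<and> \<lfloor>(h' x - \<tau>) / s\<rfloor> = \<lfloor>(h' (\<pi> x) - \<tau>) / s\<rfloor> \<and>
        (x \<in> verts ((a, v, w) # l) \<longrightarrow> \<pi> x \<in> verts ((a, v, w) # l)) \<and>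
        (x \<notin> verts ((a, v, w) # l) \<longrightarrow> \<pi> x = x)) \<and>
      (\<forall>(a, x, y)\<in>set ((a, v, w) # l). \<lfloor>(h' x - \<tau>) / s\<rfloor> = \<lfloor>(h' y - \<tau>) / s\<rfloor> \<longrightarrow> \<pi> x = \<pi> y)" for \<tau>
    proof -
      obtain \<pi> where \<pi>: "\<And>x. c x (\<pi> x) \<le> h x - h (\<pi> x)"
          "\<And>x. \<lfloor>(h x - \<tau>) / s\<rfloor> = \<lfloor>(h (\<pi> x) - \<tau>) / s\<rfloor>"
          "\<And>x. x \<in> verts l \<Longrightarrow> \<pi> x \<in> verts l" "\<And>x. x \<notin> verts l \<Longrightarrow> \<pi> x = x"
        and same: "\<forall>(a, x, y)\<in>set l. \<lfloor>(h x - \<tau>) / s\<rfloor> = \<lfloor>(h y - \<tau>) / s\<rfloor> \<longrightarrow> \<pi> x = \<pi> y"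
        using part[of \<tau>] by blast
      have ne: "\<pi> x \<noteq> v" if "x \<noteq> v" for x using \<pi>(3,4)[of x] vw(2) that by metis
      \<comment> \<open>The leaf joins the piece of its neighbour unless a level separates them;
        then it starts a piece of its own.\<close>
      define \<pi>' where "\<pi>' = \<pi>(v := if \<lfloor>(h' v - \<tau>) / s\<rfloor> = \<lfloor>(h' w - \<tau>) / s\<rfloor> then \<pi> w else v)"
      have \<pi>'_eq: "\<pi>' x = \<pi> x" if "x \<noteq> v" for x using that by (simp add: \<pi>'_def)
      have w: "h' w = h w" "h' (\<pi> w) = h (\<pi> w)" "\<pi>' w = \<pi> w" and hv: "h' v = h w + c v w"
        using vw ne[of w] by (auto simp: h'_def \<pi>'_def)
      have "c x (\<pi>' x) \<le> h' x - h' (\<pi>' x) \<and> \<lfloor>(h' x - \<tau>) / s\<rfloor> = \<lfloor>(h' (\<pi>' x) - \<tau>) / s\<rfloor> \<and>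
        (x \<in> verts ((a, v, w) # l) \<longrightarrow> \<pi>' x \<in> verts ((a, v, w) # l)) \<and>
        (x \<notin> verts ((a, v, w) # l) \<longrightarrow> \<pi>' x = x)" for x
      proof (cases "x = v")
        case False
        then show ?thesis using \<pi>[of x] ne[of x] h'_eq \<pi>'_eq by (cases "x \<in> verts l") auto
      next
        case True
        show ?thesis
        proof (cases "\<lfloor>(h' v - \<tau>) / s\<rfloor> = \<lfloor>(h' w - \<tau>) / s\<rfloor>")
          case t: True
          then have "\<pi>' v = \<pi> w" by (simp add: \<pi>'_def)
          moreover have "c v (\<pi> w) \<le> h' v - h' (\<pi> w)"
            using pseudo_metricD(4)[OF c, of v "\<pi> w" w] \<pi>(1)[of w] w hv by linarith
          moreover have "\<lfloor>(h' v - \<tau>) / s\<rfloor> = \<lfloor>(h' (\<pi> w) - \<tau>) / s\<rfloor>" using t \<pi>(2)[of w] w by simp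
          moreover have "\<pi> w \<in> verts ((a, v, w) # l)" using \<pi>(3,4)[of w] by auto
          ultimately show ?thesis using True by auto
        next
          case False
          then have "\<pi>' v = v" by (simp add: \<pi>'_def)
          then show ?thesis using True pseudo_metricD(2)[OF c, of v] by auto
        qed
      qed
      moreover have "\<forall>(a, x, y)\<in>set ((a, v, w) # l).
          \<lfloor>(h' x - \<tau>) / s\<rfloor> = \<lfloor>(h' y - \<tau>) / s\<rfloor> \<longrightarrow> \<pi>' x = \<pi>' y"
      proof (clarify)
        fix b x y assume e: "(b, x, y) \<in> set ((a, v, w) # l)"
          and fl: "\<lfloor>(h' x - \<tau>) / s\<rfloor> = \<lfloor>(h' y - \<tau>) / s\<rfloor>"
        show "\<pi>' x = \<pi>' y"
        proof (cases "(b, x, y) \<in> set l")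
          case True
          then have "x \<noteq> v" "y \<noteq> v" using verts_l vw by blast+
          then show ?thesis using same True fl h'_eq \<pi>'_eq by force
        next
          case False
          then have "x = v" "y = w" using e by auto
          then show ?thesis using fl w by (simp add: \<pi>'_def vw)
        qed
      qed
      ultimately show ?thesis by blast
    qed
    moreover have "\<forall>(b, x, y)\<in>set ((a, v, w) # l). h' x = h' y + c x y"
    proof (clarify)
      fix b x y assume e: "(b, x, y) \<in> set ((a, v, w) # l)"
      show "h' x = h' y + c x y"
      proof (cases "(b, x, y) \<in> set l")
        case True
        then have "x \<noteq> v" "y \<noteq> v" using verts_l vw by blast+
        then show ?thesis using h True h'_eq by fastforce
      next
        case False
        then have "x = v" "y = w" using e by auto
        then show ?thesis using vw by (simp add: h'_def)
      qed
    qed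
    ultimately show ?case by blast
  qed
  then obtain h where h: "\<forall>(a, x, y)\<in>set l. h x = h y + c x y"
    and part: "\<And>\<tau>. \<exists>\<pi>. (\<forall>x. c x (\<pi> x) \<le> h x - h (\<pi> x) \<and> \<lfloor>(h x - \<tau>) / s\<rfloor> = \<lfloor>(h (\<pi> x) - \<tau>) / s\<rfloor> \<and>
        (x \<in> verts l \<longrightarrow> \<pi> x \<in> verts l) \<and> (x \<notin> verts l \<longrightarrow> \<pi> x = x)) \<and>
      (\<forall>(a, x, y)\<in>set l. \<lfloor>(h x - \<tau>) / s\<rfloor> = \<lfloor>(h y - \<tau>) / s\<rfloor> \<longrightarrow> \<pi> x = \<pi> y)" by blast
  have small: "a - b \<le> s" if "\<lfloor>(a - \<tau>) / s\<rfloor> = \<lfloor>(b - \<tau>) / s\<rfloor>" for a b \<tau>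
  proof -
    have "(a - \<tau>) / s - (b - \<tau>) / s < 1" using that by linarith
    then show ?thesis using s by (simp add: field_simps)
  qed
  show ?thesis
  proof (intro exI[of _ h] conjI allI)
    fix \<tau>
    obtain \<pi> where \<pi>: "\<And>x. c x (\<pi> x) \<le> h x - h (\<pi> x)" "\<And>x. \<lfloor>(h x - \<tau>) / s\<rfloor> = \<lfloor>(h (\<pi> x) - \<tau>) / s\<rfloor>"
      and same: "\<forall>(a, x, y)\<in>set l. \<lfloor>(h x - \<tau>) / s\<rfloor> = \<lfloor>(h y - \<tau>) / s\<rfloor> \<longrightarrow> \<pi> x = \<pi> y"
      using part[of \<tau>] by blast
    have "c x (\<pi> x) \<le> s" for x using \<pi>(1)[of x] small[OF \<pi>(2)[of x]] by linarith
    with same show "\<exists>\<pi>. (\<forall>x. c x (\<pi> x) \<le> s) \<and>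
      (\<forall>(a, x, y)\<in>set l. \<lfloor>(h x - \<tau>) / s\<rfloor> = \<lfloor>(h y - \<tau>) / s\<rfloor> \<longrightarrow> \<pi> x = \<pi> y)" by blast
  qed (rule h)
qed

text \<open>Modulo \<open>s\<close>, the separating levels form an arc of length \<open>b\<close>.
  In the window from 0 to \<open>s\<close> the arc may wrap around, and covering it by two intervals
  of length \<open>b\<close> gives the factor 2.\<close>

lemma level_crossing_measure:
  fixes a b s :: real
  assumes s: "0 < s" and ab: "0 \<le> b"
  defines "X \<equiv> {\<tau>. \<lfloor>(a + b - \<tau>) / s\<rfloor> \<noteq> \<lfloor>(a - \<tau>) / s\<rfloor>}"
  shows "X \<in> sets lborel" "measure lborel (X \<inter> {0<..<s}) \<le> 2 * min s b"
proof -
  show X: "X \<in> sets lborel" unfolding X_def by measurable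
  have le_s: "measure lborel (X \<inter> {0<..<s}) \<le> s"
  proof -
    have "measure lborel (X \<inter> {0<..<s}) \<le> measure lborel {0<..<s}"
      using s by (intro measure_mono_fmeasurable) (use X in \<open>auto simp: fmeasurable_def\<close>)
    then show ?thesis using s by simp
  qed
  \<comment> \<open>The residue of \<open>a\<close> modulo \<open>s\<close>; passing to it shifts
    both floors by the same integer.\<close>
  define r where "r = a - s * \<lfloor>a / s\<rfloor>"
  have r: "0 \<le> r" "r < s"
  proof -
    have "s * real_of_int \<lfloor>a / s\<rfloor> \<le> s * (a / s)" "s * (a / s) < s * (real_of_int \<lfloor>a / s\<rfloor> + 1)"
      using s by (intro mult_left_mono mult_strict_left_mono; linarith)+
    then show "0 \<le> r" "r < s" unfolding r_def using s by (simp_all add: algebra_simps)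
  qed
  have shift: "\<lfloor>(a + t) / s\<rfloor> = \<lfloor>(r + t) / s\<rfloor> + \<lfloor>a / s\<rfloor>" for t
  proof -
    have "(a + t) / s = (r + t) / s + \<lfloor>a / s\<rfloor>" unfolding r_def using s by (simp add: field_simps)
    then show ?thesis by simp
  qed
  have "measure lborel (X \<inter> {0<..<s}) \<le> 2 * b" if "b < s"
  proof -
    have "X \<inter> {0<..<s} \<subseteq> {r..r + b} \<union> {r - s..r - s + b}"
    proof
      fix \<tau> assume "\<tau> \<in> X \<inter> {0<..<s}"
      then have \<tau>: "0 < \<tau>" "\<tau> < s" "\<lfloor>(r + b - \<tau>) / s\<rfloor> \<noteq> \<lfloor>(r - \<tau>) / s\<rfloor>"
        unfolding X_def using shift[of "b - \<tau>"] shift[of "- \<tau>"] by (auto simp: algebra_simps)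
      show "\<tau> \<in> {r..r + b} \<union> {r - s..r - s + b}"
      proof (rule ccontr)
        assume out: "\<tau> \<notin> {r..r + b} \<union> {r - s..r - s + b}"
        consider "r + b < \<tau>" | "\<tau> < r" using out by fastforce
        then show False
        proof cases
          case 1
          then have "\<lfloor>(r + b - \<tau>) / s\<rfloor> = - 1" "\<lfloor>(r - \<tau>) / s\<rfloor> = - 1"
            using r \<tau> s ab by (auto simp: floor_eq_iff field_simps)
          then show False using \<tau> by simp
        next
          case 2
          then have "r - s + b < \<tau>" using out r \<tau> by auto
          then have "\<lfloor>(r + b - \<tau>) / s\<rfloor> = 0" "\<lfloor>(r - \<tau>) / s\<rfloor> = 0"
            using 2 r \<tau> s ab by (auto simp: floor_eq_iff field_simps)
          then show False using \<tau> by simp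
        qed
      qed
    qed
    then have "measure lborel (X \<inter> {0<..<s}) \<le> measure lborel ({r..r + b} \<union> {r - s..r - s + b})"
      using X by (intro measure_mono_fmeasurable fmeasurable_compact compact_Un) auto
    also have "\<dots> \<le> measure lborel {r..r + b} + measure lborel {r - s..r - s + b}"
      by (intro measure_Un_le) auto
    also have "\<dots> = 2 * b" using ab by simp
    finally show ?thesis .
  qed
  then show "measure lborel (X \<inter> {0<..<s}) \<le> 2 * min s b"
    using le_s s by (cases "b < s") auto
qed

text \<open>The factor \<open>cost p (\<lambda>_ _. 1) l'\<close> plays the role of the total mass of \<open>boundary l\<close>.\<close>

lemma transport_cost_snowflake_le:
  assumes p: "0 < p" "p \<le> 1" and c: "pseudo_metric c" and r: "0 < r" "r \<le> 1" and s: "0 < s"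
    and bd: "boundary l' = boundary l"
  shows "transport_cost p (\<lambda>x y. c x y powr r) (boundary l)
    \<le> 2 * s powr r * cost p (\<lambda>_ _. 1) l' + 6 * s powr (r - 1) * cost p c l"
proof -
  define \<rho> where "\<rho> x y = c x y powr r" for x y
  have \<rho>: "pseudo_metric \<rho>" unfolding \<rho>_def using c r by (rule pseudo_metric_powr)
  obtain f where f: "forest f" "boundary f = boundary l" "cost p c f \<le> cost p c l"
    using forest_exists[OF p pseudo_metric_imp_nonneg_cost[OF c] pseudo_metricD(3)[OF c]] by blast
  obtain h where h: "\<And>a x y. (a, x, y) \<in> set f \<Longrightarrow> h x = h y + c x y"
    and part: "\<And>\<tau>. \<exists>\<pi>. (\<forall>x. c x (\<pi> x) \<le> s) \<and>
      (\<forall>(a, x, y)\<in>set f. \<lfloor>(h x - \<tau>) / s\<rfloor> = \<lfloor>(h y - \<tau>) / s\<rfloor> \<longrightarrow> \<pi> x = \<pi> y)"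
    using forest_partition[OF c s f(1)] by fast
  define A where "A = (\<lambda>(a::real, x, y). {\<tau>. \<lfloor>(h x - \<tau>) / s\<rfloor> \<noteq> \<lfloor>(h y - \<tau>) / s\<rfloor>})"
  \<comment> \<open>\<open>w\<close> bounds the cost of an edge once both ends have moved to the
    tops of their pieces; only edges with different tops contribute. The level \<open>\<tau>\<close>
    is chosen so that the cut edges cost no more than average.\<close>
  define w where "w = (\<lambda>(a::real, x, y). \<bar>a\<bar> powr p * (\<rho> x y + 2 * s powr r))"
  define len where "len = (\<lambda>(a::real, x, y). 2 * min s (c x y))"
  have "\<exists>\<tau>. 0 < \<tau> \<and> \<tau> < s \<and> (\<Sum>e\<leftarrow>f. w e * indicator (A e) \<tau>) \<le> (\<Sum>e\<leftarrow>f. w e * len e) / (s - 0)"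
  proof (rule exists_le_average[OF s])
    fix e assume e: "e \<in> set f"
    obtain a x y where e_eq: "e = (a, x, y)" by (cases e)
    have hx: "h x = h y + c x y" using h e e_eq by blast
    show "0 \<le> w e" unfolding w_def e_eq using pseudo_metricD(1)[OF \<rho>] by simp
    show "A e \<in> sets lborel" "measure lborel (A e \<inter> {0<..<s}) \<le> len e"
      using level_crossing_measure[OF s pseudo_metricD(1)[OF c, of x y], of "h y"]
      unfolding A_def e_eq len_def using hx by auto
  qed
  then obtain \<tau> where \<tau>: "(\<Sum>e\<leftarrow>f. w e * indicator (A e) \<tau>) \<le> (\<Sum>e\<leftarrow>f. w e * len e) / s" by auto
  obtain \<pi> where \<pi>: "\<And>x. c x (\<pi> x) \<le> s"
    and same: "\<And>a x y. (a, x, y) \<in> set f \<Longrightarrow> \<lfloor>(h x - \<tau>) / s\<rfloor> = \<lfloor>(h y - \<tau>) / s\<rfloor> \<Longrightarrow> \<pi> x = \<pi> y"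
    using part[of \<tau>] by fast
  have \<rho>\<pi>: "\<rho> x (\<pi> x) \<le> s powr r" for x
    unfolding \<rho>_def using \<pi>[of x] pseudo_metricD(1)[OF c] r by (intro powr_mono2) auto
  \<comment> \<open>For \<open>c x y \<le> s\<close> the bracket is at most
    \<open>3 * s powr r\<close>. For longer edges
    \<open>\<rho> x y \<le> s powr (r - 1) * c x y\<close> because \<open>r \<le> 1\<close>, and the
    measure of cutting levels is capped by \<open>2 * s\<close>.\<close>
  have "(\<rho> x y + 2 * s powr r) * (2 * min s (c x y)) \<le> 6 * s powr r * c x y" for x y
  proof (cases "c x y \<le> s")
    case True
    then have "\<rho> x y \<le> s powr r"
      unfolding \<rho>_def using pseudo_metricD(1)[OF c] r by (intro powr_mono2) auto
    then have "(\<rho> x y + 2 * s powr r) * (2 * c x y) \<le> (3 * s powr r) * (2 * c x y)"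
      using pseudo_metricD(1)[OF c] by (intro mult_right_mono) auto
    then show ?thesis using True by simp
  next
    case False
    then have "c x y powr (r - 1) \<le> s powr (r - 1)" using r s by (intro powr_mono2') auto
    then have "s * (c x y * c x y powr (r - 1)) \<le> s * (c x y * s powr (r - 1))"
      using s False by (intro mult_left_mono) auto
    moreover have "c x y * c x y powr (r - 1) = \<rho> x y" "s * s powr (r - 1) = s powr r"
      using False s by (auto simp: \<rho>_def powr_diff)
    ultimately have 1: "s * \<rho> x y \<le> s powr r * c x y" by (metis mult.left_commute mult.commute)
    have 2: "s powr r * s \<le> s powr r * c x y" using False by (intro mult_left_mono) auto
    have "min s (c x y) = s" using False by simp
    then show ?thesis using 1 2 by (simp add: algebra_simps)
  qed
  then have "w e * len e \<le> (case e of (a, x, y) \<Rightarrow> \<bar>a\<bar> powr p * (6 * s powr r * c x y))" for e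
    unfolding w_def len_def by (cases e) (simp add: mult.assoc mult_left_mono)
  then have "(\<Sum>e\<leftarrow>f. w e * len e) \<le> (\<Sum>e\<leftarrow>f. case e of (a, x, y) \<Rightarrow> \<bar>a\<bar> powr p * (6 * s powr r * c x y))"
    by (intro sum_list_mono) auto
  also have "\<dots> = 6 * s powr r * cost p c f"
    by (induction f rule: flow_induct) (auto simp: algebra_simps)
  also have "\<dots> \<le> 6 * s powr r * cost p c l" using f(3) by (intro mult_left_mono) auto
  finally have "(\<Sum>e\<leftarrow>f. w e * len e) / s \<le> (6 * s powr r * cost p c l) / s"
    using s by (intro divide_right_mono) auto
  also have "\<dots> = 6 * s powr (r - 1) * cost p c l" using s by (simp add: powr_diff)
  finally have cut: "(\<Sum>e\<leftarrow>f. w e * indicator (A e) \<tau>) \<le> 6 * s powr (r - 1) * cost p c l"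
    using \<tau> by linarith
  have mapf: "cost p \<rho> (map_flow \<pi> f) \<le> (\<Sum>e\<leftarrow>f. w e * indicator (A e) \<tau>)"
  proof -
    have "\<rho> (\<pi> x) (\<pi> y) * \<bar>a\<bar> powr p \<le> w (a, x, y) * indicator (A (a, x, y)) \<tau>"
      if "(a, x, y) \<in> set f" for a x y
    proof (cases "\<tau> \<in> A (a, x, y)")
      case True
      have "\<rho> (\<pi> x) (\<pi> y) \<le> \<rho> (\<pi> x) x + \<rho> x y + \<rho> y (\<pi> y)"
        using pseudo_metricD(4)[OF \<rho>, of "\<pi> x" "\<pi> y" x] pseudo_metricD(4)[OF \<rho>, of x "\<pi> y" y] by linarith
      also have "\<dots> \<le> \<rho> x y + 2 * s powr r"
        using \<rho>\<pi>[of x] \<rho>\<pi>[of y] pseudo_metricD(3)[OF \<rho>, of x "\<pi> x"] by linarith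
      finally show ?thesis using True by (simp add: w_def mult.commute mult_left_mono)
    next
      case False
      then have "\<pi> x = \<pi> y" using same[OF that] by (auto simp: A_def)
      then show ?thesis using False pseudo_metricD(2)[OF \<rho>] by simp
    qed
    then show ?thesis unfolding cost_map_flow
    proof (induction f rule: flow_induct)
      case (Cons a x y f)
      from Cons.prems[of a x y] Cons.IH Cons.prems show ?case by (fastforce simp: mult.commute)
    qed simp
  qed
  \<comment> \<open>The flow \<open>l'\<close>, useful for its small mass, only brings mass to the
    tops of the pieces and back, at \<open>s powr r\<close> per end. Between the tops, its image and
    that of the forest \<open>f\<close> have the same boundary, and the cheaper forest is
    used.\<close>
  define g1 where "g1 = map (\<lambda>(a, x, y). (a, x, \<pi> x)) l'"
  define g2 where "g2 = map (\<lambda>(a, x, y). (a, \<pi> y, y)) l'"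
  have g: "boundary g1 + boundary g2 + boundary (map_flow \<pi> l') = boundary l'"
    unfolding g1_def g2_def map_flow_def
    by (induction l' rule: flow_induct) (auto simp: fun_eq_iff boundary_Cons_apply algebra_simps simp del: boundary_Cons)
  have step: "\<bar>a\<bar> powr p * \<rho> x (\<pi> x) \<le> s powr r * \<bar>a\<bar> powr p" for a x
    using mult_right_mono[OF \<rho>\<pi>[of x], of "\<bar>a\<bar> powr p"] by (simp add: mult.commute)
  have "cost p \<rho> g1 \<le> s powr r * cost p (\<lambda>_ _. 1) l'"
    unfolding g1_def
    by (induction l' rule: flow_induct) (auto simp: distrib_left intro!: add_mono step)
  moreover have "cost p \<rho> g2 \<le> s powr r * cost p (\<lambda>_ _. 1) l'"
    unfolding g2_def
    by (induction l' rule: flow_induct)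
      (auto simp: distrib_left pseudo_metricD(3)[OF \<rho>, of "\<pi> _"] intro!: add_mono step)
  ultimately have "cost p \<rho> (g1 @ g2 @ map_flow \<pi> f)
      \<le> 2 * s powr r * cost p (\<lambda>_ _. 1) l' + 6 * s powr (r - 1) * cost p c l"
    using mapf cut by simp
  moreover have "boundary (g1 @ g2 @ map_flow \<pi> f) = boundary l"
    using g boundary_map_flow_cong[of f l' \<pi>] f(2) bd by (simp add: add.assoc)
  ultimately show ?thesis
    using transport_cost_le[OF pseudo_metric_imp_nonneg_cost[OF \<rho>], of p "g1 @ g2 @ map_flow \<pi> f"]
    unfolding \<rho>_def by simp
qed

section \<open>Scales\<close>

lemma infinite_disjoint_subsets:
  fixes A :: "nat set"
  assumes "infinite A"
  obtains P :: "nat \<Rightarrow> nat set" where "\<And>k. P k \<subseteq> A" "\<And>k. infinite (P k)"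
    "\<And>k l. k \<noteq> l \<Longrightarrow> P k \<inter> P l = {}"
proof
  define f where "f k i = enumerate A (prod_encode (k, i))" for k i
  have inj: "f k i = f l j \<longleftrightarrow> k = l \<and> i = j" for k i l j
    unfolding f_def using inj_enumerate[OF assms] by (simp add: inj_eq)
  show "range (f k) \<subseteq> A" for k unfolding f_def using enumerate_in_set[OF assms] by auto
  show "infinite (range (f k))" for k using inj by (intro range_inj_infinite injI) auto
  show "range (f k) \<inter> range (f l) = {}" if "k \<noteq> l" for k l using inj that by auto
qed

text \<open>A budget argument. The index set is split into infinitely many infinite pieces. If every
  piece fails, an offending index \<open>i k\<close> with its set \<open>J k\<close> is picked in
  each; on the new index set \<open>range i\<close> the sums at \<open>i k\<close> have lost
  \<open>\<delta>\<close>, because \<open>J k\<close> contains no \<open>i l\<close>. The budget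
  \<open>B\<close> allows this only finitely often.\<close>

lemma rosenthal_disjointification:
  fixes b :: "nat \<Rightarrow> nat \<Rightarrow> real"
  assumes b: "\<And>j i. 0 \<le> b j i" and \<delta>: "0 < \<delta>"
    and B: "\<And>i J. finite J \<Longrightarrow> (\<Sum>j\<in>J. b j i) \<le> B"
  obtains I where "infinite I" "\<And>i J. i \<in> I \<Longrightarrow> finite J \<Longrightarrow> J \<subseteq> I - {i} \<Longrightarrow> (\<Sum>j\<in>J. b j i) \<le> \<delta>"
proof -
  have step: "\<exists>I. infinite I \<and> (\<forall>i\<in>I. \<forall>J. finite J \<longrightarrow> J \<subseteq> I - {i} \<longrightarrow> (\<Sum>j\<in>J. b j i) \<le> \<delta>)"
    if "infinite A" "\<And>i J. i \<in> A \<Longrightarrow> finite J \<Longrightarrow> J \<subseteq> A \<Longrightarrow> (\<Sum>j\<in>J. b j i) \<le> real n * \<delta>" for A n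
    using that
  proof (induction n arbitrary: A)
    case 0
    have "(\<Sum>j\<in>J. b j i) \<le> \<delta>" if "i \<in> A" "finite J" "J \<subseteq> A - {i}" for i J
    proof -
      have "J \<subseteq> A" using that(3) by blast
      from "0.prems"(2)[OF that(1,2) this] \<delta> show ?thesis by simp
    qed
    with "0.prems"(1) show ?case by blast
  next
    case (Suc n)
    obtain P :: "nat \<Rightarrow> nat set" where P: "\<And>k. P k \<subseteq> A" "\<And>k. infinite (P k)" "\<And>k l. k \<noteq> l \<Longrightarrow> P k \<inter> P l = {}"
      using infinite_disjoint_subsets[OF Suc.prems(1)] by blast
    show ?case
    proof (cases "\<exists>k. \<forall>i\<in>P k. \<forall>J. finite J \<longrightarrow> J \<subseteq> P k - {i} \<longrightarrow> (\<Sum>j\<in>J. b j i) \<le> \<delta>")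
      case True
      then show ?thesis using P(2) by blast
    next
      case False
      then have "\<forall>k. \<exists>i J. i \<in> P k \<and> finite J \<and> J \<subseteq> P k - {i} \<and> \<delta> < (\<Sum>j\<in>J. b j i)"
        unfolding not_le[symmetric] by blast
      then obtain i J where iJ: "\<And>k. i k \<in> P k" "\<And>k. finite (J k)" "\<And>k. J k \<subseteq> P k - {i k}"
        "\<And>k. \<delta> < (\<Sum>j\<in>J k. b j (i k))" by metis
      have inj: "i k = i l \<longleftrightarrow> k = l" for k l
      proof
        assume "i k = i l"
        then have "i k \<in> P k \<inter> P l" using iJ(1)[of k] iJ(1)[of l] by simp
        then show "k = l" using P(3)[of k l] by blast
      qed simp
      have "infinite (range i)" using inj by (intro range_inj_infinite injI) auto
      moreover have "(\<Sum>j\<in>J'. b j x) \<le> real n * \<delta>" if x: "x \<in> range i" "finite J'" "J' \<subseteq> range i" for x J'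
      proof -
        obtain k where k: "x = i k" using x by blast
        have disj: "J' \<inter> J k = {}"
        proof (rule ccontr)
          assume "J' \<inter> J k \<noteq> {}"
          then obtain l where l: "i l \<in> J k" using x(3) by blast
          then have "i l \<in> P k" "i l \<noteq> i k" using iJ(3)[of k] by auto
          then show False using iJ(1)[of l] P(3)[of l k] inj[of l k] by auto
        qed
        have "J' \<union> J k \<subseteq> A" using x iJ(1,3) P(1) by blast
        moreover have "i k \<in> A" using iJ(1) P(1) by blast
        ultimately have "(\<Sum>j\<in>J' \<union> J k. b j (i k)) \<le> real (Suc n) * \<delta>"
          using Suc.prems(2)[of "i k" "J' \<union> J k"] x(2) iJ(2) by blast
        then show ?thesis using iJ(4)[of k] x(2) iJ(2) disj
          by (simp add: sum.union_disjoint k algebra_simps)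
      qed
      ultimately show ?thesis by (rule Suc.IH)
    qed
  qed
  obtain n where n: "B < real n * \<delta>" using reals_Archimedean3[OF \<delta>] by blast
  have "\<exists>I. infinite I \<and> (\<forall>i\<in>I. \<forall>J. finite J \<longrightarrow> J \<subseteq> I - {i} \<longrightarrow> (\<Sum>j\<in>J. b j i) \<le> \<delta>)"
  proof (rule step[of UNIV n])
    show "(\<Sum>j\<in>J. b j i) \<le> real n * \<delta>" if "finite J" for i J
      using B[OF that, of i] n by linarith
  qed simp
  then obtain I where I: "infinite I"
    "\<forall>i\<in>I. \<forall>J. finite J \<longrightarrow> J \<subseteq> I - {i} \<longrightarrow> (\<Sum>j\<in>J. b j i) \<le> \<delta>" by blast
  show ?thesis
  proof (rule that[OF I(1)])
    show "(\<Sum>j\<in>J. b j i) \<le> \<delta>" if "i \<in> I" "finite J" "J \<subseteq> I - {i}" for i J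
      using I(2) that by simp
  qed
qed

text \<open>The gauge \<open>c j\<close> detects \<open>u j\<close>, and Rosenthal's lemma thins the
  sequence until the other gauges together see at most \<open>\<theta> / 2\<close> of each vector.
  Adding up the reverse triangle inequalities over \<open>j\<close> and exchanging sums leaves half
  of \<open>\<theta>\<close>; the gauges together cost the factor \<open>C\<close>.\<close>

lemma lower_p_estimate:
  fixes \<rho> :: "'a \<Rightarrow> 'a \<Rightarrow> real" and u :: "nat \<Rightarrow> 'a \<Rightarrow> real"
  assumes p: "0 < p" and \<rho>: "nonneg_cost \<rho>" and c: "\<And>j. nonneg_cost (c j)"
    and C: "0 < C" "\<And>J x y. finite J \<Longrightarrow> (\<Sum>j\<in>J. c j x y) \<le> C * \<rho> x y"
    and u: "\<And>j. u j \<in> range boundary" "\<And>j. transport_cost p \<rho> (u j) \<le> B"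
    and \<theta>: "0 < \<theta>" "\<And>j. \<theta> \<le> transport_cost p (c j) (u j)"
  obtains r :: "nat \<Rightarrow> nat" and \<kappa> where "strict_mono r" "0 < \<kappa>"
    "\<And>n a. \<kappa> * (\<Sum>i<n. \<bar>a i\<bar> powr p) \<le> transport_cost p \<rho> (\<Sum>i<n. a i *\<^sub>R u (r i))"
proof -
  define b where "b j i = transport_cost p (c j) (u i)" for j i
  have total: "(\<Sum>j\<in>J. transport_cost p (c j) m) \<le> C * transport_cost p \<rho> m"
    if "finite J" "m \<in> range boundary" for J m
  proof -
    have "nonneg_cost (\<lambda>x y. \<Sum>j\<in>J. c j x y)"
      using c by (auto simp: nonneg_cost_def intro!: sum_nonneg)
    then have "transport_cost p (\<lambda>x y. \<Sum>j\<in>J. c j x y) m \<le> transport_cost p (\<lambda>x y. C * \<rho> x y) m"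
      using C(2)[OF that(1)] that(2) by (intro transport_cost_mono) auto
    also have "\<dots> \<le> C * transport_cost p \<rho> m" using \<rho> that C(1) by (intro transport_cost_cmult) auto
    finally show ?thesis using transport_cost_sum_gauges[of c m p J, OF c that(2)] by linarith
  qed
  have b_nonneg: "0 \<le> b j i" for j i unfolding b_def using c u(1) by (rule transport_cost_nonneg)
  have "(\<Sum>j\<in>J. b j i) \<le> C * B" if "finite J" for J i
    using total[OF that u(1)[of i]] mult_left_mono[OF u(2)[of i], of C] C(1) unfolding b_def by linarith
  then obtain I where I: "infinite I"
    "\<And>i J. i \<in> I \<Longrightarrow> finite J \<Longrightarrow> J \<subseteq> I - {i} \<Longrightarrow> (\<Sum>j\<in>J. b j i) \<le> \<theta> / 2"
    using rosenthal_disjointification[of b "\<theta> / 2" "C * B"] b_nonneg \<theta>(1) by auto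
  define r where "r = enumerate I"
  have r: "strict_mono r" "r i \<in> I" for i
    unfolding r_def using I(1) by (auto simp: strict_mono_enumerate enumerate_in_set)
  have inj: "r i = r j \<longleftrightarrow> i = j" for i j using strict_mono_eq[OF r(1)] .
  have "\<theta> / (2 * C) * (\<Sum>i<n. \<bar>a i\<bar> powr p) \<le> transport_cost p \<rho> (\<Sum>i<n. a i *\<^sub>R u (r i))" for n a
  proof -
    define v where "v = (\<Sum>i<n. a i *\<^sub>R u (r i))"
    have mem: "a i *\<^sub>R u (r i) \<in> range boundary" for i using u(1) by (rule range_boundary_scaleR)
    have v: "v \<in> range boundary" unfolding v_def using mem by (intro range_boundary_sum)
    have low: "\<theta> * \<bar>a j\<bar> powr p \<le> transport_cost p (c (r j)) v +
        (\<Sum>i\<in>{..<n} - {j}. \<bar>a i\<bar> powr p * b (r j) (r i))" if "j < n" for j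
    proof -
      define w where "w = (\<Sum>i\<in>{..<n} - {j}. a i *\<^sub>R u (r i))"
      have w: "w \<in> range boundary" unfolding w_def using mem by (intro range_boundary_sum)
      have "a j *\<^sub>R u (r j) + w = v"
        unfolding v_def w_def using that by (intro sum.remove[symmetric]) auto
      then have diff: "a j *\<^sub>R u (r j) = v - w" by (metis add_diff_cancel_right')
      have "\<theta> * \<bar>a j\<bar> powr p \<le> \<bar>a j\<bar> powr p * transport_cost p (c (r j)) (u (r j))"
        using mult_right_mono[OF \<theta>(2)[of "r j"], of "\<bar>a j\<bar> powr p"] by (simp add: mult.commute)
      also have "\<dots> = transport_cost p (c (r j)) (v - w)"
        unfolding diff[symmetric] using c u(1) by (intro transport_cost_scaleR[symmetric])
      also have "\<dots> \<le> transport_cost p (c (r j)) v + transport_cost p (c (r j)) w"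
        using c v w by (rule transport_cost_diff)
      also have "transport_cost p (c (r j)) w \<le>
          (\<Sum>i\<in>{..<n} - {j}. transport_cost p (c (r j)) (a i *\<^sub>R u (r i)))"
        unfolding w_def using c mem by (intro transport_cost_sum) auto
      also have "\<dots> = (\<Sum>i\<in>{..<n} - {j}. \<bar>a i\<bar> powr p * b (r j) (r i))"
        unfolding b_def using transport_cost_scaleR[OF c u(1)] by simp
      finally show ?thesis by simp
    qed
    have "\<theta> * (\<Sum>j<n. \<bar>a j\<bar> powr p) \<le> (\<Sum>j<n. transport_cost p (c (r j)) v +
        (\<Sum>i\<in>{..<n} - {j}. \<bar>a i\<bar> powr p * b (r j) (r i)))"
      unfolding sum_distrib_left using low by (intro sum_mono) auto
    also have "\<dots> = (\<Sum>j\<in>r ` {..<n}. transport_cost p (c j) v) +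
        (\<Sum>j<n. \<Sum>i\<in>{..<n} - {j}. \<bar>a i\<bar> powr p * b (r j) (r i))"
      using inj by (subst sum.reindex) (auto simp: sum.distrib inj_on_def)
    also have "\<dots> \<le> C * transport_cost p \<rho> v + (\<Sum>j<n. \<Sum>i\<in>{..<n} - {j}. \<bar>a i\<bar> powr p * b (r j) (r i))"
      using total[OF _ v, of "r ` {..<n}"] by simp
    also have "(\<Sum>j<n. \<Sum>i\<in>{..<n} - {j}. \<bar>a i\<bar> powr p * b (r j) (r i)) =
        (\<Sum>j<n. \<Sum>i | i \<in> {..<n} \<and> i \<noteq> j. \<bar>a i\<bar> powr p * b (r j) (r i))"
      by (intro sum.cong) auto
    also have "\<dots> = (\<Sum>i<n. \<Sum>j | j \<in> {..<n} \<and> i \<noteq> j. \<bar>a i\<bar> powr p * b (r j) (r i))"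
      by (intro sum.swap_restrict) auto
    also have "\<dots> \<le> (\<Sum>i<n. \<bar>a i\<bar> powr p * (\<theta> / 2))"
    proof (rule sum_mono)
      fix i
      have "(\<Sum>j\<in>r ` {j \<in> {..<n}. i \<noteq> j}. b j (r i)) \<le> \<theta> / 2"
        using r(2) inj by (intro I(2)) auto
      then have "(\<Sum>j | j \<in> {..<n} \<and> i \<noteq> j. b (r j) (r i)) \<le> \<theta> / 2"
        using inj by (subst (asm) sum.reindex) (auto simp: inj_on_def)
      then show "(\<Sum>j | j \<in> {..<n} \<and> i \<noteq> j. \<bar>a i\<bar> powr p * b (r j) (r i)) \<le> \<bar>a i\<bar> powr p * (\<theta> / 2)"
        unfolding sum_distrib_left[symmetric] by (intro mult_left_mono) auto
    qed
    also have "\<dots> = \<theta> / 2 * (\<Sum>i<n. \<bar>a i\<bar> powr p)" by (simp add: sum_distrib_left mult.commute)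
    finally show ?thesis using C(1) unfolding v_def by (simp add: field_simps)
  qed
  then show ?thesis using that[of r "\<theta> / (2 * C)"] r(1) \<theta>(1) C(1) by simp
qed

text \<open>The gauge lives on the whole type. A space with carrier \<open>M\<close> enters through
  \<open>d (r x) (r y)\<close>, where \<open>r\<close> sends points off \<open>M\<close> to the base
  point; this is why pseudo-metrics occur.\<close>

locale snowflake_space =
  fixes p q :: real and d :: "'a \<Rightarrow> 'a \<Rightarrow> real"
  assumes p_pos: "0 < p" and p_less_q: "p < q" and q_le_1: "q \<le> 1"
    and d_nonneg: "\<And>x y. 0 \<le> d x y" and d_metric: "pseudo_metric (\<lambda>x y. d x y powr q)"
begin

definition \<sigma> :: "'a \<Rightarrow> 'a \<Rightarrow> real" where "\<sigma> x y = d x y powr q"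
definition \<rho> :: "'a \<Rightarrow> 'a \<Rightarrow> real" where "\<rho> x y = d x y powr p"

text \<open>At \<open>d x y = u\<close> both terms equal \<open>\<rho> x y\<close>, so each
  truncated metric touches \<open>\<rho>\<close> at its own scale and lies below it elsewhere. Being
  the minimum of a multiple of the metric \<open>\<sigma>\<close> and a constant, it is again a
  pseudo-metric.\<close>

definition truncated :: "real \<Rightarrow> 'a \<Rightarrow> 'a \<Rightarrow> real" where
  "truncated u x y = min (u powr (p - q) * \<sigma> x y) (u powr p)"

abbreviation scale :: "int \<Rightarrow> real" where "scale k \<equiv> 2 powr real_of_int k"

section \<open>Decomposition of the snowflake metric into truncated metrics\<close>

lemma p_le_1: "p \<le> 1" using p_less_q q_le_1 by simp
lemma q_pos: "0 < q" using p_pos p_less_q by simp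

lemma \<sigma>_metric: "pseudo_metric \<sigma>" unfolding \<sigma>_def[abs_def] by (rule d_metric)

lemma \<rho>_eq: "\<rho> x y = \<sigma> x y powr (p / q)"
  unfolding \<rho>_def \<sigma>_def using q_pos by (simp add: powr_powr)

lemma \<rho>_metric: "pseudo_metric \<rho>"
  using pseudo_metric_powr[OF \<sigma>_metric, of "p / q"] p_pos p_less_q q_pos by (simp add: \<rho>_eq[abs_def])

lemma nonneg_costs: "nonneg_cost \<sigma>" "nonneg_cost \<rho>" "nonneg_cost (truncated u)"
  by (auto simp: nonneg_cost_def \<sigma>_def \<rho>_def truncated_def)

lemma truncated_metric: "pseudo_metric (truncated u)"
proof (rule pseudo_metricI)
  fix x y z
  have "u powr (p - q) * \<sigma> x z \<le> u powr (p - q) * \<sigma> x y + u powr (p - q) * \<sigma> y z"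
    using pseudo_metricD(4)[OF \<sigma>_metric, of x z y]
    by (metis distrib_left mult_left_mono powr_ge_zero)
  moreover have "0 \<le> u powr (p - q) * \<sigma> x y" "0 \<le> u powr (p - q) * \<sigma> y z" "0 \<le> u powr p"
    using pseudo_metricD(1)[OF \<sigma>_metric] by auto
  ultimately show "truncated u x z \<le> truncated u x y + truncated u y z"
    unfolding truncated_def by linarith
qed (use pseudo_metricD[OF \<sigma>_metric] in \<open>auto simp: truncated_def\<close>)

lemma geometric_sum_le:
  fixes W :: "int set"
  assumes \<beta>: "0 < \<beta>" and W: "finite W" "\<And>k. k \<in> W \<Longrightarrow> k \<le> B"
  shows "(\<Sum>k\<in>W. scale k powr \<beta>) \<le> scale B powr \<beta> / (1 - 2 powr (- \<beta>))"
  using W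
proof (induction W arbitrary: B rule: finite_linorder_max_induct)
  case empty
  have "2 powr (- \<beta>) < (1::real)" using \<beta> by (simp add: powr_less_one)
  then show ?case by simp
next
  case (insert m W)
  have r: "2 powr (- \<beta>) < (1::real)" using \<beta> by (simp add: powr_less_one)
  have "m \<notin> W" using insert by auto
  moreover have "(\<Sum>k\<in>W. scale k powr \<beta>) \<le> scale (m - 1) powr \<beta> / (1 - 2 powr (- \<beta>))"
    using insert by (intro insert.IH) auto
  ultimately have "(\<Sum>k\<in>insert m W. scale k powr \<beta>)
      \<le> scale m powr \<beta> + scale (m - 1) powr \<beta> / (1 - 2 powr (- \<beta>))"
    using insert(1) by simp
  also have "scale (m - 1) powr \<beta> = scale m powr \<beta> * 2 powr (- \<beta>)"
    by (simp add: powr_powr powr_add[symmetric] algebra_simps)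
  also have "scale m powr \<beta> + scale m powr \<beta> * 2 powr (- \<beta>) / (1 - 2 powr (- \<beta>))
      = scale m powr \<beta> / (1 - 2 powr (- \<beta>))"
  proof -
    have "x + x * y / (1 - y) = x / (1 - y)" if "y < 1" for x y :: real
      using that by (simp add: divide_simps) (simp add: algebra_simps)
    then show ?thesis using r by blast
  qed
  also have "\<dots> \<le> scale B powr \<beta> / (1 - 2 powr (- \<beta>))"
    using insert.prems[of m] r \<beta> by (intro divide_right_mono powr_mono2) auto
  finally show ?case .
qed

text \<open>The first series adds the caps \<open>u powr p\<close> over scales up to
  \<open>d x y\<close>, the second the factors \<open>u powr (p - q)\<close> over the scales beyond
  it. They converge because \<open>0 < p\<close> and \<open>p < q\<close>.\<close>

definition scale_const :: real where
  "scale_const = 1 / (1 - 2 powr (- p)) + 1 / (1 - 2 powr (- (q - p)))"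

lemma scale_const_pos: "0 < scale_const"
proof -
  have "2 powr (- p) < (1::real)" "2 powr (- (q - p)) < (1::real)"
    using p_pos p_less_q by (auto intro: powr_less_one)
  then show ?thesis unfolding scale_const_def by (intro add_pos_pos divide_pos_pos) auto
qed

lemma sum_truncated_le:
  assumes W: "finite W"
  shows "(\<Sum>k\<in>W. truncated (scale k) x y) \<le> scale_const * \<rho> x y"
proof (cases "d x y = 0")
  case True
  then show ?thesis using p_pos q_pos by (simp add: truncated_def \<sigma>_def \<rho>_def)
next
  case False
  then have t: "0 < d x y" using d_nonneg[of x y] by simp
  define W1 W2 where "W1 = {k\<in>W. scale k \<le> d x y}" and "W2 = {k\<in>W. d x y < scale k}"
  have W12: "finite W1" "finite W2" "W = W1 \<union> W2" "W1 \<inter> W2 = {}"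
    unfolding W1_def W2_def using W by auto
  have r1: "2 powr (- p) < (1::real)" and r2: "2 powr (- (q - p)) < (1::real)"
    using p_pos p_less_q by (auto intro: powr_less_one)
  have "(\<Sum>k\<in>W1. truncated (scale k) x y) \<le> (\<Sum>k\<in>W1. scale k powr p)"
    unfolding truncated_def by (intro sum_mono) auto
  also have "\<dots> \<le> \<rho> x y / (1 - 2 powr (- p))"
  proof (cases "W1 = {}")
    case False
    have "(\<Sum>k\<in>W1. scale k powr p) \<le> scale (Max W1) powr p / (1 - 2 powr (- p))"
      using W12 p_pos by (intro geometric_sum_le) auto
    also have "\<dots> \<le> \<rho> x y / (1 - 2 powr (- p))"
      unfolding \<rho>_def using Max_in[OF W12(1) False] r1 p_pos
      by (intro divide_right_mono powr_mono2) (auto simp: W1_def)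
    finally show ?thesis .
  qed (use r1 in \<open>simp add: \<rho>_def\<close>)
  finally have s1: "(\<Sum>k\<in>W1. truncated (scale k) x y) \<le> \<rho> x y / (1 - 2 powr (- p))" .
  have neg: "scale k powr (p - q) = scale (- k) powr (q - p)" for k
    by (simp add: powr_powr algebra_simps)
  have "(\<Sum>k\<in>W2. truncated (scale k) x y) \<le> (\<Sum>k\<in>W2. scale k powr (p - q) * \<sigma> x y)"
    unfolding truncated_def by (intro sum_mono) auto
  also have "\<dots> = (\<Sum>k\<in>uminus ` W2. scale k powr (q - p)) * \<sigma> x y"
    by (subst sum.reindex) (auto simp: sum_distrib_right neg)
  also have "\<dots> \<le> \<rho> x y / (1 - 2 powr (- (q - p)))"
  proof (cases "W2 = {}")
    case False
    have "(\<Sum>k\<in>uminus ` W2. scale k powr (q - p)) \<le> scale (- Min W2) powr (q - p) / (1 - 2 powr (- (q - p)))"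
      using W12 p_less_q by (intro geometric_sum_le) auto
    also have "\<dots> \<le> d x y powr (p - q) / (1 - 2 powr (- (q - p)))"
    proof (rule divide_right_mono)
      have "scale (Min W2) powr (p - q) \<le> d x y powr (p - q)"
        using Min_in[OF W12(2) False] t p_less_q by (intro powr_mono2') (auto simp: W2_def)
      then show "scale (- Min W2) powr (q - p) \<le> d x y powr (p - q)" by (simp only: neg)
    qed (use r2 in auto)
    finally have "(\<Sum>k\<in>uminus ` W2. scale k powr (q - p)) * \<sigma> x y
        \<le> d x y powr (p - q) / (1 - 2 powr (- (q - p))) * \<sigma> x y"
      by (rule mult_right_mono) (simp add: \<sigma>_def)
    also have "\<dots> = \<rho> x y / (1 - 2 powr (- (q - p)))"
      using t by (simp add: \<sigma>_def \<rho>_def powr_add[symmetric])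
    finally show ?thesis .
  qed (use r2 in \<open>simp add: \<rho>_def\<close>)
  finally have "(\<Sum>k\<in>W2. truncated (scale k) x y) \<le> \<rho> x y / (1 - 2 powr (- (q - p)))" .
  with s1 have "(\<Sum>k\<in>W. truncated (scale k) x y)
      \<le> \<rho> x y / (1 - 2 powr (- p)) + \<rho> x y / (1 - 2 powr (- (q - p)))"
    using W12 by (simp add: sum.union_disjoint)
  then show ?thesis by (simp add: scale_const_def distrib_right)
qed

definition long :: "real \<Rightarrow> 'a flow \<Rightarrow> 'a flow" where
  "long u = filter (\<lambda>(a, x, y). u < d x y)"
definition short :: "real \<Rightarrow> 'a flow \<Rightarrow> 'a flow" where
  "short u = filter (\<lambda>(a, x, y). \<not> u < d x y)"

lemma boundary_long_short: "boundary (long u l) + boundary (short u l) = boundary l"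
  using boundary_filter[of "\<lambda>(a, x, y). u < d x y" l]
  by (simp add: long_def short_def case_prod_unfold)

text \<open>On long edges the truncated gauge equals its cap and thus controls mass; on short edges
  it is a multiple of \<open>\<sigma>\<close>, see \<open>cost_short\<close>. Mass and
  \<open>\<sigma>\<close>-cost are the two quantities that \<open>transport_cost_le_scale\<close>
  asks for.\<close>

lemma weight_long:
  assumes "0 < u"
  shows "cost p (\<lambda>_ _. 1) (long u l) \<le> u powr (- p) * cost p (truncated u) l"
proof -
  have le: "1 \<le> u powr (- p) * truncated u x y" if "u < d x y" for x y
  proof -
    have "u powr p = u powr (p - q) * u powr q" by (simp add: powr_add[symmetric])
    also have "\<dots> \<le> u powr (p - q) * \<sigma> x y"
      unfolding \<sigma>_def using assms that q_pos by (intro mult_left_mono powr_mono2) auto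
    finally have "truncated u x y = u powr p" by (simp add: truncated_def)
    then show ?thesis using assms by (simp add: powr_minus)
  qed
  have "cost p (\<lambda>_ _. 1) (long u l) \<le> cost p (\<lambda>x y. u powr (- p) * truncated u x y) (long u l)"
    using le by (intro cost_mono) (auto simp: long_def)
  also have "\<dots> \<le> u powr (- p) * cost p (truncated u) l"
    unfolding cost_cmult long_def using nonneg_costs by (intro mult_left_mono cost_filter_le) auto
  finally show ?thesis .
qed

lemma cost_short:
  assumes "0 < u"
  shows "cost p \<sigma> (short u l) \<le> u powr (q - p) * cost p (truncated u) l"
proof -
  have le: "\<sigma> x y \<le> u powr (q - p) * truncated u x y" if "\<not> u < d x y" for x y
  proof -
    have "u powr (p - q) * \<sigma> x y \<le> u powr (p - q) * u powr q"
      unfolding \<sigma>_def using that d_nonneg q_pos by (intro mult_left_mono powr_mono2) auto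
    also have "\<dots> = u powr p" by (simp add: powr_add[symmetric])
    finally have "truncated u x y = u powr (p - q) * \<sigma> x y" by (simp add: truncated_def)
    moreover have "u powr (q - p) * u powr (p - q) = 1" using assms by (simp add: powr_add[symmetric])
    ultimately show ?thesis by (simp add: mult.assoc[symmetric])
  qed
  have "cost p \<sigma> (short u l) \<le> cost p (\<lambda>x y. u powr (q - p) * truncated u x y) (short u l)"
    using le by (intro cost_mono) (auto simp: short_def)
  also have "\<dots> \<le> u powr (q - p) * cost p (truncated u) l"
    unfolding cost_cmult short_def using nonneg_costs by (intro mult_left_mono cost_filter_le) auto
  finally show ?thesis .
qed

lemma transport_cost_le_scale:
  assumes u: "0 < u" and bd: "boundary l' = boundary l"
  shows "transport_cost p \<rho> (boundary l)
    \<le> 2 * u powr p * cost p (\<lambda>_ _. 1) l' + 6 * u powr (p - q) * cost p \<sigma> l"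
proof -
  have "(u powr q) powr (p / q) = u powr p" "(u powr q) powr (p / q - 1) = u powr (p - q)"
    using q_pos by (auto simp: powr_powr algebra_simps)
  then show ?thesis
    using transport_cost_snowflake_le[OF p_pos p_le_1 \<sigma>_metric _ _ _ bd, of "p / q" "u powr q"]
      p_pos p_less_q q_pos u by (simp add: \<rho>_eq[abs_def])
qed

text \<open>
  A near-optimal flow for each truncated cost splits into its long and short part; the short part at
  scale \<open>2u\<close> minus the one at scale \<open>u\<close> is also a difference of long parts, so that
  \<open>transport_cost_le_scale\<close> applies to it at scale \<open>u\<close>.
\<close>

lemma transport_cost_le_sum_truncated:
  assumes m: "m \<in> range boundary" and \<theta>: "0 < \<theta>"
  shows "\<exists>W. finite W \<and> transport_cost p \<rho> m \<le> 38 * (\<Sum>k\<in>W. transport_cost p (truncated (scale k)) m) + \<theta>"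
proof -
  obtain l0 where l0: "m = boundary l0" using m by auto
  define w0 s0 where "w0 = cost p (\<lambda>_ _. 1) l0" and "s0 = cost p \<sigma> l0"
  have nn: "0 \<le> w0" "0 \<le> s0" unfolding w0_def s0_def using nonneg_costs
    by (auto intro!: cost_nonneg simp: nonneg_cost_def)
  \<comment> \<open>One fixed flow \<open>l0\<close> closes both ends of the range of scales: at the
    lowest scale its mass costs next to nothing, at the highest its \<open>\<sigma>\<close>-cost
    does. Each end may cost \<open>\<theta> / 4\<close>.\<close>
  have "((\<lambda>k. 2 * (2 powr (- real k)) powr p * w0) \<longlongrightarrow> 0) sequentially" 
    using p_pos by (real_asymp)
  then have "\<forall>\<^sub>F k in sequentially. 2 * (2 powr (- real k)) powr p * w0 < \<theta> / 4"
    using \<theta> by (intro order_tendstoD(2)[of _ 0]) auto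
  then obtain k0 where k0: "2 * (2 powr (- real k0)) powr p * w0 < \<theta> / 4"
    by (auto simp: eventually_sequentially)
  have "((\<lambda>k. 6 * (2 powr real k) powr (p - q) * s0) \<longlongrightarrow> 0) sequentially"
    using p_less_q by (real_asymp)
  then have "\<forall>\<^sub>F k in sequentially. 6 * (2 powr real k) powr (p - q) * s0 < \<theta> / 4"
    using \<theta> by (intro order_tendstoD(2)[of _ 0]) auto
  then obtain k1 where k1: "6 * (2 powr real k1) powr (p - q) * s0 < \<theta> / 4"
    by (auto simp: eventually_sequentially)
  define n where "n = k0 + k1"
  define u where "u i = scale (int i - int k0)" for i :: nat
  have u: "0 < u i" for i by (simp add: u_def)
  have u_Suc: "u (Suc i) = 2 * u i" for i
    unfolding u_def by (simp add: powr_add powr_diff)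
  define K where "K i = transport_cost p (truncated (u i)) m" for i
  \<comment> \<open>\<open>Suc n\<close> errors of size \<open>e\<close>, multiplied by the final
    constant 38, add up to \<open>\<theta> / 2\<close>.\<close>
  define e where "e = \<theta> / (76 * real (Suc n))"
  have e: "0 < e" unfolding e_def using \<theta> by simp
  have "\<exists>l. boundary l = m \<and> cost p (truncated (u i)) l < K i + e" for i
    using transport_cost_less_iff[OF nonneg_costs(3) m, of p "u i" "K i + e"] e by (simp add: K_def)
  then obtain f where f: "\<And>i. boundary (f i) = m" "\<And>i. cost p (truncated (u i)) (f i) < K i + e"
    by metis
  define C where "C i = cost p (truncated (u i)) (f i)" for i
  have C_nonneg: "0 \<le> C i" for i unfolding C_def using nonneg_costs(3) by (rule cost_nonneg)
  define S L where "S i = short (u i) (f i)" and "L i = long (u i) (f i)" for i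
  have LS: "boundary (L i) + boundary (S i) = m" for i
    unfolding S_def L_def by (simp add: boundary_long_short f)
  have L_eq: "boundary (L i) = m - boundary (S i)" for i
    using LS[of i] by (simp only: eq_diff_eq)
  have wL: "cost p (\<lambda>_ _. 1) (L i) \<le> u i powr (- p) * C i" for i
    unfolding L_def C_def using u by (rule weight_long)
  have cS: "cost p \<sigma> (S i) \<le> u i powr (q - p) * C i" for i
    unfolding S_def C_def using u by (rule cost_short)
  have pw: "u i powr p * (u i powr (- p) * x) = x" "u i powr (p - q) * (u i powr (q - p) * x) = x" for i x
    using u[of i] by (simp_all add: mult.assoc[symmetric] powr_add[symmetric])
  have pw_Suc: "u i powr p * (u (Suc i) powr (- p) * x) = 2 powr (- p) * x"
    "u i powr (p - q) * (u (Suc i) powr (q - p) * x) = 2 powr (q - p) * x" for i x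
    using u[of i] by (simp_all add: u_Suc powr_mult powr_add[symmetric] mult.assoc[symmetric] mult.left_commute[of "u i powr _"])
  \<comment> \<open>\<open>S 0\<close> has the boundary of \<open>l0\<close> minus
    \<open>L 0\<close>, whose mass is under control at the lowest scale. Dually, \<open>last\<close>
    replaces \<open>L n\<close> by \<open>l0\<close> minus \<open>S n\<close>, whose
    \<open>\<sigma>\<close>-cost is under control at the highest.\<close>
  have first: "transport_cost p \<rho> (boundary (S 0)) \<le> 8 * C 0 + \<theta> / 4"
  proof -
    have eq: "boundary (l0 @ scale_flow (- 1) (L 0)) = boundary (S 0)"
      using LS[of 0] l0 by (simp add: algebra_simps)
    have "transport_cost p \<rho> (boundary (S 0))
        \<le> 2 * u 0 powr p * (w0 + cost p (\<lambda>_ _. 1) (L 0)) + 6 * u 0 powr (p - q) * cost p \<sigma> (S 0)"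
      using transport_cost_le_scale[OF u eq, of 0] by (simp add: w0_def)
    also have "\<dots> \<le> 2 * u 0 powr p * (w0 + u 0 powr (- p) * C 0)
        + 6 * u 0 powr (p - q) * (u 0 powr (q - p) * C 0)"
      using wL[of 0] cS[of 0] by (intro add_mono mult_left_mono) auto
    also have "\<dots> = 2 * u 0 powr p * w0 + 8 * C 0" by (simp add: distrib_left mult.assoc pw)
    finally show ?thesis using k0 by (simp add: u_def)
  qed
  have last: "transport_cost p \<rho> (boundary (L n)) \<le> 8 * C n + \<theta> / 4"
  proof -
    have eq: "boundary (L n) = boundary (l0 @ scale_flow (- 1) (S n))"
      using LS[of n] l0 by (simp add: algebra_simps)
    have "transport_cost p \<rho> (boundary (l0 @ scale_flow (- 1) (S n)))
        \<le> 2 * u n powr p * cost p (\<lambda>_ _. 1) (L n) + 6 * u n powr (p - q) * (s0 + cost p \<sigma> (S n))"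
      using transport_cost_le_scale[OF u eq, of n] by (simp add: s0_def)
    also have "\<dots> \<le> 2 * u n powr p * (u n powr (- p) * C n)
        + 6 * u n powr (p - q) * (s0 + u n powr (q - p) * C n)"
      using wL[of n] cS[of n] by (intro add_mono mult_left_mono) auto
    also have "\<dots> = 6 * u n powr (p - q) * s0 + 8 * C n" by (simp add: distrib_left mult.assoc pw)
    finally show ?thesis using k1 eq by (simp add: u_def n_def)
  qed
  \<comment> \<open>At scale \<open>u i\<close>, mass enters with the factor 2 and
    \<open>\<sigma>\<close>-cost with 6. Bounds from the next scale, read at scale
    \<open>u i\<close>, change by a factor at most 1 for mass and 2 for
    \<open>\<sigma>\<close>-cost: 2 + 6 = 8 and 2 + 12 = 14.\<close>
  have step: "transport_cost p \<rho> (boundary (S (Suc i)) - boundary (S i)) \<le> 8 * C i + 14 * C (Suc i)" for i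
  proof -
    have eq: "boundary (L i @ scale_flow (- 1) (L (Suc i))) = boundary (S (Suc i) @ scale_flow (- 1) (S i))"
      by (simp add: L_eq)
    have "2 powr (- p) \<le> (1::real)" "2 powr (q - p) \<le> (2::real)"
      using p_pos p_less_q q_le_1 powr_mono[of "q - p" 1 "2::real"] powr_mono[of "- p" 0 "2::real"] by auto
    then have pw2: "2 powr (- p) * C (Suc i) \<le> C (Suc i)" "2 powr (q - p) * C (Suc i) \<le> 2 * C (Suc i)"
      using C_nonneg[of "Suc i"] by (auto intro: mult_left_le_one_le mult_right_mono)
    have "transport_cost p \<rho> (boundary (S (Suc i) @ scale_flow (- 1) (S i)))
        \<le> 2 * u i powr p * (cost p (\<lambda>_ _. 1) (L i) + cost p (\<lambda>_ _. 1) (L (Suc i)))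
          + 6 * u i powr (p - q) * (cost p \<sigma> (S (Suc i)) + cost p \<sigma> (S i))"
      using transport_cost_le_scale[OF u eq, of i] by simp
    also have "\<dots> \<le> 2 * u i powr p * (u i powr (- p) * C i + u (Suc i) powr (- p) * C (Suc i))
          + 6 * u i powr (p - q) * (u (Suc i) powr (q - p) * C (Suc i) + u i powr (q - p) * C i)"
      using wL cS by (intro add_mono mult_left_mono) auto
    also have "\<dots> = 2 * (C i + 2 powr (- p) * C (Suc i)) + 6 * (2 powr (q - p) * C (Suc i) + C i)"
      by (simp add: distrib_left mult.assoc pw pw_Suc)
    also have "\<dots> \<le> 8 * C i + 14 * C (Suc i)"
    proof -
      have "2 * (a + x) + 6 * (y + a) \<le> 8 * a + 14 * b" if "x \<le> b" "y \<le> 2 * b" for a b x y :: real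
        using that by (simp add: distrib_left)
      then show ?thesis using pw2 by blast
    qed
    finally show ?thesis by simp
  qed
  define T where "T = (\<Sum>i<n. boundary (S (Suc i)) - boundary (S i))"
  have T: "T \<in> range boundary" unfolding T_def by (intro range_boundary_sum range_boundary_diff rangeI)
  \<comment> \<open>The short parts telescope, and the long part at the top scale is the
    remainder.\<close>
  have "m = boundary (L n) + (boundary (S 0) + (\<Sum>i<n. boundary (S (Suc i)) - boundary (S i)))"
    unfolding sum_lessThan_telescope[of "\<lambda>i. boundary (S i)" n] L_eq
    by (simp only: add_diff_eq add_diff_cancel_left' diff_add_cancel)
  then have "transport_cost p \<rho> m \<le> transport_cost p \<rho> (boundary (L n)) + (transport_cost p \<rho> (boundary (S 0))
      + (\<Sum>i<n. transport_cost p \<rho> (boundary (S (Suc i)) - boundary (S i))))"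
    using transport_cost_add[OF nonneg_costs(2) rangeI, of "boundary (S 0) + T" p "L n"]
      transport_cost_add[OF nonneg_costs(2) rangeI, of T p "S 0"]
      transport_cost_sum[OF nonneg_costs(2) finite_lessThan, of n "\<lambda>i. boundary (S (Suc i)) - boundary (S i)" p]
      T range_boundary_add[OF rangeI T, of "S 0"]
    unfolding T_def by (simp add: range_boundary_diff)
  also have "\<dots> \<le> (8 * C n + \<theta> / 4) + ((8 * C 0 + \<theta> / 4) + (\<Sum>i<n. 8 * C i + 14 * C (Suc i)))"
    using first last step by (intro add_mono sum_mono) auto
  also have "(\<Sum>i<n. 8 * C i + 14 * C (Suc i)) = 8 * (\<Sum>i<n. C i) + 14 * (\<Sum>i<n. C (Suc i))"
    by (simp add: sum.distrib sum_distrib_left)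
  \<comment> \<open>38 = 8 + 8 + 8 + 14, each of the four terms being bounded by the full
    sum.\<close>
  also have "(8 * C n + \<theta> / 4) + ((8 * C 0 + \<theta> / 4) + (8 * (\<Sum>i<n. C i) + 14 * (\<Sum>i<n. C (Suc i))))
      \<le> 38 * (\<Sum>i<Suc n. C i) + \<theta> / 2"
  proof -
    have "C 0 + (\<Sum>i<n. C (Suc i)) = (\<Sum>i<Suc n. C i)" by (rule sum.lessThan_Suc_shift[symmetric])
    moreover have "C n + (\<Sum>i<n. C i) = (\<Sum>i<Suc n. C i)" by simp
    moreover have "0 \<le> (\<Sum>i<n. C i)" "0 \<le> (\<Sum>i<n. C (Suc i))" using C_nonneg by (auto intro: sum_nonneg)
    moreover have "8 * c + t + (8 * c0 + t + (8 * s + 14 * s')) \<le> 38 * x + 2 * t"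
      if "c0 + s' = x" "c + s = x" "0 \<le> s" "0 \<le> s'" "0 \<le> c0" "0 \<le> c" for c c0 s s' x t :: real
      using that by (simp flip: that(1))
    from this[of "C 0" _ _ "C n" _ "\<theta> / 4"] calculation show ?thesis
      using C_nonneg[of 0] C_nonneg[of n] by force
  qed
  also have "(\<Sum>i<Suc n. C i) \<le> (\<Sum>i<Suc n. K i + e)"
    using f(2) unfolding C_def by (intro sum_mono) (auto intro: less_imp_le)
  also have "\<dots> = (\<Sum>i<Suc n. K i) + real (Suc n) * e"
    by (simp add: sum.distrib del: sum.lessThan_Suc)
  also have "real (Suc n) * e = \<theta> / 76"
    unfolding e_def by (simp add: divide_simps)
  finally have bound: "transport_cost p \<rho> m \<le> 38 * (\<Sum>i<Suc n. K i) + \<theta>" by simp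
  have "(\<Sum>k\<in>(\<lambda>i. int i - int k0) ` {..<Suc n}. transport_cost p (truncated (scale k)) m) = (\<Sum>i<Suc n. K i)"
    by (subst sum.reindex) (auto simp: inj_on_def K_def u_def)
  with bound show ?thesis by (intro exI[of _ "(\<lambda>i. int i - int k0) ` {..<Suc n}"]) simp
qed

end

section \<open>Separated sequences\<close>

text \<open>A quantitative tightness condition: up to the error \<open>e\<close>, \<open>m\<close>
  is carried by the open \<open>s\<close>-neighbourhood of \<open>K\<close>.\<close>

definition near :: "real \<Rightarrow> ('a \<Rightarrow> 'a \<Rightarrow> real) \<Rightarrow> 'a set \<Rightarrow> real \<Rightarrow> real \<Rightarrow> ('a \<Rightarrow> real) \<Rightarrow> bool" where
  "near p c K s e m \<longleftrightarrow>
    (\<exists>y\<in>range boundary. (\<forall>z. y z \<noteq> 0 \<longrightarrow> (\<exists>k\<in>K. c z k < s)) \<and> transport_cost p c (m - y) \<le> e)"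

section \<open>Cutting flows along level sets of a distance\<close>

definition dist_to :: "('a \<Rightarrow> 'a \<Rightarrow> real) \<Rightarrow> 'a set \<Rightarrow> 'a \<Rightarrow> real" where
  "dist_to c S y = Min ((\<lambda>z. c z y) ` S)"

lemma dist_to_less_iff:
  "finite S \<Longrightarrow> S \<noteq> {} \<Longrightarrow> dist_to c S y < t \<longleftrightarrow> (\<exists>z\<in>S. c z y < t)"
  unfolding dist_to_def by (subst Min_less_iff) auto

lemma dist_to_attained:
  assumes "finite S" "S \<noteq> {}"
  obtains z where "z \<in> S" "dist_to c S y = c z y"
proof -
  have "dist_to c S y \<in> (\<lambda>z. c z y) ` S" unfolding dist_to_def using assms by (intro Min_in) auto
  then show ?thesis using that by blast
qed

lemma dist_to_le: "finite S \<Longrightarrow> z \<in> S \<Longrightarrow> dist_to c S y \<le> c z y"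
  unfolding dist_to_def by (intro Min_le) auto

lemma dist_to_lipschitz:
  assumes c: "pseudo_metric c" and S: "finite S" "S \<noteq> {}"
  shows "\<bar>dist_to c S x - dist_to c S y\<bar> \<le> c x y"
proof -
  have le: "dist_to c S x \<le> dist_to c S y + c x y" for x y
  proof -
    obtain z where z: "z \<in> S" "dist_to c S y = c z y" using dist_to_attained[OF S] by blast
    have "dist_to c S x \<le> c z x" using dist_to_le[OF S(1) z(1)] .
    also have "\<dots> \<le> c z y + c y x" using pseudo_metricD(4)[OF c] .
    finally show ?thesis using z pseudo_metricD(3)[OF c, of x y] by simp
  qed
  show ?thesis using le[of x y] le[of y x] pseudo_metricD(3)[OF c, of x y] by linarith
qed

text \<open>A coarea inequality: the levels that cut an edge form an interval of length
  \<open>\<bar>h x - h y\<bar>\<close>. Edges with both ends at height \<open>v\<close> or above are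
  never cut, so nothing is asked of them; hence a gauge that vanishes far away may be used.\<close>

lemma good_level:
  assumes uv: "u < v"
    and cross: "\<And>a x y. (a, x, y) \<in> set l \<Longrightarrow> \<not> (v \<le> h x \<and> v \<le> h y) \<Longrightarrow> \<bar>h x - h y\<bar> \<le> c x y"
    and c: "nonneg_cost c"
  shows "\<exists>t. u < t \<and> t < v \<and>
    cost p (\<lambda>x y. of_bool ((h x < t) \<noteq> (h y < t))) l \<le> cost p c l / (v - (u::real))"
proof -
  define w where "w = (\<lambda>(a::real, x::'a, y::'a). \<bar>a\<bar> powr p)"
  define A where "A = (\<lambda>(a::real, x, y). {t. (h x < t) \<noteq> (h y < t)})"
  define len where "len = (\<lambda>(a::real, x, y). c x y)"
  have "\<exists>t. u < t \<and> t < v \<and> (\<Sum>e\<leftarrow>l. w e * indicator (A e) t) \<le> (\<Sum>e\<leftarrow>l. w e * len e) / (v - u)"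
  proof (rule exists_le_average[OF uv])
    fix e assume e: "e \<in> set l"
    obtain a x y where exy: "e = (a, x, y)" by (cases e)
    show "0 \<le> w e" by (simp add: w_def exy)
    show A: "A e \<in> sets lborel" unfolding A_def exy by simp
    show "measure lborel (A e \<inter> {u<..<v}) \<le> len e"
    proof (cases "v \<le> h x \<and> v \<le> h y")
      case True
      then have "A e \<inter> {u<..<v} = {}" by (auto simp: A_def exy)
      then show ?thesis using nonneg_costD[OF c] by (simp add: len_def exy)
    next
      case False
      have "A e \<inter> {u<..<v} \<subseteq> {min (h x) (h y)..max (h x) (h y)}" by (auto simp: A_def exy)
      then have "measure lborel (A e \<inter> {u<..<v}) \<le> measure lborel {min (h x) (h y)..max (h x) (h y)}"
        using A by (intro measure_mono_fmeasurable fmeasurable_compact) auto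
      also have "\<dots> = \<bar>h x - h y\<bar>" by (simp add: abs_if min_def max_def)
      finally show ?thesis using cross[of a x y] e exy False by (simp add: len_def)
    qed
  qed
  moreover have "(\<Sum>e\<leftarrow>l. w e * len e) = cost p c l"
    by (induction l rule: flow_induct) (auto simp: w_def len_def)
  moreover have "(\<Sum>e\<leftarrow>l. w e * indicator (A e) t) = cost p (\<lambda>x y. of_bool ((h x < t) \<noteq> (h y < t))) l" for t
    by (induction l rule: flow_induct) (auto simp: w_def A_def indicator_def)
  ultimately show ?thesis by simp
qed

text \<open>By contraposition: a flow for \<open>m\<close> that is cheap for the localized gauge is
  cut along a level \<open>t < s / 2\<close> of the distance to \<open>S\<close>, and what crosses
  the level is sent to \<open>b\<close>. This moves the part of \<open>m\<close> inside the level at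
  cost at most \<open>e\<close>, and the remainder is carried near \<open>K\<close>. In the
  constant, 1 pays for the edges inside and \<open>2 * D / s\<close> for the cut ones, whose gauge
  is at most \<open>D\<close> and whose level is averaged over an interval of length
  \<open>s / 2\<close>.\<close>

lemma localized_cost_lower_bound:
  fixes c :: "'a \<Rightarrow> 'a \<Rightarrow> real"
  assumes c: "pseudo_metric c" and D: "\<And>x y. c x y \<le> D" "0 \<le> D"
    and K: "finite K" "b \<in> K" and m: "m \<in> range boundary" and se: "0 < s" "0 < e"
    and far: "\<not> near p c K s e m"
  defines "S \<equiv> {z. m z \<noteq> 0 \<and> (\<forall>k\<in>K. s \<le> c z k)}"
  defines "R \<equiv> {y. \<exists>z\<in>S. c z y < s / 2}"
  shows "e / (1 + 2 * D / s) \<le> transport_cost p (\<lambda>x y. if x \<in> R \<or> y \<in> R then c x y else 0) m"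
proof (rule ccontr)
  define c' where "c' x y = (if x \<in> R \<or> y \<in> R then c x y else 0)" for x y
  define \<theta> where "\<theta> = e / (1 + 2 * D / s)"
  have c_nonneg: "nonneg_cost c" using c by (rule pseudo_metric_imp_nonneg_cost)
  then have c': "nonneg_cost c'" by (auto simp: nonneg_cost_def c'_def)
  assume "\<not> ?thesis"
  then obtain l where l: "boundary l = m" "cost p c' l < \<theta>"
    using transport_cost_less_iff[OF c' m, of p \<theta>] unfolding \<theta>_def c'_def by (auto simp: not_le)
  have finS: "finite S"
    using finite_support_boundary[of l] by (rule finite_subset[rotated]) (auto simp: S_def l)
  have neS: "S \<noteq> {}"
  proof
    assume S: "S = {}"
    have "\<exists>k\<in>K. c z k < s" if "m z \<noteq> 0" for z
    proof (rule ccontr)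
      assume "\<not> ?thesis"
      then have "z \<in> S" using that by (auto simp: S_def not_less)
      then show False using S by simp
    qed
    moreover have "transport_cost p c (m - m) \<le> e"
      using transport_cost_zero[OF c_nonneg, of p] se by simp
    ultimately have "near p c K s e m" unfolding near_def using m by blast
    then show False using far by simp
  qed
  define h where "h = dist_to c S"
  have h_less: "h y < t \<longleftrightarrow> (\<exists>z\<in>S. c z y < t)" for y t
    unfolding h_def using finS neS by (rule dist_to_less_iff)
  have R: "y \<in> R \<longleftrightarrow> h y < s / 2" for y unfolding R_def h_less by simp
  have "\<exists>t. 0 < t \<and> t < s / 2 \<and>
      cost p (\<lambda>x y. of_bool ((h x < t) \<noteq> (h y < t))) l \<le> cost p c' l / (s / 2 - 0)"
  proof (rule good_level)
    fix a x y assume "\<not> (s / 2 \<le> h x \<and> s / 2 \<le> h y)"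
    then have "c' x y = c x y" by (auto simp: c'_def R not_le)
    then show "\<bar>h x - h y\<bar> \<le> c' x y" using dist_to_lipschitz[OF c finS neS] by (simp add: h_def)
  qed (use se c' in auto)
  then obtain t where t: "0 < t" "t < s / 2"
    "cost p (\<lambda>x y. of_bool ((h x < t) \<noteq> (h y < t))) l \<le> 2 * cost p c' l / s"
    by (auto simp: mult.commute)
  define l1 where "l1 = filter (\<lambda>(a, x, y). h x < t \<and> h y < t) l"
  define g :: "real \<times> 'a \<times> 'a \<Rightarrow> real \<times> 'a \<times> 'a"
    where "g = (\<lambda>(a, x, y). if h x < t then (a, x, b) else (a, b, y))"
  define l2 where "l2 = map g (filter (\<lambda>(a, x, y). (h x < t) \<noteq> (h y < t)) l)"
  \<comment> \<open>Rerouting through \<open>b\<close> is harmless: \<open>b\<close> lies outside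
    the level, at distance at least \<open>s\<close> from \<open>S\<close>, and any mass left at
    \<open>b\<close> is carried by \<open>K\<close>.\<close>
  have hb: "\<not> h b < t"
    using K(2) t by (auto simp: h_less S_def not_less intro: order.trans[of t s])
  \<comment> \<open>Ends of edges below the level survive in \<open>l1\<close> or \<open>l2\<close>,
    while above the level \<open>b\<close> is the only endpoint left.\<close>
  have inside: "boundary (l1 @ l2) z = (if h z < t then m z else 0)" if "z \<noteq> b" for z
    unfolding l(1)[symmetric] l1_def l2_def boundary_append plus_fun_apply using that
    by (induction l rule: flow_induct) (auto simp: g_def boundary_Cons_apply simp del: boundary_Cons)
  have "cost p c l1 \<le> cost p c' l1"
    unfolding l1_def using t by (intro cost_mono) (auto simp: c'_def R)
  also have "\<dots> \<le> cost p c' l" unfolding l1_def using c' by (rule cost_filter_le)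
  finally have cost1: "cost p c l1 \<le> cost p c' l" .
  have "cost p c l2 \<le> D * cost p (\<lambda>x y. of_bool ((h x < t) \<noteq> (h y < t))) l"
    unfolding l2_def
  proof (induction l rule: flow_induct)
    case (Cons a x y l)
    have "\<bar>a\<bar> powr p * c x b \<le> \<bar>a\<bar> powr p * D" "\<bar>a\<bar> powr p * c b y \<le> \<bar>a\<bar> powr p * D"
      using D by (auto intro: mult_left_mono)
    with Cons show ?case by (auto simp: g_def algebra_simps)
  qed simp
  also have "\<dots> \<le> D * (2 * cost p c' l / s)" using t(3) D(2) by (rule mult_left_mono)
  finally have cost2: "cost p c l2 \<le> D * (2 * cost p c' l / s)" .
  have "cost p c (l1 @ l2) \<le> cost p c' l * (1 + 2 * D / s)"
    using cost1 cost2 by (simp add: algebra_simps)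
  also have "\<dots> \<le> \<theta> * (1 + 2 * D / s)"
    using l(2) D(2) se by (intro mult_right_mono) auto
  also have "\<dots> = e"
  proof -
    have "0 \<le> 2 * D / s" using D(2) se by simp
    then have "1 + 2 * D / s \<noteq> 0" by linarith
    then show ?thesis by (simp add: \<theta>_def)
  qed
  finally have "transport_cost p c (boundary (l1 @ l2)) \<le> e"
    using transport_cost_le[OF c_nonneg, of p "l1 @ l2"] by linarith
  moreover define y where "y = m - boundary (l1 @ l2)"
  ultimately have "transport_cost p c (m - y) \<le> e" by simp
  moreover have "y \<in> range boundary" unfolding y_def using m by (intro range_boundary_diff rangeI)
  moreover have "\<exists>k\<in>K. c z k < s" if "y z \<noteq> 0" for z
  proof (cases "z = b")
    case True
    then show ?thesis using K(2) pseudo_metricD(2)[OF c, of b] se by (intro bexI[of _ b]) auto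
  next
    case False
    have yz: "y z = (if h z < t then 0 else m z)" using inside[OF False] by (simp add: y_def)
    then have "\<not> h z < t" "m z \<noteq> 0" using that by (auto split: if_splits)
    then have "z \<notin> S" using t(1) pseudo_metricD(2)[OF c, of z] by (auto simp: h_less)
    then show ?thesis using \<open>m z \<noteq> 0\<close> by (auto simp: S_def not_le)
  qed
  ultimately have "near p c K s e m" unfolding near_def by blast
  then show False using far by simp
qed

text \<open>Each vector is chosen not to be near the supports of its predecessors. The sets
  \<open>S j\<close> are then mutually \<open>s\<close>-separated and their neighbourhoods
  \<open>R j\<close> of radius \<open>s / 2\<close> are disjoint. An edge has two ends and so meets
  at most two of them, whence the factor 2.\<close>

lemma disjoint_localization:
  fixes c :: "'a \<Rightarrow> 'a \<Rightarrow> real" and x :: "nat \<Rightarrow> 'a \<Rightarrow> real"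
  assumes c: "pseudo_metric c" and D: "\<And>x y. c x y \<le> D" "0 \<le> D"
    and x: "\<And>n. x n \<in> range boundary" and se: "0 < s" "0 < e"
    and far: "\<And>K. finite K \<Longrightarrow> b \<in> K \<Longrightarrow> \<exists>n. \<not> near p c K s e (x n)"
  obtains n :: "nat \<Rightarrow> nat" and c' \<theta> where "0 < \<theta>" "\<And>j. nonneg_cost (c' j)"
    "\<And>j. \<theta> \<le> transport_cost p (c' j) (x (n j))"
    "\<And>J y z. finite J \<Longrightarrow> (\<Sum>j\<in>J. c' j y z) \<le> 2 * c y z"
proof -
  define ch where "ch K = (SOME n. \<not> near p c K s e (x n))" for K
  define Ks where "Ks = rec_nat {b} (\<lambda>_ K. K \<union> {z. x (ch K) z \<noteq> 0})"
  have Ks_0: "Ks 0 = {b}" and Ks_Suc: "Ks (Suc j) = Ks j \<union> {z. x (ch (Ks j)) z \<noteq> 0}" for j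
    by (simp_all add: Ks_def)
  have fin_supp: "finite {z. x i z \<noteq> 0}" for i
    using x[of i] finite_support_boundary by auto
  have Ks: "finite (Ks j)" "b \<in> Ks j" for j
    using fin_supp by (induction j) (auto simp: Ks_0 Ks_Suc)
  have mono: "Ks i \<subseteq> Ks j" if "i \<le> j" for i j
    using that by (rule lift_Suc_mono_le[rotated]) (auto simp: Ks_Suc)
  define n where "n j = ch (Ks j)" for j
  have far_n: "\<not> near p c (Ks j) s e (x (n j))" for j
    unfolding n_def ch_def using someI_ex[OF far[OF Ks]] .
  define S where "S j = {z. x (n j) z \<noteq> 0 \<and> (\<forall>k\<in>Ks j. s \<le> c z k)}" for j
  define R where "R j = {y. \<exists>z\<in>S j. c z y < s / 2}" for j
  define c' where "c' j y z = (if y \<in> R j \<or> z \<in> R j then c y z else 0)" for j y z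
  define \<theta> where "\<theta> = e / (1 + 2 * D / s)"
  have "0 \<le> 2 * D / s" using D(2) se by simp
  then have \<theta>: "0 < \<theta>" unfolding \<theta>_def using se by (intro divide_pos_pos) auto
  have low: "\<theta> \<le> transport_cost p (c' j) (x (n j))" for j
    unfolding \<theta>_def c'_def[abs_def] R_def S_def
    using c D Ks x se far_n by (rule localized_cost_lower_bound)
  have disj: "R i \<inter> R j = {}" if "i < j" for i j
  proof (rule ccontr)
    assume "R i \<inter> R j \<noteq> {}"
    then obtain y zi zj where y: "zi \<in> S i" "c zi y < s / 2" "zj \<in> S j" "c zj y < s / 2"
      by (auto simp: R_def)
    have "zi \<in> Ks (Suc i)" using y(1) by (simp add: S_def Ks_Suc n_def)
    then have "zi \<in> Ks j" using mono[of "Suc i" j] that by auto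
    then have "s \<le> c zj zi" using y(3) by (simp add: S_def)
    also have "\<dots> \<le> c zj y + c y zi" using pseudo_metricD(4)[OF c] .
    finally show False using y pseudo_metricD(3)[OF c, of y zi] by linarith
  qed
  have one: "(\<Sum>j\<in>J. of_bool (y \<in> R j)) \<le> (1::real)" if J: "finite J" for J y
  proof -
    have "i = j" if "y \<in> R i" "y \<in> R j" for i j
      using disj[of i j] disj[of j i] that by (cases i j rule: linorder_cases) auto
    then have "card (J \<inter> {j. y \<in> R j}) \<le> 1"
      unfolding One_nat_def using J by (subst card_le_Suc0_iff_eq) auto
    then show ?thesis using J by (subst sum_of_bool_eq) auto
  qed
  have "(\<Sum>j\<in>J. c' j y z) \<le> 2 * c y z" if "finite J" for J y z
  proof -
    have "(\<Sum>j\<in>J. c' j y z) \<le> (\<Sum>j\<in>J. (of_bool (y \<in> R j) + of_bool (z \<in> R j)) * c y z)"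
      using pseudo_metricD(1)[OF c] by (intro sum_mono) (auto simp: c'_def)
    also have "\<dots> = ((\<Sum>j\<in>J. of_bool (y \<in> R j)) + (\<Sum>j\<in>J. of_bool (z \<in> R j))) * c y z"
      by (simp add: sum_distrib_right sum.distrib distrib_right)
    also have "\<dots> \<le> (1 + 1) * c y z"
      using one[OF that] pseudo_metricD(1)[OF c] by (intro mult_right_mono add_mono) auto
    finally show ?thesis by simp
  qed
  moreover have "nonneg_cost (c' j)" for j
    using pseudo_metricD(1)[OF c] by (auto simp: nonneg_cost_def c'_def)
  ultimately show ?thesis using that[of \<theta> c' n] \<theta> low by blast
qed

section \<open>Approximation by measures on a finite set\<close>

lemma abs_boundary_powr_le:
  assumes "0 < p" "p \<le> 1"
  shows "\<bar>boundary l z\<bar> powr p \<le> 2 * cost p (\<lambda>x y. of_bool (x = z \<or> y = z)) l"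
proof (induction l rule: flow_induct)
  case (Cons a x y l)
  have "\<bar>a * (of_bool (z = x) - of_bool (z = y))\<bar> powr p \<le> 2 * (\<bar>a\<bar> powr p * of_bool (x = z \<or> y = z))"
    using assms by auto
  then show ?case
    using Cons abs_powr_triangle[OF assms, of "a * (of_bool (z = x) - of_bool (z = y))" "boundary l z"]
    unfolding boundary_Cons_apply cost.simps by (simp only: distrib_left)
qed simp

text \<open>A boundary has total mass 0, so the corrections by \<open>point_mass b\<close> cancel
  whatever \<open>b\<close> is.\<close>

lemma boundary_eq_sum_point_masses:
  assumes K: "finite K" "\<And>z. m z \<noteq> 0 \<Longrightarrow> z \<in> K" and m: "m \<in> range boundary"
  shows "m = (\<Sum>z\<in>K. m z *\<^sub>R (point_mass z - point_mass b))"
proof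
  obtain l where l: "m = boundary l" using m by auto
  have 0: "(\<Sum>z\<in>K. m z) = 0"
    unfolding l using K by (intro sum_boundary_eq_0) (auto simp: l)
  fix u
  have ev: "(\<Sum>z\<in>K. m z *\<^sub>R (point_mass z - point_mass b)) u
      = (\<Sum>z\<in>K. m z * (of_bool (u = z) - of_bool (u = b)))" if "finite K" for K
    using that by (induction K rule: finite_induct) (auto simp: scaleR_fun_def point_mass_def)
  have "(\<Sum>z\<in>K. m z * (of_bool (u = z) - of_bool (u = b)))
      = (\<Sum>z\<in>K. if u = z then m z else 0) - (\<Sum>z\<in>K. m z) * of_bool (u = b)"
    unfolding sum_distrib_right sum_subtractf[symmetric] by (intro sum.cong) auto
  also have "\<dots> = m u" using 0 K by (auto simp: sum.delta)
  finally show "m u = (\<Sum>z\<in>K. m z *\<^sub>R (point_mass z - point_mass b)) u" using ev[OF K(1)] by simp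
qed

lemma transport_cost_finite_support_le:
  assumes c: "nonneg_cost c" and D: "\<And>x y. c x y \<le> D" and p: "0 < p"
    and K: "finite K" "\<And>z. m z \<noteq> 0 \<Longrightarrow> z \<in> K" and m: "m \<in> range boundary"
    and \<zeta>: "\<And>z. z \<in> K \<Longrightarrow> \<bar>m z\<bar> \<le> \<zeta>"
  shows "transport_cost p c m \<le> real (card K) * (\<zeta> powr p * D)"
proof -
  fix b :: 'a
  define e where "e z = point_mass z - point_mass b" for z
  have e: "e z = boundary [(1, z, b)]" for z by (simp add: e_def)
  then have e_mem: "e z \<in> range boundary" for z by (metis rangeI)
  have e_cost: "transport_cost p c (e z) \<le> D" for z
    using transport_cost_le[OF c, of p "[(1, z, b)]"] D[of z b] unfolding e by simp
  have "transport_cost p c m = transport_cost p c (\<Sum>z\<in>K. m z *\<^sub>R e z)"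
    using boundary_eq_sum_point_masses[OF K m, of b] by (simp add: e_def)
  also have "\<dots> \<le> (\<Sum>z\<in>K. transport_cost p c (m z *\<^sub>R e z))"
    using c K(1) range_boundary_scaleR[OF e_mem] by (rule transport_cost_sum)
  also have "\<dots> \<le> (\<Sum>z\<in>K. \<zeta> powr p * D)"
  proof (rule sum_mono)
    fix z assume "z \<in> K"
    then have "\<bar>m z\<bar> powr p \<le> \<zeta> powr p" using \<zeta> p by (intro powr_mono2) auto
    then show "transport_cost p c (m z *\<^sub>R e z) \<le> \<zeta> powr p * D"
      unfolding transport_cost_scaleR[OF c e_mem]
      using e_cost transport_cost_nonneg[OF c e_mem] by (intro mult_mono) auto
  qed
  finally show ?thesis by simp
qed

text \<open>Two approximants of \<open>x\<close> are combined: \<open>y\<close>, carried near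
  \<open>K\<close>, and \<open>boundary l\<close>, of bounded mass. A cheap flow \<open>f\<close>
  between them is cut along a level of the distance to \<open>K\<close>, and points inside the level
  are snapped to \<open>K\<close>. The vector \<open>w\<close> has two descriptions: as the image of
  \<open>l\<close> minus that of the outer edges \<open>f2\<close> it has bounded coefficients and
  is close to \<open>boundary l\<close>; as the image of the inner edges \<open>f1\<close> plus that
  of \<open>y\<close> it is carried by \<open>K\<close>.\<close>

lemma finite_dimensional_approximation:
  fixes c :: "'a \<Rightarrow> 'a \<Rightarrow> real"
  assumes p: "0 < p" "p \<le> 1" and c: "pseudo_metric c"
    and K: "finite K" "K \<noteq> {}" and s: "0 < s" and \<eta>: "0 < \<eta>"
    and near: "near p c K s \<eta> x" and x: "x \<in> range boundary"
    and g: "transport_cost p c (x - boundary l) \<le> \<eta>" "cost p (\<lambda>_ _. 1) l \<le> C"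
  shows "\<exists>w\<in>range boundary. (\<forall>z. w z \<noteq> 0 \<longrightarrow> z \<in> K) \<and> (\<forall>z. \<bar>w z\<bar> powr p \<le> 2 * C + 6 * \<eta> / s) \<and>
    transport_cost p c (x - w) \<le> 10 * \<eta> + 4 * s * C"
proof -
  have nn: "nonneg_cost c" using c by (rule pseudo_metric_imp_nonneg_cost)
  obtain y where y: "y \<in> range boundary" "\<And>z. y z \<noteq> 0 \<Longrightarrow> \<exists>k\<in>K. c z k < s"
    "transport_cost p c (x - y) \<le> \<eta>" using near unfolding near_def by blast
  have gy: "boundary l - y \<in> range boundary" using y(1) by (intro range_boundary_diff rangeI)
  have "boundary l - y = (x - y) - (x - boundary l)" by simp
  then have "transport_cost p c (boundary l - y) \<le> transport_cost p c (x - y) + transport_cost p c (x - boundary l)"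
    using transport_cost_diff[OF nn range_boundary_diff[OF x y(1)] range_boundary_diff[OF x rangeI]] by metis
  then have "transport_cost p c (boundary l - y) < 3 * \<eta>" using y(3) g(1) \<eta> by linarith
  then obtain f where f: "boundary f = boundary l - y" "cost p c f < 3 * \<eta>"
    using transport_cost_less_iff[OF nn gy] by blast
  define h where "h = dist_to c K"
  have h_less: "h y < t \<longleftrightarrow> (\<exists>z\<in>K. c z y < t)" for y t
    unfolding h_def using K by (rule dist_to_less_iff)
  have "\<exists>t. s < t \<and> t < 2 * s \<and> cost p (\<lambda>x y. of_bool ((h x < t) \<noteq> (h y < t))) f \<le> cost p c f / (2 * s - s)"
    by (rule good_level) (use s nn dist_to_lipschitz[OF c K] in \<open>auto simp: h_def\<close>)
  then obtain t where t: "s < t" "t < 2 * s"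
    "cost p (\<lambda>x y. of_bool ((h x < t) \<noteq> (h y < t))) f \<le> cost p c f / s" by auto
  have cross: "cost p (\<lambda>x y. of_bool ((h x < t) \<noteq> (h y < t))) f \<le> 3 * \<eta> / s"
    using t(3) divide_right_mono[of "cost p c f" "3 * \<eta>" s] f(2) s by linarith
  \<comment> \<open>Inside the level points move to a nearest point of \<open>K\<close>, hence by at
    most \<open>2 * s\<close>; outside nothing moves. Among the edges of \<open>f2\<close>, only
    those crossing the level are changed.\<close>
  define \<psi> where "\<psi> z = (if z \<in> K \<or> \<not> h z < t then z else SOME k. k \<in> K \<and> c k z = h z)" for z
  have some: "\<exists>k. k \<in> K \<and> c k z = h z" for z
    using dist_to_attained[OF K, of c z] unfolding h_def by metis
  have \<psi>_in: "\<psi> z \<in> K" if "h z < t" for z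
    using someI_ex[OF some[of z]] that by (auto simp: \<psi>_def)
  have \<psi>_out: "\<psi> z = z" if "\<not> h z < t" for z using that by (simp add: \<psi>_def)
  have \<psi>_dist: "c z (\<psi> z) \<le> 2 * s" for z
    using someI_ex[OF some[of z]] pseudo_metricD(2,3)[OF c] t s by (auto simp: \<psi>_def)
  have hK: "h z < t" if "z \<in> K" for z
    using that pseudo_metricD(2)[OF c, of z] t s by (auto simp: h_less intro!: bexI[of _ z])
  define I where "I = (\<lambda>(a::real, x, y). h x < t \<and> h y < t)"
  define f1 f2 where "f1 = filter I f" and "f2 = filter (\<lambda>e. \<not> I e) f"
  define w where "w = boundary (map_flow \<psi> l) - boundary (map_flow \<psi> f2)"
  have w: "w \<in> range boundary" unfolding w_def by (intro range_boundary_diff rangeI)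
  obtain ly where ly: "y = boundary ly" using y(1) by auto
  have "boundary (f1 @ f2 @ ly) = boundary l"
    using boundary_filter[of I f] f(1) by (simp add: f1_def f2_def ly algebra_simps)
  from boundary_map_flow_cong[OF this, of \<psi>]
  have "boundary (map_flow \<psi> f1) + boundary (map_flow \<psi> f2) + boundary (map_flow \<psi> ly)
      = boundary (map_flow \<psi> l)"
    by (simp add: map_flow_def add.assoc)
  then have w_eq: "w = boundary (map_flow \<psi> f1) + boundary (map_flow \<psi> ly)"
    unfolding w_def by (simp add: algebra_simps)
  have supp: "z \<in> K" if "w z \<noteq> 0" for z
  proof (rule ccontr)
    assume z: "z \<notin> K"
    have "boundary (map_flow \<psi> f1) z = 0"
      by (rule boundary_eq_0) (use z \<psi>_in in \<open>auto simp: f1_def I_def map_flow_def\<close>)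
    moreover have "boundary (map_flow \<psi> ly) z = 0"
    proof -
      have ev: "(\<Sum>x\<in>A. y x *\<^sub>R point_mass (\<psi> x)) z = 0" if "finite A" "\<And>x. x \<in> A \<Longrightarrow> \<psi> x \<in> K" for A
        using that by (induction A rule: finite_induct) (use z in \<open>auto simp: scaleR_fun_def point_mass_def\<close>)
      have "\<psi> x \<in> K" if yx: "y x \<noteq> 0" for x
      proof (rule \<psi>_in)
        obtain k where "k \<in> K" "c x k < s" using y(2)[OF yx] by blast
        then show "h x < t" unfolding h_less using pseudo_metricD(3)[OF c, of x k] t by (intro bexI[of _ k]) auto
      qed
      moreover have "finite {x. y x \<noteq> 0}" unfolding ly by (rule finite_support_boundary)
      ultimately have "linear_extension (\<lambda>x. point_mass (\<psi> x)) y z = 0"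
        unfolding linear_extension_def by (intro ev) auto
      then show ?thesis unfolding ly linear_extension_boundary_point_mass .
    qed
    ultimately show False using that unfolding w_eq by simp
  qed
  \<comment> \<open>At a point of \<open>K\<close> the image of \<open>l\<close> contributes at most
    twice the mass of \<open>l\<close>. An edge of \<open>f2\<close> contributes only if it crosses
    the level, since points outside are fixed and do not belong to \<open>K\<close>.\<close>
  have bound: "\<bar>w z\<bar> powr p \<le> 2 * C + 6 * \<eta> / s" for z
  proof (cases "z \<in> K")
    case True
    have "\<bar>w z\<bar> powr p \<le> \<bar>boundary (map_flow \<psi> l) z\<bar> powr p + \<bar>boundary (map_flow \<psi> f2) z\<bar> powr p"
      using abs_powr_triangle[OF p, of "boundary (map_flow \<psi> l) z" "- boundary (map_flow \<psi> f2) z"]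
      by (simp add: w_def)
    also have "\<bar>boundary (map_flow \<psi> l) z\<bar> powr p \<le> 2 * cost p (\<lambda>_ _. 1) l"
    proof -
      have "cost p (\<lambda>x y. of_bool (x = z \<or> y = z)) (map_flow \<psi> l) \<le> cost p (\<lambda>_ _. 1) l"
        unfolding cost_map_flow by (intro cost_mono) auto
      then show ?thesis using abs_boundary_powr_le[OF p, of "map_flow \<psi> l" z] by linarith
    qed
    also have "\<bar>boundary (map_flow \<psi> f2) z\<bar> powr p \<le> 2 * cost p (\<lambda>x y. of_bool ((h x < t) \<noteq> (h y < t))) f"
    proof -
      have "cost p (\<lambda>x y. of_bool (x = z \<or> y = z)) (map_flow \<psi> f2)
          \<le> cost p (\<lambda>x y. of_bool ((h x < t) \<noteq> (h y < t))) f2"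
        unfolding cost_map_flow
        using hK[OF True] \<psi>_out by (intro cost_mono) (fastforce simp: f2_def I_def)
      also have "\<dots> \<le> cost p (\<lambda>x y. of_bool ((h x < t) \<noteq> (h y < t))) f"
        unfolding f2_def by (rule cost_filter_le) (simp add: nonneg_cost_def)
      finally show ?thesis using abs_boundary_powr_le[OF p, of "map_flow \<psi> f2" z] by linarith
    qed
    finally show ?thesis using g(2) cross by simp
  next
    case False
    then have "w z = 0" using supp by blast
    moreover have "0 \<le> C"
      using g(2) cost_nonneg[of "\<lambda>_ _. 1" p l] by (simp add: nonneg_cost_def)
    ultimately show ?thesis using \<eta> s p by simp
  qed
  define l1 where "l1 = map (\<lambda>(a, x, y). (a, x, \<psi> x)) l"
  define l2 where "l2 = map (\<lambda>(a, x, y). (a, \<psi> y, y)) l"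
  have "boundary l1 + boundary l2 + boundary (map_flow \<psi> l) = boundary l"
    unfolding l1_def l2_def map_flow_def
    by (induction l rule: flow_induct) (auto simp: fun_eq_iff boundary_Cons_apply algebra_simps simp del: boundary_Cons)
  then have gw: "boundary l - w = boundary (l1 @ l2 @ map_flow \<psi> f2)"
    unfolding w_def by (simp add: algebra_simps)
  have step: "\<bar>a\<bar> powr p * c x (\<psi> x) \<le> 2 * s * \<bar>a\<bar> powr p" for a x
    using mult_right_mono[OF \<psi>_dist[of x], of "\<bar>a\<bar> powr p"] by (simp add: mult.commute)
  have "cost p c l1 \<le> 2 * s * cost p (\<lambda>_ _. 1) l"
    unfolding l1_def by (induction l rule: flow_induct) (auto simp: distrib_left intro!: add_mono step)
  moreover have "cost p c l2 \<le> 2 * s * cost p (\<lambda>_ _. 1) l"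
    unfolding l2_def by (induction l rule: flow_induct)
      (auto simp: distrib_left pseudo_metricD(3)[OF c, of "\<psi> _"] intro!: add_mono step)
  moreover have "2 * s * cost p (\<lambda>_ _. 1) l \<le> 2 * s * C" using g(2) s by (intro mult_left_mono) auto
  \<comment> \<open>\<open>3 * \<eta>\<close> for the flow itself and \<open>6 * \<eta>\<close> for
    moving the inner ends of the crossing edges, of total weight at most
    \<open>3 * \<eta> / s\<close>, by up to \<open>2 * s\<close>.\<close>
  moreover have "cost p c (map_flow \<psi> f2) \<le> 9 * \<eta>"
  proof -
    have "c (\<psi> x) (\<psi> y) \<le> c x y + 2 * s * of_bool ((h x < t) \<noteq> (h y < t))"
      if "\<not> (h x < t \<and> h y < t)" for x y
    proof (cases "h x < t"; cases "h y < t")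
      assume "h x < t" "\<not> h y < t"
      then show ?thesis
        using pseudo_metricD(4)[OF c, of "\<psi> x" y x] pseudo_metricD(3)[OF c, of "\<psi> x" x] \<psi>_dist[of x] \<psi>_out[of y] by simp
    next
      assume "\<not> h x < t" "h y < t"
      then show ?thesis
        using pseudo_metricD(4)[OF c, of x "\<psi> y" y] \<psi>_dist[of y] \<psi>_out[of x] by simp
    qed (use that \<psi>_out in auto)
    then have "cost p c (map_flow \<psi> f2) \<le> cost p (\<lambda>x y. c x y + 2 * s * of_bool ((h x < t) \<noteq> (h y < t))) f2"
      unfolding cost_map_flow by (intro cost_mono) (auto simp: f2_def I_def)
    also have "\<dots> \<le> cost p (\<lambda>x y. c x y + 2 * s * of_bool ((h x < t) \<noteq> (h y < t))) f"
      unfolding f2_def using nonneg_costD[OF nn] s by (intro cost_filter_le) (auto simp: nonneg_cost_def)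
    also have "\<dots> = cost p c f + 2 * s * cost p (\<lambda>x y. of_bool ((h x < t) \<noteq> (h y < t))) f"
      unfolding cost_add cost_cmult ..
    also have "\<dots> \<le> 3 * \<eta> + 2 * s * (3 * \<eta> / s)"
      using f(2) cross s by (intro add_mono mult_left_mono) auto
    also have "\<dots> = 9 * \<eta>" using s by simp
    finally show ?thesis .
  qed
  ultimately have "transport_cost p c (boundary l - w) \<le> 9 * \<eta> + 4 * s * C"
    using transport_cost_le[OF nn, of p "l1 @ l2 @ map_flow \<psi> f2"] unfolding gw by simp
  moreover have "x - w = (x - boundary l) + (boundary l - w)" by simp
  then have "transport_cost p c (x - w) \<le> transport_cost p c (x - boundary l) + transport_cost p c (boundary l - w)"
    using transport_cost_add[OF nn range_boundary_diff[OF x rangeI] range_boundary_diff[OF rangeI w]] by metis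
  ultimately have "transport_cost p c (x - w) \<le> 10 * \<eta> + 4 * s * C" using g(1) by linarith
  with w supp bound show ?thesis by blast
qed

text \<open>Total boundedness by pigeonhole: the approximants lie in a bounded box of the functions
  on one finite set \<open>K\<close>, so two of them fall into the same cell of a fine grid.\<close>

lemma near_finite_imp_close:
  fixes c :: "'a \<Rightarrow> 'a \<Rightarrow> real" and x :: "nat \<Rightarrow> 'a \<Rightarrow> real"
  assumes p: "0 < p" "p \<le> 1" and c: "pseudo_metric c" and D: "\<And>x y. c x y \<le> D"
    and x: "\<And>n. x n \<in> range boundary" and \<epsilon>: "0 < \<epsilon>"
    and approx: "\<And>\<eta>. 0 < \<eta> \<Longrightarrow> \<exists>C. \<forall>n. \<exists>l. cost p (\<lambda>_ _. 1) l \<le> C \<and> transport_cost p c (x n - boundary l) \<le> \<eta>"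
    and near: "\<And>s e. 0 < s \<Longrightarrow> 0 < e \<Longrightarrow> \<exists>K. finite K \<and> K \<noteq> {} \<and> (\<forall>n. near p c K s e (x n))"
  shows "\<exists>n m. n \<noteq> m \<and> transport_cost p c (x n - x m) < \<epsilon>"
proof -
  have nn: "nonneg_cost c" using c by (rule pseudo_metric_imp_nonneg_cost)
  \<comment> \<open>Two approximation errors of \<open>11 * \<eta>\<close> and one rounding error
    \<open>\<eta>\<close> make \<open>23 * \<eta>\<close>. The radius \<open>s\<close> is chosen
    after the mass bound \<open>C\<close>, which depends on \<open>\<eta>\<close> alone, so that
    \<open>4 * s * C \<le> \<eta>\<close>.\<close>
  define \<eta> where "\<eta> = \<epsilon> / 24"
  have \<eta>: "0 < \<eta>" using \<epsilon> by (simp add: \<eta>_def)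
  from approx[OF this] obtain C l where l: "\<And>n. cost p (\<lambda>_ _. 1) (l n) \<le> C"
    "\<And>n. transport_cost p c (x n - boundary (l n)) \<le> \<eta>" by metis
  have C: "0 \<le> C" using l(1)[of 0] cost_nonneg[of "\<lambda>_ _. 1" p "l 0"] by (simp add: nonneg_cost_def)
  define s where "s = \<eta> / (4 * (C + 1))"
  have s: "0 < s" unfolding s_def using \<eta> C by simp
  have sC: "4 * s * C \<le> \<eta>"
  proof -
    have "4 * s * C \<le> 4 * s * (C + 1)" using s by (intro mult_left_mono) auto
    also have "\<dots> = \<eta>" unfolding s_def using C by (simp add: field_simps)
    finally show ?thesis .
  qed
  from near[OF s \<eta>] obtain K where K: "finite K" "K \<noteq> {}" "\<And>n. near p c K s \<eta> (x n)" by blast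
  have "\<exists>w\<in>range boundary. (\<forall>z. w z \<noteq> 0 \<longrightarrow> z \<in> K) \<and> (\<forall>z. \<bar>w z\<bar> powr p \<le> 2 * C + 6 * \<eta> / s) \<and>
    transport_cost p c (x n - w) \<le> 10 * \<eta> + 4 * s * C" for n
    by (rule finite_dimensional_approximation[OF p c K(1,2) s \<eta> K(3) x l(2,1)])
  then obtain w where w: "\<And>n. w n \<in> range boundary" "\<And>n z. w n z \<noteq> 0 \<Longrightarrow> z \<in> K"
    "\<And>n z. \<bar>w n z\<bar> powr p \<le> 2 * C + 6 * \<eta> / s"
    "\<And>n. transport_cost p c (x n - w n) \<le> 10 * \<eta> + 4 * s * C" by metis
  define B where "B = (2 * C + 6 * \<eta> / s) powr (1 / p)"
  have wB: "\<bar>w n z\<bar> \<le> B" for n z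
  proof -
    have "(\<bar>w n z\<bar> powr p) powr (1 / p) \<le> B" unfolding B_def using w(3) p by (intro powr_mono2) auto
    then show ?thesis using p by (simp add: powr_powr)
  qed
  have D0: "0 \<le> D" using D[of undefined undefined] nonneg_costD[OF nn, of undefined undefined] by linarith
  define N where "N = real (card K) * (D + 1)"
  have N: "0 < N" unfolding N_def using K(1,2) D0 by (simp add: card_gt_0_iff)
  define \<zeta> where "\<zeta> = (\<eta> / N) powr (1 / p)"
  have \<zeta>: "0 < \<zeta>" "\<zeta> powr p = \<eta> / N" unfolding \<zeta>_def using \<eta> N p by (simp_all add: powr_powr)
  \<comment> \<open>The grid cell of mesh \<open>\<zeta>\<close> containing \<open>w n\<close>;
    restricting to \<open>K\<close> makes it an element of a finite function space.\<close>
  define F where "F n = restrict (\<lambda>z. \<lfloor>w n z / \<zeta>\<rfloor>) K" for n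
  have "F n \<in> K \<rightarrow>\<^sub>E {\<lfloor>- B / \<zeta>\<rfloor>..\<lfloor>B / \<zeta>\<rfloor>}" for n
  proof -
    have "\<lfloor>- B / \<zeta>\<rfloor> \<le> \<lfloor>w n z / \<zeta>\<rfloor> \<and> \<lfloor>w n z / \<zeta>\<rfloor> \<le> \<lfloor>B / \<zeta>\<rfloor>" for z
    proof -
      have "- B \<le> w n z" "w n z \<le> B" using wB[of n z] by auto
      then show ?thesis using \<zeta> by (intro conjI floor_mono divide_right_mono) auto
    qed
    then show ?thesis unfolding F_def by auto
  qed
  then have "range F \<subseteq> K \<rightarrow>\<^sub>E {\<lfloor>- B / \<zeta>\<rfloor>..\<lfloor>B / \<zeta>\<rfloor>}" by blast
  then have "finite (range F)" by (rule finite_subset) (use K(1) in \<open>auto intro: finite_PiE\<close>)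
  then have "\<not> inj F" using range_inj_infinite by blast
  then obtain n m where nm: "F n = F m" "n \<noteq> m" unfolding inj_def by blast
  have "\<bar>(w n - w m) z\<bar> \<le> \<zeta>" if "z \<in> K" for z
  proof -
    have "\<lfloor>w n z / \<zeta>\<rfloor> = \<lfloor>w m z / \<zeta>\<rfloor>" using fun_cong[OF nm(1), of z] that by (simp add: F_def)
    then have "\<bar>w n z / \<zeta> - w m z / \<zeta>\<bar> \<le> 1" by linarith
    then have "\<bar>w n z - w m z\<bar> / \<zeta> \<le> 1" using \<zeta> by (simp add: diff_divide_distrib[symmetric])
    then show ?thesis using \<zeta> by (simp add: field_simps)
  qed
  moreover have "z \<in> K" if "(w n - w m) z \<noteq> 0" for z
  proof -
    have "w n z \<noteq> 0 \<or> w m z \<noteq> 0" using that by auto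
    then show ?thesis using w(2) by blast
  qed
  ultimately have "transport_cost p c (w n - w m) \<le> real (card K) * (\<zeta> powr p * D)"
    using w(1) by (intro transport_cost_finite_support_le nn D p K(1) range_boundary_diff) auto
  also have "\<dots> \<le> \<eta>"
  proof -
    have "real (card K) * (\<zeta> powr p * D) = \<eta> * (real (card K) * D / N)" unfolding \<zeta>(2) by simp
    also have "\<dots> \<le> \<eta> * 1"
      using \<eta> N unfolding N_def by (intro mult_left_mono) (auto simp: field_simps)
    finally show ?thesis by simp
  qed
  finally have wd: "transport_cost p c (w n - w m) \<le> \<eta>" .
  define X Y where "X = x n - w n" and "Y = x m - w m"
  have XY: "X \<in> range boundary" "Y \<in> range boundary" "w n - w m \<in> range boundary"
    unfolding X_def Y_def by (intro range_boundary_diff x w(1))+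
  have "x n - x m = (X - Y) + (w n - w m)" unfolding X_def Y_def by (simp add: algebra_simps)
  then have "transport_cost p c (x n - x m) \<le> transport_cost p c X + transport_cost p c Y + transport_cost p c (w n - w m)"
    using transport_cost_add[OF nn range_boundary_diff[OF XY(1,2)] XY(3), of p]
      transport_cost_diff[OF nn XY(1,2), of p] by simp
  also have "\<dots> \<le> (10 * \<eta> + \<eta>) + (10 * \<eta> + \<eta>) + \<eta>"
    using w(4)[of n] w(4)[of m] sC wd unfolding X_def Y_def by linarith
  also have "\<dots> < \<epsilon>" using \<epsilon> by (simp add: \<eta>_def)
  finally show ?thesis using nm(2) by blast
qed

section \<open>Lower p-estimates for separated sequences\<close>

context snowflake_space
begin

lemma truncated_le: "0 < u \<Longrightarrow> truncated u x y \<le> \<rho> x y"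
proof (cases "u < d x y")
  case True
  then have "u powr p \<le> \<rho> x y" if "0 < u" using that p_pos unfolding \<rho>_def by (intro powr_mono2) auto
  then show "0 < u \<Longrightarrow> ?thesis" by (simp add: truncated_def)
next
  case False
  assume u: "0 < u"
  show ?thesis
  proof (cases "d x y = 0")
    case False
    then have pos: "0 < d x y" using d_nonneg[of x y] by simp
    then have "u powr (p - q) * \<sigma> x y \<le> d x y powr (p - q) * \<sigma> x y"
      using \<open>\<not> u < d x y\<close> p_less_q unfolding \<sigma>_def by (intro mult_right_mono powr_mono2') auto
    also have "\<dots> = \<rho> x y" using pos by (simp add: \<sigma>_def \<rho>_def powr_add[symmetric])
    finally show ?thesis by (simp add: truncated_def)
  qed (simp add: truncated_def \<sigma>_def \<rho>_def)
qed

theorem lower_p_estimate_separated: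
  fixes x :: "nat \<Rightarrow> 'a \<Rightarrow> real"
  assumes x: "\<And>n. x n \<in> range boundary" and B: "\<And>n. transport_cost p \<rho> (x n) \<le> B"
    and \<epsilon>: "0 < \<epsilon>" and sep: "\<And>n m. n \<noteq> m \<Longrightarrow> \<epsilon> \<le> transport_cost p \<rho> (x n - x m)"
  shows "\<exists>(r :: nat \<Rightarrow> nat) \<kappa>. 0 < \<kappa> \<and>
    (\<forall>n a. \<kappa> * (\<Sum>i<n. \<bar>a i\<bar> powr p) \<le> transport_cost p \<rho> (\<Sum>i<n. a i *\<^sub>R x (r i)))"
proof -
  define T where "T k = transport_cost p (truncated (scale k))" for k
  have T_nonneg: "0 \<le> T k m" if "m \<in> range boundary" for k m
    unfolding T_def using nonneg_costs(3) that by (rule transport_cost_nonneg)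
  \<comment> \<open>Both ways in which mass can escape end here: they supply gauges and indices, and
    a subsequence is then extracted.\<close>
  have finish: ?thesis
    if c: "\<And>j. nonneg_cost (c j)" "0 < C" "\<And>J y z. finite J \<Longrightarrow> (\<Sum>j\<in>J. c j y z) \<le> C * \<rho> y z"
      and \<theta>: "0 < \<theta>" "\<And>j. \<theta> \<le> transport_cost p (c j) (x (n j))" for c C \<theta> and n :: "nat \<Rightarrow> nat"
  proof -
    obtain r :: "nat \<Rightarrow> nat" and \<kappa> where r: "strict_mono r" "0 < \<kappa>"
      "\<And>N a. \<kappa> * (\<Sum>i<N. \<bar>a i\<bar> powr p) \<le> transport_cost p \<rho> (\<Sum>i<N. a i *\<^sub>R x (n (r i)))"
      by (rule lower_p_estimate[OF p_pos nonneg_costs(2) c x B \<theta>]) (assumption | rule that)+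
    then show ?thesis by (intro exI[of _ "\<lambda>i. n (r i)"] exI[of _ \<kappa>]) simp
  qed
  show ?thesis
  proof (cases "\<exists>\<theta>>0. \<forall>W. finite W \<longrightarrow> (\<exists>n W'. finite W' \<and> W' \<inter> W = {} \<and> \<theta> \<le> (\<Sum>k\<in>W'. T k (x n)))")
    case True
    then obtain \<theta> where \<theta>: "0 < \<theta>"
      and ex: "\<forall>W. finite W \<longrightarrow> (\<exists>n W'. finite W' \<and> W' \<inter> W = {} \<and> \<theta> \<le> (\<Sum>k\<in>W'. T k (x n)))"
      by (elim exE conjE)
    define P where "P W nW \<longleftrightarrow> finite (snd nW) \<and> snd nW \<inter> W = {} \<and> \<theta> \<le> (\<Sum>k\<in>snd nW. T k (x (fst nW)))"
      for W and nW :: "nat \<times> int set"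
    define n W' where "n W = fst (SOME nW. P W nW)" and "W' W = snd (SOME nW. P W nW)" for W
    have nW: "finite (W' W) \<and> W' W \<inter> W = {} \<and> \<theta> \<le> (\<Sum>k\<in>W' W. T k (x (n W)))" if W: "finite W" for W
    proof -
      obtain i U where "finite U" "U \<inter> W = {}" "\<theta> \<le> (\<Sum>k\<in>U. T k (x i))" using ex W by meson
      then have "P W (i, U)" by (simp add: P_def)
      then have "P W (SOME nW. P W nW)" by (rule someI)
      then show ?thesis unfolding P_def n_def W'_def .
    qed
    \<comment> \<open>\<open>V\<close> collects the scales already used. The gauges for different
      \<open>j\<close> thus use disjoint sets of scales, and \<open>sum_truncated_le\<close> bounds
      all of them together.\<close>
    define V where "V = rec_nat {} (\<lambda>_ W. W \<union> W' W)"
    have V_0: "V 0 = {}" and V_Suc: "V (Suc j) = V j \<union> W' (V j)" for j by (simp_all add: V_def)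
    have V: "finite (V j)" for j using nW by (induction j) (auto simp: V_0 V_Suc)
    define U where "U j = W' (V j)" for j
    have U: "finite (U j)" "U j \<inter> V j = {}" "\<theta> \<le> (\<Sum>k\<in>U j. T k (x (n (V j))))" for j
      using nW[OF V[of j]] by (auto simp: U_def)
    have mono: "V i \<subseteq> V j" if "i \<le> j" for i j
      using that by (rule lift_Suc_mono_le[rotated]) (auto simp: V_Suc)
    have disj: "U i \<inter> U j = {}" if "i \<noteq> j" for i j
    proof -
      have "U i \<inter> U j = {}" if "i < j" for i j
        using mono[of "Suc i" j] that U(2)[of j] by (auto simp: V_Suc U_def)
      then show ?thesis using \<open>i \<noteq> j\<close> by (metis Int_commute linorder_neqE_nat)
    qed
    show ?thesis
    proof (rule finish[of "\<lambda>j y z. \<Sum>k\<in>U j. truncated (scale k) y z" scale_const \<theta> "\<lambda>j. n (V j)"])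
      show "nonneg_cost (\<lambda>y z. \<Sum>k\<in>U j. truncated (scale k) y z)" for j
        using nonneg_costs(3) by (auto simp: nonneg_cost_def intro!: sum_nonneg)
      show "(\<Sum>j\<in>J. \<Sum>k\<in>U j. truncated (scale k) y z) \<le> scale_const * \<rho> y z" if "finite J" for J y z
      proof -
        have "(\<Sum>j\<in>J. \<Sum>k\<in>U j. truncated (scale k) y z) = (\<Sum>k\<in>(\<Union>j\<in>J. U j). truncated (scale k) y z)"
          using that U(1) disj by (intro sum.UNION_disjoint[symmetric]) auto
        also have "\<dots> \<le> scale_const * \<rho> y z" using that U(1) by (intro sum_truncated_le) auto
        finally show ?thesis .
      qed
      show "\<theta> \<le> transport_cost p (\<lambda>y z. \<Sum>k\<in>U j. truncated (scale k) y z) (x (n (V j)))" for j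
      proof -
        have "(\<Sum>k\<in>U j. T k (x (n (V j))))
            \<le> transport_cost p (\<lambda>y z. \<Sum>k\<in>U j. truncated (scale k) y z) (x (n (V j)))"
          unfolding T_def by (rule transport_cost_sum_gauges[OF nonneg_costs(3) x])
        then show ?thesis using U(3)[of j] by linarith
      qed
    qed (use \<theta> scale_const_pos in auto)
  next
    case False
    \<comment> \<open>304 = 2 * 4 * 38: a difference of two members has less than
      \<open>\<epsilon> / 152\<close> outside \<open>W\<close>, which amounts to
      \<open>\<epsilon> / 4\<close> after multiplication by 38.\<close>
    have "\<not> (\<forall>W. finite W \<longrightarrow> (\<exists>n W'. finite W' \<and> W' \<inter> W = {} \<and> \<epsilon> / 304 \<le> (\<Sum>k\<in>W'. T k (x n))))"
    proof
      assume *: "\<forall>W. finite W \<longrightarrow> (\<exists>n W'. finite W' \<and> W' \<inter> W = {} \<and> \<epsilon> / 304 \<le> (\<Sum>k\<in>W'. T k (x n)))"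
      have "0 < \<epsilon> / 304" using \<epsilon> by simp
      with * False show False by (elim notE) (intro exI[of _ "\<epsilon> / 304"] conjI)
    qed
    then obtain W where W: "finite W"
      and small': "\<And>n W'. \<not> (finite W' \<and> W' \<inter> W = {} \<and> \<epsilon> / 304 \<le> (\<Sum>k\<in>W'. T k (x n)))"
      unfolding not_all not_imp not_ex by (elim exE conjE) iprover
    have small: "(\<Sum>k\<in>W'. T k (x n)) < \<epsilon> / 304" if "finite W'" "W' \<inter> W = {}" for n W'
      using small'[of W' n] that by auto
    define \<kappa> where "\<kappa> y z = (\<Sum>k\<in>W. truncated (scale k) y z)" for y z
    define D where "D = (\<Sum>k\<in>W. scale k powr p)"
    define A where "A = (\<Sum>k\<in>W. scale k powr (p - q))"
    have \<kappa>: "pseudo_metric \<kappa>"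
    proof (rule pseudo_metricI)
      fix y z w
      show "0 \<le> \<kappa> y z" "\<kappa> y y = 0" "\<kappa> y z = \<kappa> z y"
        unfolding \<kappa>_def using pseudo_metricD(1-3)[OF truncated_metric]
        by (auto intro!: sum_nonneg sum.neutral sum.cong)
      show "\<kappa> y w \<le> \<kappa> y z + \<kappa> z w"
        unfolding \<kappa>_def sum.distrib[symmetric] by (intro sum_mono pseudo_metricD(4)[OF truncated_metric])
    qed
    have nn: "nonneg_cost \<kappa>" using \<kappa> by (rule pseudo_metric_imp_nonneg_cost)
    have D: "\<kappa> y z \<le> D" "0 \<le> D" for y z
      unfolding \<kappa>_def D_def by (auto intro!: sum_mono sum_nonneg simp: truncated_def)
    have A: "\<kappa> y z \<le> A * \<sigma> y z" "0 \<le> A" for y z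
      unfolding \<kappa>_def A_def sum_distrib_right by (auto intro!: sum_mono sum_nonneg simp: truncated_def)
    \<comment> \<open>Of \<open>\<epsilon>\<close>, one half covers the error in
      \<open>transport_cost_le_sum_truncated\<close> and one quarter the scales outside
      \<open>W\<close>. The last quarter, divided by 38, is left for
      \<open>\<kappa>\<close>.\<close>
    have sep\<kappa>: "\<epsilon> / 152 \<le> transport_cost p \<kappa> (x n - x m)" if "n \<noteq> m" for n m
    proof -
      have mem: "x n - x m \<in> range boundary" by (intro range_boundary_diff x)
      obtain W' where W': "finite W'"
        "transport_cost p \<rho> (x n - x m) \<le> 38 * (\<Sum>k\<in>W'. T k (x n - x m)) + \<epsilon> / 2"
        using transport_cost_le_sum_truncated[OF mem, of "\<epsilon> / 2"] \<epsilon> unfolding T_def by auto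
      have "(\<Sum>k\<in>W'. T k (x n - x m)) \<le> (\<Sum>k\<in>W \<union> (W' - W). T k (x n - x m))"
        using W W'(1) T_nonneg[OF mem] by (intro sum_mono2) auto
      also have "\<dots> = (\<Sum>k\<in>W. T k (x n - x m)) + (\<Sum>k\<in>W' - W. T k (x n - x m))"
        using W W'(1) by (intro sum.union_disjoint) auto
      also have "(\<Sum>k\<in>W' - W. T k (x n - x m)) \<le> (\<Sum>k\<in>W' - W. T k (x n) + T k (x m))"
        unfolding T_def by (intro sum_mono transport_cost_diff nonneg_costs x)
      also have "\<dots> \<le> \<epsilon> / 152"
      proof -
        have fin: "finite (W' - W)" "(W' - W) \<inter> W = {}" using W'(1) by auto
        show ?thesis unfolding sum.distrib using small[OF fin, of n] small[OF fin, of m] by simp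
      qed
      also have "(\<Sum>k\<in>W. T k (x n - x m)) \<le> transport_cost p \<kappa> (x n - x m)"
        unfolding T_def \<kappa>_def[abs_def] by (rule transport_cost_sum_gauges[OF nonneg_costs(3) mem])
      finally show ?thesis using W'(2) sep[OF that] by linarith
    qed
    \<comment> \<open>The approximant is the long part of a near-optimal flow, whose mass is bounded
      in terms of \<open>u\<close>. The short part costs at most
      \<open>A * (u powr (q - p) * (B + 1))\<close>, which is at most \<open>\<eta>\<close> for the
      given \<open>u\<close>; such a \<open>u\<close> exists because \<open>p < q\<close>.
      \<open>A + 1\<close> and \<open>B + 1\<close> keep denominators positive.\<close>
    have approx: "\<exists>C. \<forall>n. \<exists>l. cost p (\<lambda>_ _. 1) l \<le> C \<and> transport_cost p \<kappa> (x n - boundary l) \<le> \<eta>"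
      if \<eta>: "0 < \<eta>" for \<eta>
    proof -
      have B0: "0 \<le> B" using transport_cost_nonneg[OF nonneg_costs(2) x, of p 0] B[of 0] by linarith
      define u where "u = (\<eta> / ((A + 1) * (B + 1))) powr (1 / (q - p))"
      have u: "0 < u" and u_eq: "u powr (q - p) = \<eta> / ((A + 1) * (B + 1))"
        unfolding u_def using \<eta> A(2) B0 p_less_q by (simp_all add: powr_powr add_nonneg_pos)
      have "\<exists>l. cost p (\<lambda>_ _. 1) l \<le> u powr (- p) * (B + 1) \<and> transport_cost p \<kappa> (x n - boundary l) \<le> \<eta>" for n
      proof -
        obtain l where l: "boundary l = x n" "cost p \<rho> l < B + 1"
          using transport_cost_less_iff[OF nonneg_costs(2) x, of p n "B + 1"] B[of n] by auto
        have trunc: "cost p (truncated u) l \<le> B + 1"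
          using cost_mono[of l "truncated u" \<rho> p] truncated_le[OF u] l(2) by force
        have "cost p (\<lambda>_ _. 1) (long u l) \<le> u powr (- p) * (B + 1)"
          using weight_long[OF u, of l] mult_left_mono[OF trunc, of "u powr (- p)"] by simp
        moreover have "transport_cost p \<kappa> (x n - boundary (long u l)) \<le> \<eta>"
        proof -
          have "x n - boundary (long u l) = boundary (short u l)"
            unfolding l(1)[symmetric] boundary_long_short[of u l, symmetric] by simp
          then have "transport_cost p \<kappa> (x n - boundary (long u l)) \<le> cost p \<kappa> (short u l)"
            using transport_cost_le[OF nn, of p "short u l"] by simp
          also have "\<dots> \<le> cost p (\<lambda>y z. A * \<sigma> y z) (short u l)" using A(1) by (intro cost_mono)
          also have "\<dots> = A * cost p \<sigma> (short u l)" by (rule cost_cmult)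
          also have "\<dots> \<le> A * (u powr (q - p) * (B + 1))"
            using cost_short[OF u, of l] mult_left_mono[OF trunc, of "u powr (q - p)"] A(2)
            by (intro mult_left_mono) auto
          also have "\<dots> = \<eta> * (A / (A + 1))"
          proof -
            have "A + 1 \<noteq> 0" "B + 1 \<noteq> 0" using A(2) B0 by auto
            then have "\<eta> / ((A + 1) * (B + 1)) * (B + 1) = \<eta> / (A + 1)"
              unfolding divide_divide_eq_left[symmetric] by simp
            then show ?thesis unfolding u_eq by simp
          qed
          also have "\<dots> \<le> \<eta> * 1" using \<eta> A(2) by (intro mult_left_mono) auto
          finally show ?thesis by simp
        qed
        ultimately show ?thesis by blast
      qed
      then show ?thesis by blast
    qed
    fix b :: 'a
    show ?thesis
    \<comment> \<open>Without tightness the sequence can be localized on disjoint sets; with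
      tightness two members are close for \<open>\<kappa>\<close>, against
      \<open>sep\<kappa>\<close>.\<close>
    proof (cases "\<exists>s>0. \<exists>e>0. \<forall>K. finite K \<and> b \<in> K \<longrightarrow> (\<exists>n. \<not> near p \<kappa> K s e (x n))")
      case True
      then obtain s e where se: "0 < s" "0 < e"
        and far: "\<And>K. finite K \<Longrightarrow> b \<in> K \<Longrightarrow> \<exists>n. \<not> near p \<kappa> K s e (x n)" by blast
      obtain n :: "nat \<Rightarrow> nat" and c' \<theta> where c': "0 < \<theta>" "\<And>j. nonneg_cost (c' j)"
        "\<And>j. \<theta> \<le> transport_cost p (c' j) (x (n j))"
        "\<And>J y z. finite J \<Longrightarrow> (\<Sum>j\<in>J. c' j y z) \<le> 2 * \<kappa> y z"
        by (rule disjoint_localization[OF \<kappa> D x se far]) (assumption | rule that)+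
      show ?thesis
      proof (rule finish[of c' "2 * scale_const" \<theta> n])
        show "(\<Sum>j\<in>J. c' j y z) \<le> 2 * scale_const * \<rho> y z" if "finite J" for J y z
          using c'(4)[OF that, of y z] sum_truncated_le[OF W, of y z] unfolding \<kappa>_def by linarith
      qed (use c' scale_const_pos in auto)
    next
      case False
      have "\<exists>n m. n \<noteq> m \<and> transport_cost p \<kappa> (x n - x m) < \<epsilon> / 152"
      proof (rule near_finite_imp_close[OF p_pos p_le_1 \<kappa> D(1) x _ approx])
        show "\<exists>K. finite K \<and> K \<noteq> {} \<and> (\<forall>n. near p \<kappa> K s e (x n))" if "0 < s" "0 < e" for s e
        proof (rule ccontr)
          assume *: "\<not> ?thesis"
          have "\<exists>n. \<not> near p \<kappa> K s e (x n)" if "finite K" "b \<in> K" for K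
            using * that by blast
          with False that show False by blast
        qed
      qed (use \<epsilon> in auto)
      then show ?thesis using sep\<kappa> by (metis not_le)
    qed
  qed
qed

end

section \<open>Free spaces\<close>

lemma subspace_complement:
  fixes Z C :: "'v::real_vector set"
  assumes Z: "subspace Z" and C: "subspace C" and ZC: "Z \<subseteq> C"
  obtains Y where "subspace Y" "Y \<subseteq> C" "Y \<inter> Z = {0}" "\<And>s. s \<in> C \<Longrightarrow> \<exists>y\<in>Y. s - y \<in> Z"
proof -
  obtain B where B: "B \<subseteq> Z" "independent B" "Z \<subseteq> span B" using maximal_independent_subset[of Z] by blast
  obtain B' where B': "B \<subseteq> B'" "B' \<subseteq> C" "independent B'" "C \<subseteq> span B'"
    using maximal_independent_subset_extend[of B C] B ZC by blast
  have spB: "span B = Z" using B Z by (simp add: span_minimal subset_antisym)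
  define Y where "Y = span (B' - B)"
  have YC: "Y \<subseteq> C" unfolding Y_def using B' C by (intro span_minimal) auto
  have "x = 0" if "x \<in> Y" "x \<in> Z" for x
  proof -
    have x: "x \<in> span B'" using that(2) ZC B' by blast
    have 1: "representation B' x = representation B x"
      using B' that(2) spB by (intro representation_extend) auto
    have 2: "representation B' x = representation (B' - B) x"
      using B' that(1) by (intro representation_extend) (auto simp: Y_def)
    have "representation B' x v = 0" for v
    proof (cases "v \<in> B")
      case True
      then show ?thesis unfolding 2 using representation_ne_zero[of "B' - B" x v] by blast
    next
      case False
      then show ?thesis unfolding 1 using representation_ne_zero[of B x v] by blast
    qed
    then show ?thesis using sum_nonzero_representation_eq[OF B'(3) x] by simp
  qed
  moreover have "0 \<in> Y" unfolding Y_def by (rule span_zero)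
  moreover have "0 \<in> Z" using Z by (rule subspace_0)
  ultimately have int: "Y \<inter> Z = {0}" by blast
  have "\<exists>y\<in>Y. s - y \<in> Z" if "s \<in> C" for s
  proof -
    have "s \<in> span ((B' - B) \<union> B)" using that B' by (simp add: Un_absorb2 sup_commute) (metis Un_absorb1 subsetD)
    then obtain y z where "y \<in> span (B' - B)" "z \<in> span B" "s = y + z" unfolding span_Un by blast
    then show ?thesis using spB unfolding Y_def by (intro bexI[of _ y]) auto
  qed
  then show ?thesis using that[of Y] int YC unfolding Y_def by auto
qed

lemma quasi_triangle_of_powr:
  fixes a b c p :: real
  assumes p: "0 < p" "p \<le> 1" and nn: "0 \<le> a" "0 \<le> b" "0 \<le> c" and le: "c powr p \<le> a powr p + b powr p"
  shows "c \<le> 2 powr (1 / p) * (a + b)"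
proof -
  have "c powr p \<le> 2 * (a + b) powr p"
    using le powr_mono2[of p a "a + b"] powr_mono2[of p b "a + b"] p nn by auto
  then have "(c powr p) powr (1 / p) \<le> (2 * (a + b) powr p) powr (1 / p)"
    using p by (intro powr_mono2) auto
  then show ?thesis using p nn by (simp add: powr_powr powr_mult)
qed

text \<open>\<open>\<kappa>\<close> is the p-th power of a p-seminorm. The power is subadditive, so
  it is Lipschitz for its own distance and limits can be handled as for a norm; only homogeneity
  differs.\<close>

locale p_seminorm =
  fixes p :: real and V :: "'v::real_vector set" and \<kappa> :: "'v \<Rightarrow> real"
  assumes p: "0 < p" "p \<le> 1" and V: "subspace V"
    and nonneg: "\<And>x. x \<in> V \<Longrightarrow> 0 \<le> \<kappa> x"
    and add: "\<And>x y. x \<in> V \<Longrightarrow> y \<in> V \<Longrightarrow> \<kappa> (x + y) \<le> \<kappa> x + \<kappa> y"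
    and scale: "\<And>c x. x \<in> V \<Longrightarrow> \<kappa> (c *\<^sub>R x) = \<bar>c\<bar> powr p * \<kappa> x"
begin

lemma minus: "x \<in> V \<Longrightarrow> \<kappa> (- x) = \<kappa> x"
  using scale[of x "- 1"] by simp

lemma diff: "x \<in> V \<Longrightarrow> y \<in> V \<Longrightarrow> \<kappa> (x - y) \<le> \<kappa> x + \<kappa> y"
  using add[of x "- y"] minus[of y] subspace_neg[OF V] by simp

lemma sym: "x \<in> V \<Longrightarrow> y \<in> V \<Longrightarrow> \<kappa> (x - y) = \<kappa> (y - x)"
  using minus[of "x - y"] subspace_diff[OF V] by simp

lemma triangle: "x \<in> V \<Longrightarrow> y \<in> V \<Longrightarrow> z \<in> V \<Longrightarrow> \<kappa> (x - z) \<le> \<kappa> (x - y) + \<kappa> (y - z)"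
  using add[of "x - y" "y - z"] subspace_diff[OF V] by simp

lemma abs_diff_le: "x \<in> V \<Longrightarrow> y \<in> V \<Longrightarrow> \<bar>\<kappa> x - \<kappa> y\<bar> \<le> \<kappa> (x - y)"
  using add[of "x - y" y] add[of "y - x" x] sym[of x y] subspace_diff[OF V] by (simp add: abs_le_iff)

lemma zero: "\<kappa> 0 = 0"
  using scale[OF subspace_0[OF V], of 0] by simp

definition cauchy_seqs :: "(nat \<Rightarrow> 'v) set" where
  "cauchy_seqs = {s. (\<forall>n. s n \<in> V) \<and> (\<forall>e>0. \<exists>N. \<forall>m\<ge>N. \<forall>n\<ge>N. \<kappa> (s m - s n) < e)}"

definition null_seqs :: "(nat \<Rightarrow> 'v) set" where
  "null_seqs = {s. (\<forall>n. s n \<in> V) \<and> (\<lambda>n. \<kappa> (s n)) \<longlonglongrightarrow> 0}"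

lemma cauchy_V: "s \<in> cauchy_seqs \<Longrightarrow> s n \<in> V"
  by (simp add: cauchy_seqs_def)

lemma tendsto_iff_less: "(\<forall>n. s n \<in> V) \<Longrightarrow> (\<lambda>n. \<kappa> (s n)) \<longlonglongrightarrow> 0 \<longleftrightarrow> (\<forall>e>0. \<exists>N. \<forall>n\<ge>N. \<kappa> (s n) < e)"
  unfolding LIMSEQ_iff using nonneg by simp

lemma null_subset_cauchy: "null_seqs \<subseteq> cauchy_seqs"
proof
  fix s assume s: "s \<in> null_seqs"
  then have V': "s n \<in> V" for n by (simp add: null_seqs_def)
  have "\<exists>N. \<forall>m\<ge>N. \<forall>n\<ge>N. \<kappa> (s m - s n) < e" if "e > 0" for e
  proof -
    have "\<forall>e>0. \<exists>N. \<forall>n\<ge>N. \<kappa> (s n) < e" using s tendsto_iff_less[of s] by (simp add: null_seqs_def)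
    then obtain N where "\<forall>n\<ge>N. \<kappa> (s n) < e / 2" using \<open>e > 0\<close> half_gt_zero by blast
    then show ?thesis using diff[OF V' V'] by (intro exI[of _ N]) (smt (verit) field_sum_of_halves)
  qed
  then show "s \<in> cauchy_seqs" using V' by (simp add: cauchy_seqs_def)
qed

lemma subspace_null: "subspace null_seqs"
  unfolding subspace_def
proof (intro conjI ballI allI)
  show "0 \<in> null_seqs" using subspace_0[OF V] by (simp add: null_seqs_def zero)
next
  fix s t assume s: "s \<in> null_seqs" and t: "t \<in> null_seqs"
  have V': "\<forall>n. s n \<in> V" "\<forall>n. t n \<in> V" using s t by (auto simp: null_seqs_def)
  have "(\<lambda>n. \<kappa> (s n) + \<kappa> (t n)) \<longlonglongrightarrow> 0 + 0" using s t by (intro tendsto_add) (auto simp: null_seqs_def)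
  then have lim: "(\<lambda>n. \<kappa> (s n) + \<kappa> (t n)) \<longlonglongrightarrow> 0" by simp
  have "0 \<le> \<kappa> ((s + t) n) \<and> \<kappa> ((s + t) n) \<le> \<kappa> (s n) + \<kappa> (t n)" for n
    using V' nonneg[of "s n + t n"] subspace_add[OF V, of "s n" "t n"] add[of "s n" "t n"] by simp
  then have "(\<lambda>n. \<kappa> ((s + t) n)) \<longlonglongrightarrow> 0"
    by (intro tendsto_sandwich[OF _ _ tendsto_const lim]) (simp_all add: always_eventually)
  then show "s + t \<in> null_seqs" using V' subspace_add[OF V] by (simp add: null_seqs_def)
next
  fix c s assume s: "s \<in> null_seqs"
  have V': "\<forall>n. s n \<in> V" using s by (auto simp: null_seqs_def)
  have "(\<lambda>n. \<bar>c\<bar> powr p * \<kappa> (s n)) \<longlonglongrightarrow> \<bar>c\<bar> powr p * 0"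
    using s by (intro tendsto_mult_left) (auto simp: null_seqs_def)
  then show "c *\<^sub>R s \<in> null_seqs"
    using V' subspace_scale[OF V] by (simp add: null_seqs_def scaleR_fun_def scale)
qed

lemma subspace_cauchy: "subspace cauchy_seqs"
  unfolding subspace_def
proof (intro conjI ballI allI)
  show "0 \<in> cauchy_seqs" using subspace_0[OF subspace_null] null_subset_cauchy by blast
next
  fix s t assume s: "s \<in> cauchy_seqs" and t: "t \<in> cauchy_seqs"
  have "\<exists>N. \<forall>m\<ge>N. \<forall>n\<ge>N. \<kappa> ((s + t) m - (s + t) n) < e" if "e > 0" for e
  proof -
    obtain N1 where N1: "\<forall>m\<ge>N1. \<forall>n\<ge>N1. \<kappa> (s m - s n) < e / 2"
      using s \<open>e > 0\<close> unfolding cauchy_seqs_def by (auto dest!: spec[of _ "e / 2"])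
    obtain N2 where N2: "\<forall>m\<ge>N2. \<forall>n\<ge>N2. \<kappa> (t m - t n) < e / 2"
      using t \<open>e > 0\<close> unfolding cauchy_seqs_def by (auto dest!: spec[of _ "e / 2"])
    have "\<kappa> ((s + t) m - (s + t) n) < e" if "m \<ge> max N1 N2" "n \<ge> max N1 N2" for m n
    proof -
      have "(s + t) m - (s + t) n = (s m - s n) + (t m - t n)" by simp
      then have "\<kappa> ((s + t) m - (s + t) n) \<le> \<kappa> (s m - s n) + \<kappa> (t m - t n)"
        using add[OF subspace_diff[OF V] subspace_diff[OF V], OF cauchy_V[OF s] cauchy_V[OF s] cauchy_V[OF t] cauchy_V[OF t]] by metis
      moreover have "\<kappa> (s m - s n) < e / 2" "\<kappa> (t m - t n) < e / 2" using N1 N2 that by auto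
      ultimately show ?thesis by linarith
    qed
    then show ?thesis by blast
  qed
  then show "s + t \<in> cauchy_seqs"
    using cauchy_V[OF s] cauchy_V[OF t] subspace_add[OF V] by (simp add: cauchy_seqs_def)
next
  fix c s assume s: "s \<in> cauchy_seqs"
  have "\<exists>N. \<forall>m\<ge>N. \<forall>n\<ge>N. \<kappa> ((c *\<^sub>R s) m - (c *\<^sub>R s) n) < e" if "e > 0" for e
  proof -
    define e' where "e' = e / (\<bar>c\<bar> powr p + 1)"
    have "0 < \<bar>c\<bar> powr p + 1" by (simp add: add_nonneg_pos)
    then have e': "0 < e'" and e: "e = e' * (\<bar>c\<bar> powr p + 1)" using \<open>e > 0\<close> by (auto simp: e'_def)
    obtain N where N: "\<forall>m\<ge>N. \<forall>n\<ge>N. \<kappa> (s m - s n) < e'"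
      using s e' unfolding cauchy_seqs_def by (auto dest!: spec[of _ e'])
    have "\<kappa> ((c *\<^sub>R s) m - (c *\<^sub>R s) n) < e" if "m \<ge> N" "n \<ge> N" for m n
    proof -
      have "(c *\<^sub>R s) m - (c *\<^sub>R s) n = c *\<^sub>R (s m - s n)" by (simp add: scaleR_fun_def scaleR_diff_right)
      then have "\<kappa> ((c *\<^sub>R s) m - (c *\<^sub>R s) n) = \<bar>c\<bar> powr p * \<kappa> (s m - s n)"
        using scale[OF subspace_diff[OF V], OF cauchy_V[OF s] cauchy_V[OF s]] by metis
      also have "\<dots> \<le> \<bar>c\<bar> powr p * e'" using N that by (intro mult_left_mono) (auto intro: less_imp_le)
      also have "\<dots> < e" using e e' by (simp add: algebra_simps)
      finally show ?thesis .
    qed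
    then show ?thesis by blast
  qed
  then show "c *\<^sub>R s \<in> cauchy_seqs"
    using cauchy_V[OF s] subspace_scale[OF V] by (simp add: cauchy_seqs_def scaleR_fun_def)
qed

definition seq_value :: "(nat \<Rightarrow> 'v) \<Rightarrow> real" where
  "seq_value s = lim (\<lambda>n. \<kappa> (s n))"

lemma seq_value_tendsto:
  assumes "s \<in> cauchy_seqs"
  shows "(\<lambda>n. \<kappa> (s n)) \<longlonglongrightarrow> seq_value s"
proof -
  have "Cauchy (\<lambda>n. \<kappa> (s n))"
  proof (rule metric_CauchyI)
    fix e :: real assume "e > 0"
    then obtain N where N: "\<forall>m\<ge>N. \<forall>n\<ge>N. \<kappa> (s m - s n) < e" using assms unfolding cauchy_seqs_def by blast
    show "\<exists>M. \<forall>m\<ge>M. \<forall>n\<ge>M. dist (\<kappa> (s m)) (\<kappa> (s n)) < e"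
      unfolding dist_real_def using N abs_diff_le[OF cauchy_V[OF assms] cauchy_V[OF assms]]
      by (intro exI[of _ N]) (meson order_le_less_trans)
  qed
  then show ?thesis unfolding seq_value_def using Cauchy_convergent convergent_LIMSEQ_iff by blast
qed

lemma seq_value_nonneg: "s \<in> cauchy_seqs \<Longrightarrow> 0 \<le> seq_value s"
  by (rule LIMSEQ_le_const[OF seq_value_tendsto]) (auto intro!: nonneg cauchy_V)

lemma seq_value_add:
  assumes s: "s \<in> cauchy_seqs" and t: "t \<in> cauchy_seqs"
  shows "seq_value (s + t) \<le> seq_value s + seq_value t"
proof (rule LIMSEQ_le)
  show "(\<lambda>n. \<kappa> ((s + t) n)) \<longlonglongrightarrow> seq_value (s + t)"
    using seq_value_tendsto subspace_add[OF subspace_cauchy s t] by blast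
  show "(\<lambda>n. \<kappa> (s n) + \<kappa> (t n)) \<longlonglongrightarrow> seq_value s + seq_value t"
    using s t by (intro tendsto_add seq_value_tendsto)
qed (use add cauchy_V[OF s] cauchy_V[OF t] in auto)

lemma seq_value_scale:
  assumes s: "s \<in> cauchy_seqs"
  shows "seq_value (c *\<^sub>R s) = \<bar>c\<bar> powr p * seq_value s"
proof (rule LIMSEQ_unique)
  show "(\<lambda>n. \<kappa> ((c *\<^sub>R s) n)) \<longlonglongrightarrow> seq_value (c *\<^sub>R s)"
    using seq_value_tendsto subspace_scale[OF subspace_cauchy s] by blast
  have "(\<lambda>n. \<bar>c\<bar> powr p * \<kappa> (s n)) \<longlonglongrightarrow> \<bar>c\<bar> powr p * seq_value s"
    using s by (intro tendsto_mult_left seq_value_tendsto)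
  then show "(\<lambda>n. \<kappa> ((c *\<^sub>R s) n)) \<longlonglongrightarrow> \<bar>c\<bar> powr p * seq_value s"
    using scale[OF cauchy_V[OF s]] by (simp add: scaleR_fun_def)
qed

lemma seq_value_null_iff:
  assumes s: "s \<in> cauchy_seqs"
  shows "seq_value s = 0 \<longleftrightarrow> s \<in> null_seqs"
  using seq_value_tendsto[OF s] cauchy_V[OF s] LIMSEQ_unique by (auto simp: null_seqs_def)

lemma seq_value_diff_le:
  assumes s: "s \<in> cauchy_seqs" and t: "t \<in> cauchy_seqs" and "\<And>n. n \<ge> N \<Longrightarrow> \<kappa> (s n - t n) \<le> e"
  shows "seq_value (s - t) \<le> e"
proof (rule LIMSEQ_le_const2)
  show "(\<lambda>n. \<kappa> ((s - t) n)) \<longlonglongrightarrow> seq_value (s - t)"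
    using seq_value_tendsto subspace_diff[OF subspace_cauchy s t] by blast
qed (use assms(3) in auto)

text \<open>
  The completion is realised inside the Cauchy sequences, as a complement \<open>Y\<close> of the null sequences.
\<close>

lemma completion_exists:
  obtains Y :: "(nat \<Rightarrow> 'v) set" and NY j where "s_Banach_space p Y NY"
    "\<And>x. x \<in> V \<Longrightarrow> j x \<in> Y" "\<And>x y. x \<in> V \<Longrightarrow> y \<in> V \<Longrightarrow> j (x + y) = j x + j y"
    "\<And>c x. x \<in> V \<Longrightarrow> j (c *\<^sub>R x) = c *\<^sub>R j x" "\<And>x. x \<in> V \<Longrightarrow> NY (j x) = \<kappa> x powr (1 / p)"
proof -
  obtain Y where Y: "subspace Y" "Y \<subseteq> cauchy_seqs" "Y \<inter> null_seqs = {0}"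
    "\<And>s. s \<in> cauchy_seqs \<Longrightarrow> \<exists>y\<in>Y. s - y \<in> null_seqs"
    by (rule subspace_complement[OF subspace_null subspace_cauchy null_subset_cauchy]) (rule that)
  \<comment> \<open>The linear projection onto \<open>Y\<close> along the null sequences. It serves
    as quotient map while the carrier stays inside the type of sequences.\<close>
  define P where "P s = (SOME y. y \<in> Y \<and> s - y \<in> null_seqs)" for s
  have P: "P s \<in> Y \<and> s - P s \<in> null_seqs" if "s \<in> cauchy_seqs" for s
    unfolding P_def using Y(4)[OF that] by (intro someI_ex[of "\<lambda>y. y \<in> Y \<and> s - y \<in> null_seqs"]) blast
  have P_eq: "P s = y" if "s \<in> cauchy_seqs" "y \<in> Y" "s - y \<in> null_seqs" for s y
  proof -
    have "P s - y \<in> Y" using P[OF that(1)] that(2) Y(1) by (simp add: subspace_diff)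
    moreover have "(s - y) - (s - P s) \<in> null_seqs"
      by (rule subspace_diff[OF subspace_null that(3) conjunct2[OF P[OF that(1)]]])
    then have "P s - y \<in> null_seqs" by simp
    ultimately have "P s - y = 0" using Y(3) by blast
    then show ?thesis by (simp only: right_minus_eq)
  qed
  define NY where "NY s = seq_value s powr (1 / p)" for s
  have NY_p: "NY s powr p = seq_value s" if "s \<in> cauchy_seqs" for s
    unfolding NY_def using p seq_value_nonneg[OF that] by (simp add: powr_powr)
  have P_add: "P (s + t) = P s + P t" if "s \<in> cauchy_seqs" "t \<in> cauchy_seqs" for s t
  proof (rule P_eq)
    show "s + t \<in> cauchy_seqs" using that by (intro subspace_add[OF subspace_cauchy])
    show "P s + P t \<in> Y" using that P by (intro subspace_add[OF Y(1)]) auto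
    have "(s - P s) + (t - P t) \<in> null_seqs" using that P by (intro subspace_add[OF subspace_null]) auto
    then show "s + t - (P s + P t) \<in> null_seqs" by (simp add: algebra_simps)
  qed
  have P_scale: "P (c *\<^sub>R s) = c *\<^sub>R P s" if "s \<in> cauchy_seqs" for c s
  proof (rule P_eq)
    show "c *\<^sub>R s \<in> cauchy_seqs" using that by (intro subspace_scale[OF subspace_cauchy])
    show "c *\<^sub>R P s \<in> Y" using that P by (intro subspace_scale[OF Y(1)]) auto
    have "c *\<^sub>R (s - P s) \<in> null_seqs" using that P by (intro subspace_scale[OF subspace_null]) auto
    then show "c *\<^sub>R s - c *\<^sub>R P s \<in> null_seqs" by (simp only: scaleR_diff_right)
  qed
  have null0: "seq_value s = 0" if "s \<in> null_seqs" for s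
    using seq_value_null_iff[of s] null_subset_cauchy that by blast
  have P_value: "seq_value (P s) = seq_value s" if "s \<in> cauchy_seqs" for s
  proof (rule antisym)
    have Ps: "P s \<in> cauchy_seqs" "s - P s \<in> null_seqs" "P s - s \<in> null_seqs"
      using P[OF that] Y(2) subspace_neg[OF subspace_null, of "s - P s"] by auto
    show "seq_value s \<le> seq_value (P s)"
      using seq_value_add[of "s - P s" "P s"] Ps null0 null_subset_cauchy by (simp add: subset_iff)
    show "seq_value (P s) \<le> seq_value s"
      using seq_value_add[of "P s - s" s] Ps that null0 null_subset_cauchy by (simp add: subset_iff)
  qed
  have YC: "s \<in> cauchy_seqs" if "s \<in> Y" for s using that Y(2) by blast
  have normed: "s_normed_space p Y NY"
    unfolding s_normed_space_def quasi_normed_space_def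
  proof (intro conjI ballI allI)
    show "0 \<le> NY s" for s by (simp add: NY_def)
    show "NY s = 0 \<longleftrightarrow> s = 0" if "s \<in> Y" for s
      using seq_value_null_iff[OF YC[OF that]] Y(3) that subspace_0[OF subspace_null] by (auto simp: NY_def)
    show "NY (c *\<^sub>R s) = \<bar>c\<bar> * NY s" if "s \<in> Y" for c s
      unfolding NY_def seq_value_scale[OF YC[OF that]] using p seq_value_nonneg[OF YC[OF that]]
      by (simp add: powr_mult powr_powr)
    show le: "NY (s + t) powr p \<le> NY s powr p + NY t powr p" if "s \<in> Y" "t \<in> Y" for s t
      using seq_value_add[of s t] NY_p that YC subspace_add[OF subspace_cauchy] by simp
    show "\<exists>C. \<forall>s\<in>Y. \<forall>t\<in>Y. NY (s + t) \<le> C * (NY s + NY t)"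
      using quasi_triangle_of_powr[OF p _ _ _ le] by (intro exI[of _ "2 powr (1 / p)"]) (auto simp: NY_def)
  qed (use p Y(1) in auto)
  interpret Y: Metric_space Y "s_norm_dist p Y NY" using normed by (rule s_normed_space_Metric_space)
  have dist: "s_norm_dist p Y NY s t = seq_value (s - t)" if "s \<in> Y" "t \<in> Y" for s t
    using that NY_p[of "s - t"] subspace_diff[OF Y(1)] YC by (simp add: snowflake_def)
  have "Y.mcomplete"
    unfolding Y.mcomplete_def
  proof (intro allI impI)
    fix \<sigma> :: "nat \<Rightarrow> nat \<Rightarrow> 'v" assume \<sigma>: "Y.MCauchy \<sigma>"
    then have \<sigma>Y: "\<sigma> i \<in> Y" for i by (auto simp: Y.MCauchy_def)
    then have \<sigma>C: "\<sigma> i \<in> cauchy_seqs" for i using YC by blast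
    have \<sigma>V: "\<sigma> i n \<in> V" for i n using \<sigma>C by (rule cauchy_V)
    have \<sigma>_cauchy: "\<exists>N. \<forall>i\<ge>N. \<forall>j\<ge>N. seq_value (\<sigma> i - \<sigma> j) < e" if "e > 0" for e
      using \<sigma> that dist[OF \<sigma>Y \<sigma>Y] unfolding Y.MCauchy_def by metis
    have "\<exists>N. \<forall>m\<ge>N. \<forall>n\<ge>N. \<kappa> (\<sigma> i m - \<sigma> i n) < inverse (real (Suc i))" for i
      using \<sigma>C[of i] unfolding cauchy_seqs_def by simp
    then obtain N where N: "\<And>i m n. m \<ge> N i \<Longrightarrow> n \<ge> N i \<Longrightarrow> \<kappa> (\<sigma> i m - \<sigma> i n) < inverse (real (Suc i))"
      by metis
    \<comment> \<open>Diagonal sequence: the \<open>i\<close>-th member is represented by an entry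
      from which on it varies by less than \<open>inverse (real (Suc i))\<close>. The limit is
      \<open>P t\<close>, as \<open>t\<close> itself may lie off \<open>Y\<close>.\<close>
    define t where "t i = \<sigma> i (N i)" for i
    have tV: "t i \<in> V" for i unfolding t_def by (rule \<sigma>V)
    have t_close: "\<kappa> (t i - t j) \<le> inverse (real (Suc i)) + e + inverse (real (Suc j))"
      if "seq_value (\<sigma> i - \<sigma> j) < e" for i j e
    proof -
      have "(\<lambda>n. \<kappa> ((\<sigma> i - \<sigma> j) n)) \<longlonglongrightarrow> seq_value (\<sigma> i - \<sigma> j)"
        using seq_value_tendsto subspace_diff[OF subspace_cauchy \<sigma>C \<sigma>C] by blast
      then have "\<forall>\<^sub>F n in sequentially. \<kappa> ((\<sigma> i - \<sigma> j) n) < e" using that by (rule order_tendstoD)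
      moreover have "\<forall>\<^sub>F n in sequentially. n \<ge> max (N i) (N j)" by (rule eventually_ge_at_top)
      ultimately have "\<forall>\<^sub>F n in sequentially. \<kappa> ((\<sigma> i - \<sigma> j) n) < e \<and> n \<ge> max (N i) (N j)"
        by (rule eventually_conj)
      then obtain n where n: "\<kappa> (\<sigma> i n - \<sigma> j n) < e" "n \<ge> N i" "n \<ge> N j"
        by (auto simp: eventually_sequentially)
      have "\<kappa> (t i - t j) \<le> \<kappa> (t i - \<sigma> i n) + \<kappa> (\<sigma> i n - t j)" using tV \<sigma>V by (intro triangle)
      also have "\<kappa> (\<sigma> i n - t j) \<le> \<kappa> (\<sigma> i n - \<sigma> j n) + \<kappa> (\<sigma> j n - t j)" using tV \<sigma>V by (intro triangle)
      finally show ?thesis using n N[of i "N i" n] N[of j n "N j"] unfolding t_def by simp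
    qed
    have t_cauchy: "\<exists>M. \<forall>i\<ge>M. \<forall>j\<ge>M. \<kappa> (t i - t j) < e" if "e > 0" for e
    proof -
      have e4: "0 < e / 4" using that by simp
      obtain M1 where M1: "\<forall>i\<ge>M1. \<forall>j\<ge>M1. seq_value (\<sigma> i - \<sigma> j) < e / 4" using \<sigma>_cauchy[OF e4] by blast
      obtain M2 where M2: "inverse (real (Suc M2)) < e / 4" using reals_Archimedean[OF e4] by blast
      have inv: "inverse (real (Suc i)) < e / 4" if "i \<ge> M2" for i
        using M2 that by (smt (verit) Suc_le_mono le_imp_inverse_le of_nat_0_less_iff of_nat_le_iff zero_less_Suc)
      have "\<kappa> (t i - t j) < e" if "i \<ge> max M1 M2" "j \<ge> max M1 M2" for i j
      proof -
        have "seq_value (\<sigma> i - \<sigma> j) < e / 4" using M1 that by auto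
        from t_close[OF this] inv[of i] inv[of j] that \<open>e > 0\<close> show ?thesis by auto
      qed
      then show ?thesis by blast
    qed
    have tC: "t \<in> cauchy_seqs" unfolding cauchy_seqs_def using tV t_cauchy by blast
    have Pt: "P t \<in> Y" using P[OF tC] by blast
    have val: "seq_value (\<sigma> i - P t) \<le> seq_value (\<sigma> i - t)" for i
    proof -
      have mem: "t - P t \<in> null_seqs" "t - P t \<in> cauchy_seqs" using P[OF tC] null_subset_cauchy by auto
      have "seq_value ((\<sigma> i - t) + (t - P t)) \<le> seq_value (\<sigma> i - t) + seq_value (t - P t)"
        using subspace_diff[OF subspace_cauchy \<sigma>C tC] mem(2) by (rule seq_value_add)
      then show ?thesis using null0[OF mem(1)] by simp
    qed
    have "\<exists>M. \<forall>i\<ge>M. \<sigma> i \<in> Y \<and> s_norm_dist p Y NY (\<sigma> i) (P t) < e" if "e > 0" for e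
    proof -
      have e4: "0 < e / 4" using that by simp
      obtain M1 where M1: "\<forall>i\<ge>M1. \<forall>j\<ge>M1. \<kappa> (t i - t j) < e / 4" using t_cauchy[OF e4] by blast
      obtain M2 where M2: "inverse (real (Suc M2)) < e / 4" using reals_Archimedean[OF e4] by blast
      have inv: "inverse (real (Suc i)) < e / 4" if "i \<ge> M2" for i
        using M2 that by (smt (verit) Suc_le_mono le_imp_inverse_le of_nat_0_less_iff of_nat_le_iff zero_less_Suc)
      have "s_norm_dist p Y NY (\<sigma> i) (P t) < e" if i: "i \<ge> max M1 M2" for i
      proof -
        have "seq_value (\<sigma> i - t) \<le> e / 4 + e / 4"
        proof (rule seq_value_diff_le[OF \<sigma>C tC, of "max (N i) M1"])
          fix n assume n: "n \<ge> max (N i) M1"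
          have "\<kappa> (\<sigma> i n - t n) \<le> \<kappa> (\<sigma> i n - t i) + \<kappa> (t i - t n)" using tV \<sigma>V by (intro triangle)
          moreover have "\<kappa> (\<sigma> i n - t i) < e / 4" using N[of i n "N i"] n inv[of i] i by (simp add: t_def)
          moreover have "\<kappa> (t i - t n) < e / 4" using M1 i n by auto
          ultimately show "\<kappa> (\<sigma> i n - t n) \<le> e / 4 + e / 4" by linarith
        qed
        then show ?thesis using val[of i] dist[OF \<sigma>Y Pt, of i] \<open>e > 0\<close> by linarith
      qed
      then show ?thesis using \<sigma>Y by blast
    qed
    then show "\<exists>x. limitin Y.mtopology \<sigma> x sequentially"
      unfolding Y.limit_metric_sequentially using Pt by blast
  qed
  then have banach: "s_Banach_space p Y NY" using normed by (simp add: s_Banach_space_def)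
  define j where "j x = P (\<lambda>_. x)" for x
  have const: "(\<lambda>_. x) \<in> cauchy_seqs" if "x \<in> V" for x
    unfolding cauchy_seqs_def using that zero by auto
  show ?thesis
  proof (rule that[OF banach, of j])
    show "j x \<in> Y" if "x \<in> V" for x unfolding j_def using P[OF const[OF that]] by blast
    show "j (x + y) = j x + j y" if "x \<in> V" "y \<in> V" for x y
      unfolding j_def using P_add[OF const const, OF that] by (simp add: plus_fun_def)
    show "j (c *\<^sub>R x) = c *\<^sub>R j x" if "x \<in> V" for c x
      unfolding j_def using P_scale[OF const[OF that], of c] by (simp add: scaleR_fun_def)
    show "NY (j x) = \<kappa> x powr (1 / p)" if "x \<in> V" for x
    proof -
      have "(\<lambda>n. \<kappa> x) \<longlonglongrightarrow> seq_value (\<lambda>_. x)" using seq_value_tendsto[OF const[OF that]] .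
      then have "seq_value (\<lambda>_. x) = \<kappa> x" by (simp add: LIMSEQ_const_iff)
      then show ?thesis unfolding NY_def j_def P_value[OF const[OF that]] by simp
    qed
  qed
qed

end

section \<open>The norm of the free space as a transport cost\<close>

lemma s_metric_powr_pseudo_metric:
  assumes "s_metric_space s M d" "b \<in> M"
  defines "r \<equiv> \<lambda>x. if x \<in> M then x else b"
  shows "pseudo_metric (\<lambda>x y. d (r x) (r y) powr s)" "0 \<le> d (r x) (r y)" "d (r x) (r y) = d (r y) (r x)"
    "d (r x) (r x) = 0"
proof -
  have s: "0 < s" and d: "\<And>x y. x \<in> M \<Longrightarrow> y \<in> M \<Longrightarrow> 0 \<le> d x y" and M: "Metric_space M (snowflake s M d)"
    using assms(1) by (auto simp: s_metric_space_def)
  interpret Metric_space M "snowflake s M d" by (rule M)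
  have rM: "r x \<in> M" for x using assms(2) by (simp add: r_def)
  have sn: "snowflake s M d (r x) (r y) = d (r x) (r y) powr s" for x y using rM by (simp add: snowflake_def)
  show pm: "pseudo_metric (\<lambda>x y. d (r x) (r y) powr s)"
    unfolding sn[symmetric] using rM by (intro pseudo_metricI) (auto intro: commute triangle)
  show nn: "0 \<le> d (r x) (r y)" for x y using d rM by simp
  have "(d (r x) (r y) powr s) powr (1 / s) = (d (r y) (r x) powr s) powr (1 / s)"
    using pseudo_metricD(3)[OF pm, of x y] by simp
  then show "d (r x) (r y) = d (r y) (r x)" using s nn by (simp add: powr_powr)
  show "d (r x) (r x) = 0" using pseudo_metricD(2)[OF pm, of x] by simp
qed

lemma operator_norm_bound:
  assumes T: "bounded_operator F N Y NY T" and F: "quasi_normed_space F N" and Y: "quasi_normed_space Y NY"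
    and v: "v \<in> F" and le: "operator_norm F N NY T \<le> 1"
  shows "NY (T v) \<le> N v"
proof -
  obtain C where "\<forall>x\<in>F. NY (T x) \<le> C * N x" using T unfolding bounded_operator_def by (elim conjE exE)
  then have C: "NY (T x) \<le> C * N x" if "x \<in> F" for x using that by blast
  have N: "\<And>x. x \<in> F \<Longrightarrow> 0 \<le> N x" using F by (auto simp: quasi_normed_space_def)
  have "NY (T x) / N x \<le> \<bar>C\<bar>" if "x \<in> F" for x
  proof (cases "N x = 0")
    case False
    then have "0 < N x" using N[OF that] by simp
    then have "NY (T x) / N x \<le> C" using C[OF that] by (simp add: field_simps)
    then show ?thesis by simp
  qed simp
  \<comment> \<open>A supremum of reals is an upper bound only for a set that is bounded
    above.\<close>
  then have "bdd_above ((\<lambda>x. NY (T x) / N x) ` F)" by (intro bdd_aboveI[of _ "\<bar>C\<bar>"]) auto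
  then have "NY (T v) / N v \<le> operator_norm F N NY T"
    unfolding operator_norm_def using v by (intro cSUP_upper)
  then have le1: "NY (T v) / N v \<le> 1" using le by simp
  show ?thesis
  proof (cases "N v = 0")
    \<comment> \<open>The quotient is 0 here by the convention for division and carries no
      information; boundedness of \<open>T\<close> settles the case.\<close>
    case True
    then show ?thesis using C[OF v] by simp
  next
    case False
    then have "0 < N v" using N[OF v] by simp
    then show ?thesis using le1 by (simp add: field_simps)
  qed
qed

text \<open>This is where the universal property is used. The test space is the completion of
  \<open>range boundary\<close> under the transport cost, carried by the one type of targets that
  the definition admits. Sending \<open>x\<close> to the class of
  \<open>point_mass x - point_mass b\<close> is 1-Lipschitz, so the extension to \<open>F\<close> is
  a contraction, and it maps the linear extension of \<open>\<delta>\<close> back to the class of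
  the boundary.\<close>

lemma transport_cost_le_free_norm:
  fixes M :: "'a set" and \<delta> :: "'a \<Rightarrow> 'f::real_vector"
  assumes p: "0 < p" "p \<le> 1" and b: "b \<in> M" and d: "s_metric_space p M d"
    and free: "is_Lipschitz_free p M d b F N \<delta>"
  defines "r \<equiv> \<lambda>x. if x \<in> M then x else b"
  shows "transport_cost p (\<lambda>x y. d (r x) (r y) powr p) (boundary l)
    \<le> N (linear_extension (\<lambda>x. \<delta> (r x)) (boundary l)) powr p"
proof -
  define \<rho> where "\<rho> x y = d (r x) (r y) powr p" for x y
  define \<kappa> where "\<kappa> = transport_cost p \<rho>"
  have dr: "0 \<le> d (r x) (r y)" "d (r x) (r x) = 0" for x y
    unfolding r_def using s_metric_powr_pseudo_metric(2,4)[OF d b] by auto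
  have r: "r x \<in> M" "x \<in> M \<Longrightarrow> r x = x" "r (r x) = r x" for x using b by (auto simp: r_def)
  have \<rho>: "nonneg_cost \<rho>" by (auto simp: nonneg_cost_def \<rho>_def)
  interpret p_seminorm p "range boundary" \<kappa>
    by standard (use p \<rho> in \<open>auto simp: \<kappa>_def simp del: image_iff intro: subspace_range_boundary
        transport_cost_nonneg transport_cost_add transport_cost_scaleR\<close>)
  obtain Y :: "(nat \<Rightarrow> 'a \<Rightarrow> real) set" and NY j where Y: "s_Banach_space p Y NY"
    and jY: "\<And>x. x \<in> range boundary \<Longrightarrow> j x \<in> Y"
    and jadd: "\<And>x y. x \<in> range boundary \<Longrightarrow> y \<in> range boundary \<Longrightarrow> j (x + y) = j x + j y"
    and jscale: "\<And>c x. x \<in> range boundary \<Longrightarrow> j (c *\<^sub>R x) = c *\<^sub>R j x"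
    and jnorm: "\<And>x. x \<in> range boundary \<Longrightarrow> NY (j x) = \<kappa> x powr (1 / p)"
    by (rule completion_exists) (rule that)
  have pm: "point_mass x - point_mass y = boundary [(1, x, y)]" for x y :: 'a by simp
  then have pm_mem: "point_mass x - point_mass y \<in> range boundary" for x y :: 'a by (metis rangeI)
  have jdiff: "j (x - y) = j x - j y" if "x \<in> range boundary" "y \<in> range boundary" for x y
    using jadd[OF that(1) subspace_neg[OF subspace_range_boundary that(2)]] jscale[OF that(2), of "-1"] by simp
  have j0: "j 0 = 0" using jscale[OF pm_mem, of 0] by simp
  define f where "f x = j (point_mass x - point_mass b)" for x
  have fdiff: "f x - f y = j (point_mass x - point_mass y)" for x y
    unfolding f_def jdiff[OF pm_mem pm_mem, symmetric] by simp
  have lip: "NY (f x - f y) \<le> d x y" if "x \<in> M" "y \<in> M" for x y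
  proof -
    have "\<kappa> (point_mass x - point_mass y) \<le> \<rho> x y"
      using transport_cost_le[OF \<rho>, of p "[(1, x, y)]"] by (simp add: \<kappa>_def)
    then have "\<kappa> (point_mass x - point_mass y) powr (1 / p) \<le> \<rho> x y powr (1 / p)"
      using p nonneg[OF pm_mem] by (intro powr_mono2) auto
    also have "\<dots> = d x y" using p dr(1)[of x y] that r by (simp add: \<rho>_def powr_powr)
    finally show ?thesis unfolding fdiff jnorm[OF pm_mem] .
  qed
  have Lipschitz: "Lipschitz_map M d Y NY f"
    unfolding Lipschitz_map_def using jY[OF pm_mem] lip by (auto simp: f_def intro!: exI[of _ 1])
  have "f b = 0" by (simp add: f_def j0)
  with Y Lipschitz have hyp: "s_Banach_space p Y NY \<and> Lipschitz_map M d Y NY f \<and> f b = 0" by simp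
  have "\<exists>T. bounded_operator F N Y NY T \<and> (\<forall>x\<in>M. T (\<delta> x) = f x) \<and> operator_norm F N NY T = Lip M d NY f \<and>
      (\<forall>T'. bounded_operator F N Y NY T' \<and> (\<forall>x\<in>M. T' (\<delta> x) = f x) \<longrightarrow> (\<forall>v\<in>F. T' v = T v))"
    using free[unfolded is_Lipschitz_free_def, THEN conjunct2, THEN conjunct2, THEN conjunct2,
        THEN conjunct2, THEN conjunct2, THEN spec, THEN spec, THEN spec, THEN mp, OF hyp] .
  then obtain T where T: "bounded_operator F N Y NY T" "\<forall>x\<in>M. T (\<delta> x) = f x"
    "operator_norm F N NY T = Lip M d NY f" by (elim exE conjE)
  have "Lip M d NY f \<le> 1" unfolding Lip_def
  proof (rule cSUP_least)
    fix xy assume "xy \<in> M \<times> M"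
    then obtain x y where xy: "xy = (x, y)" "x \<in> M" "y \<in> M" by auto
    have "0 \<le> d x y" using dr(1)[of x y] r xy by simp
    then show "(case xy of (x, y) \<Rightarrow> NY (f x - f y) / d x y) \<le> 1"
      using lip[OF xy(2,3)] xy by (cases "d x y = 0") (auto simp: field_simps)
  qed (use b in auto)
  then have le1: "operator_norm F N NY T \<le> 1" using T(3) by simp
  have qF: "quasi_normed_space F N" and F: "subspace F" and \<delta>F: "\<And>x. x \<in> M \<Longrightarrow> \<delta> x \<in> F"
    using free by (auto simp: is_Lipschitz_free_def s_Banach_space_def s_normed_space_def quasi_normed_space_def)
  have qY: "quasi_normed_space Y NY" using Y by (auto simp: s_Banach_space_def s_normed_space_def)
  define v where "v l = linear_extension (\<lambda>x. \<delta> (r x)) (boundary l)" for l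
  have T_add: "T (x + y) = T x + T y" and T_scale: "T (c *\<^sub>R x) = c *\<^sub>R T x" if "x \<in> F" "y \<in> F" for x y c
    using T(1) that by (auto simp: bounded_operator_def)
  have vF: "v l \<in> F \<and> T (v l) = j (boundary (map_flow r l))" for l
  proof (induction l rule: flow_induct)
    case Nil
    have "v [] = 0" by (simp add: v_def linear_extension_def)
    moreover have "T 0 = 0" using T_scale[OF subspace_0[OF F] subspace_0[OF F], of 0] by simp
    moreover have "boundary (map_flow r ([] :: 'a flow)) = 0" by (simp add: map_flow_def)
    ultimately show ?case using subspace_0[OF F] j0 by (simp only: simp_thms)
  next
    case (Cons a x y l)
    have eq: "v ((a, x, y) # l) = a *\<^sub>R (\<delta> (r x) - \<delta> (r y)) + v l"
      by (simp only: v_def linear_extension_boundary list.map sum_list.Cons case_prod_conv)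
    have dF: "\<delta> (r x) - \<delta> (r y) \<in> F" by (rule subspace_diff[OF F \<delta>F[OF r(1)] \<delta>F[OF r(1)]])
    have "T (\<delta> (r x) + (- 1) *\<^sub>R \<delta> (r y)) = T (\<delta> (r x)) + (- 1) *\<^sub>R T (\<delta> (r y))"
      unfolding T_add[OF \<delta>F[OF r(1)] subspace_scale[OF F \<delta>F[OF r(1)]]]
        T_scale[OF \<delta>F[OF r(1)] \<delta>F[OF r(1)]] ..
    then have "T (\<delta> (r x) - \<delta> (r y)) = f (r x) - f (r y)" using T(2) r(1) by simp
    then have "T (v ((a, x, y) # l)) = a *\<^sub>R (f (r x) - f (r y)) + j (boundary (map_flow r l))"
      unfolding eq T_add[OF subspace_scale[OF F dF] conjunct1[OF Cons]] T_scale[OF dF dF] conjunct2[OF Cons]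
      by simp
    also have "\<dots> = j (a *\<^sub>R (point_mass (r x) - point_mass (r y)) + boundary (map_flow r l))"
      unfolding fdiff jadd[OF range_boundary_scaleR[OF pm_mem] rangeI] jscale[OF pm_mem] ..
    finally have "T (v ((a, x, y) # l)) = j (boundary (map_flow r ((a, x, y) # l)))"
      by (simp add: map_flow_def)
    moreover have "v ((a, x, y) # l) \<in> F"
      unfolding eq by (rule subspace_add[OF F subspace_scale[OF F dF] conjunct1[OF Cons]])
    ultimately show ?case by blast
  qed
  have "\<kappa> (boundary (map_flow r l)) powr (1 / p) \<le> N (v l)"
    using operator_norm_bound[OF T(1) qF qY _ le1] vF[of l] jnorm by (metis rangeI)
  then have "(\<kappa> (boundary (map_flow r l)) powr (1 / p)) powr p \<le> N (v l) powr p"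
    using p by (intro powr_mono2) auto
  then have le: "\<kappa> (boundary (map_flow r l)) \<le> N (v l) powr p"
    using p nonneg[OF rangeI] by (simp add: powr_powr)
  \<comment> \<open>Moving an endpoint \<open>x\<close> to \<open>r x\<close> is free, since the
    gauge sees only \<open>r x\<close>. This passes from boundaries on \<open>M\<close> to arbitrary
    ones.\<close>
  define l1 where "l1 = map (\<lambda>(a, x, y). (a, x, r x)) l"
  define l2 where "l2 = map (\<lambda>(a, x, y). (a, r y, y)) l"
  have bd: "boundary l = boundary (l1 @ l2) + boundary (map_flow r l)"
    unfolding l1_def l2_def map_flow_def
    by (induction l rule: flow_induct) (auto simp: fun_eq_iff boundary_Cons_apply algebra_simps simp del: boundary_Cons)
  have "cost p \<rho> l1 = 0" "cost p \<rho> l2 = 0"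
    unfolding l1_def l2_def by (induction l rule: flow_induct) (auto simp: \<rho>_def r(3) dr(2))
  then have "\<kappa> (boundary (l1 @ l2)) \<le> 0" using transport_cost_le[OF \<rho>, of p "l1 @ l2"] by (simp add: \<kappa>_def)
  then have "\<kappa> (boundary l) \<le> \<kappa> (boundary (map_flow r l))"
    unfolding bd using add[OF rangeI rangeI, of "l1 @ l2" "map_flow r l"] by linarith
  then show ?thesis using le unfolding \<kappa>_def \<rho>_def[abs_def] v_def by linarith
qed

section \<open>Copies of \<open>\<ell>\<^sub>p\<close> in \<open>p\<close>-Banach spaces\<close>

locale p_banach =
  fixes p :: real and E :: "'v::real_vector set" and N :: "'v \<Rightarrow> real"
  assumes banach: "s_Banach_space p E N"
begin

definition \<kappa> :: "'v \<Rightarrow> real" where "\<kappa> x = N x powr p"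

lemma normed: "s_normed_space p E N" using banach by (simp add: s_Banach_space_def)
lemma p: "0 < p" "p \<le> 1" using normed by (auto simp: s_normed_space_def)
lemma E: "subspace E" using normed by (simp add: s_normed_space_def quasi_normed_space_def)
lemma N_nonneg: "x \<in> E \<Longrightarrow> 0 \<le> N x"
  using normed by (simp add: s_normed_space_def quasi_normed_space_def)
lemma N_zero_iff: "x \<in> E \<Longrightarrow> N x = 0 \<longleftrightarrow> x = 0"
  using normed by (simp add: s_normed_space_def quasi_normed_space_def)
lemma N_scale: "x \<in> E \<Longrightarrow> N (c *\<^sub>R x) = \<bar>c\<bar> * N x"
  using normed by (simp add: s_normed_space_def quasi_normed_space_def)

sublocale p_seminorm p E \<kappa>
proof
  show "\<kappa> (x + y) \<le> \<kappa> x + \<kappa> y" if "x \<in> E" "y \<in> E" for x y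
    using normed that by (simp add: s_normed_space_def \<kappa>_def)
  show "\<kappa> (c *\<^sub>R x) = \<bar>c\<bar> powr p * \<kappa> x" if "x \<in> E" for c x
    using N_scale[OF that] N_nonneg[OF that] by (simp add: \<kappa>_def powr_mult)
qed (use p E in \<open>auto simp: \<kappa>_def\<close>)

lemma \<kappa>_zero_iff: "x \<in> E \<Longrightarrow> \<kappa> x = 0 \<longleftrightarrow> x = 0"
  using N_zero_iff by (simp add: \<kappa>_def)

lemma N_eq: "x \<in> E \<Longrightarrow> N x = \<kappa> x powr (1 / p)"
  using N_nonneg p by (simp add: \<kappa>_def powr_powr)

lemma dist_eq: "x \<in> E \<Longrightarrow> y \<in> E \<Longrightarrow> s_norm_dist p E N x y = \<kappa> (x - y)"
  by (simp add: snowflake_def \<kappa>_def)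

sublocale metric: Metric_space E "s_norm_dist p E N"
  using normed by (rule s_normed_space_Metric_space)

lemma limitin_iff:
  "limitin metric.mtopology s x sequentially \<longleftrightarrow> x \<in> E \<and> (\<forall>e>0. \<exists>M. \<forall>n\<ge>M. s n \<in> E \<and> \<kappa> (s n - x) < e)"
  unfolding metric.limit_metric_sequentially using dist_eq by (metis (no_types, lifting))

lemma cauchy_limit_exists:
  assumes s: "\<And>n. s n \<in> E" and c: "\<And>e. 0 < e \<Longrightarrow> \<exists>M. \<forall>m\<ge>M. \<forall>n\<ge>M. \<kappa> (s m - s n) < e"
  shows "\<exists>x\<in>E. (\<lambda>n. \<kappa> (s n - x)) \<longlonglongrightarrow> 0"
proof -
  have "metric.MCauchy s" unfolding metric.MCauchy_def
  proof (intro conjI allI impI)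
    show "range s \<subseteq> E" using s by blast
    fix e :: real assume "e > 0"
    then obtain M where "\<forall>m\<ge>M. \<forall>n\<ge>M. \<kappa> (s m - s n) < e" using c by blast
    then show "\<exists>M. \<forall>n n'. M \<le> n \<longrightarrow> M \<le> n' \<longrightarrow> s_norm_dist p E N (s n) (s n') < e"
      unfolding dist_eq[OF s s] by blast
  qed
  then obtain x where "limitin metric.mtopology s x sequentially"
    using banach unfolding s_Banach_space_def metric.mcomplete_def by blast
  then have x: "x \<in> E" "\<forall>e>0. \<exists>M. \<forall>n\<ge>M. \<kappa> (s n - x) < e" unfolding limitin_iff by blast+
  then have "(\<lambda>n. \<kappa> (s n - x)) \<longlonglongrightarrow> 0"
    using tendsto_iff_less[of "\<lambda>n. s n - x"] s subspace_diff[OF E] by simp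
  with x show ?thesis by blast
qed

lemma limit_unique:
  assumes s: "\<And>n. s n \<in> E" and x: "x \<in> E" "(\<lambda>n. \<kappa> (s n - x)) \<longlonglongrightarrow> 0"
    and y: "y \<in> E" "(\<lambda>n. \<kappa> (s n - y)) \<longlonglongrightarrow> 0"
  shows "x = y"
proof -
  have "(\<lambda>n. \<kappa> (s n - x) + \<kappa> (s n - y)) \<longlonglongrightarrow> 0 + 0" using x y by (intro tendsto_add)
  moreover have "\<kappa> (x - y) \<le> \<kappa> (s n - x) + \<kappa> (s n - y)" for n
    using triangle[OF x(1) s y(1), of n] sym[OF x(1) s, of n] by simp
  ultimately have "\<kappa> (x - y) \<le> 0 + 0" by (intro LIMSEQ_le_const) auto
  then have "\<kappa> (x - y) = 0" using nonneg[OF subspace_diff[OF E x(1) y(1)]] by simp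
  then show ?thesis using \<kappa>_zero_iff[OF subspace_diff[OF E x(1) y(1)]] by (simp only: right_minus_eq)
qed

lemma \<kappa>_tendsto:
  assumes s: "\<And>n. s n \<in> E" and x: "x \<in> E" "(\<lambda>n. \<kappa> (s n - x)) \<longlonglongrightarrow> 0"
  shows "(\<lambda>n. \<kappa> (s n)) \<longlonglongrightarrow> \<kappa> x"
proof -
  have "(\<lambda>n. \<kappa> (s n) - \<kappa> x) \<longlonglongrightarrow> 0"
    by (rule Lim_null_comparison[OF always_eventually x(2)]) (use abs_diff_le[OF s x(1)] in simp)
  then show ?thesis by (rule LIM_zero_cancel)
qed

lemma sum_mem: "(\<And>i. i \<in> I \<Longrightarrow> x i \<in> E) \<Longrightarrow> sum x I \<in> E"
  by (rule subspace_sum[OF E])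

lemma \<kappa>_sum_le: "finite I \<Longrightarrow> (\<And>i. i \<in> I \<Longrightarrow> x i \<in> E) \<Longrightarrow> \<kappa> (sum x I) \<le> (\<Sum>i\<in>I. \<kappa> (x i))"
proof (induction I rule: finite_induct)
  case (insert i I)
  then have "\<kappa> (x i + sum x I) \<le> \<kappa> (x i) + \<kappa> (sum x I)" by (intro add sum_mem) auto
  also have "\<kappa> (sum x I) \<le> (\<Sum>i\<in>I. \<kappa> (x i))" using insert by auto
  finally show ?case using insert(1,2) by simp
qed (simp add: zero)

end

section \<open>Sequences with a lower p-estimate\<close>

lemma isomorphismI:
  assumes V: "subspace V" and maps: "T ` V = W" and inj: "inj_on T V"
    and add: "\<And>x y. x \<in> V \<Longrightarrow> y \<in> V \<Longrightarrow> T (x + y) = T x + T y"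
    and scale: "\<And>c x. x \<in> V \<Longrightarrow> T (c *\<^sub>R x) = c *\<^sub>R T x"
    and upper: "\<And>x. x \<in> V \<Longrightarrow> N' (T x) \<le> C * N x"
    and lower: "\<And>x. x \<in> V \<Longrightarrow> N x \<le> C' * N' (T x)"
  shows "isomorphism V N W N' T"
proof -
  have inv: "inv_into V T (T x) = x" if "x \<in> V" for x using inj that by (rule inv_into_f_f)
  have "bounded_operator V N W N' T"
    unfolding bounded_operator_def using maps add scale upper by blast
  moreover have "bij_betw T V W" using maps inj by (simp add: bij_betw_def)
  moreover have "bounded_operator W N' V N (inv_into V T)"
    unfolding bounded_operator_def
  proof (intro conjI ballI allI)
    fix x y assume "x \<in> W" "y \<in> W"
    then obtain x' y' where xy: "x' \<in> V" "y' \<in> V" "x = T x'" "y = T y'" using maps by blast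
    show "inv_into V T (x + y) = inv_into V T x + inv_into V T y"
      using xy subspace_add[OF V xy(1,2)] by (simp add: inv flip: add)
  next
    fix c x assume "x \<in> W"
    then obtain x' where x: "x' \<in> V" "x = T x'" using maps by blast
    show "inv_into V T (c *\<^sub>R x) = c *\<^sub>R inv_into V T x"
      using x subspace_scale[OF V x(1)] by (simp add: inv flip: scale)
  next
    show "inv_into V T x \<in> V" if "x \<in> W" for x using that maps by (metis inv_into_into)
    show "\<exists>C. \<forall>x\<in>W. N (inv_into V T x) \<le> C * N' x"
      using lower inv maps by (intro exI[of _ C']) auto
  qed
  ultimately show ?thesis by (simp add: isomorphism_def)
qed

lemma subspace_lp:
  assumes p: "0 < p" "p \<le> 1"
  shows "subspace (lp p)"
  unfolding subspace_def
proof (intro conjI ballI allI)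
  show "0 \<in> lp p" by (simp add: lp_def)
next
  fix a b assume "a \<in> lp p" "b \<in> lp p"
  then have "summable (\<lambda>n. \<bar>a n\<bar> powr p + \<bar>b n\<bar> powr p)" unfolding lp_def by (intro summable_add) auto
  then have "summable (\<lambda>n. \<bar>a n + b n\<bar> powr p)"
    by (rule summable_comparison_test[rotated]) (use abs_powr_triangle[OF p] in auto)
  then show "a + b \<in> lp p" by (simp add: lp_def)
next
  fix c a assume "a \<in> lp p"
  then have "summable (\<lambda>n. \<bar>c\<bar> powr p * \<bar>a n\<bar> powr p)" unfolding lp_def by (intro summable_mult) auto
  then show "c *\<^sub>R a \<in> lp p" by (simp add: lp_def scaleR_fun_def abs_mult powr_mult)
qed

context p_banach
begin

text \<open>The upper estimate is automatic from boundedness and p-subadditivity, so a lower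
  estimate makes the sequence equivalent to the unit vectors of \<open>lp p\<close>. The last
  conclusion lets estimates for finite combinations pass to all of \<open>Z\<close>.\<close>

lemma lp_copy_exists:
  fixes u :: "nat \<Rightarrow> 'v"
  assumes u: "\<And>i. u i \<in> E" "\<And>i. \<kappa> (u i) \<le> C" and c: "0 < c"
    and low: "\<And>n a. c * (\<Sum>i<n. \<bar>a i\<bar> powr p) \<le> \<kappa> (\<Sum>i<n. a i *\<^sub>R u i)"
  obtains Z where "closed_subspace p E N Z" "isomorphic_spaces (lp p) (lp_norm p) Z N"
    "\<And>z. z \<in> Z \<Longrightarrow> \<exists>a\<in>lp p. (\<lambda>n. \<kappa> ((\<Sum>i<n. a i *\<^sub>R u i) - z)) \<longlonglongrightarrow> 0"
proof -
  define S where "S a n = (\<Sum>i<n. a i *\<^sub>R u i)" for a n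
  have SE: "S a n \<in> E" for a n unfolding S_def using u(1) by (intro sum_mem subspace_scale[OF E])
  have C: "0 \<le> C" using u[of 0] nonneg[of "u 0"] by linarith
  have S_add: "S (a + b) n = S a n + S b n" and S_scale: "S (t *\<^sub>R a) n = t *\<^sub>R S a n" and
    S_diff: "S (a - b) n = S a n - S b n" for a b t n
    unfolding S_def by (simp_all add: scaleR_fun_def scaleR_add_left scaleR_diff_left sum.distrib
        sum_subtractf scaleR_sum_right)
  have up: "\<kappa> (\<Sum>i\<in>I. a i *\<^sub>R u i) \<le> C * (\<Sum>i\<in>I. \<bar>a i\<bar> powr p)" if "finite I" for I and a :: "nat \<Rightarrow> real"
  proof -
    have "\<kappa> (\<Sum>i\<in>I. a i *\<^sub>R u i) \<le> (\<Sum>i\<in>I. \<kappa> (a i *\<^sub>R u i))"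
      using that u(1) by (intro \<kappa>_sum_le subspace_scale[OF E])
    also have "\<dots> \<le> (\<Sum>i\<in>I. \<bar>a i\<bar> powr p * C)"
      using u by (intro sum_mono) (simp add: scale mult_left_mono)
    finally show ?thesis by (simp add: sum_distrib_left mult.commute)
  qed
  have "\<exists>x\<in>E. (\<lambda>n. \<kappa> (S a n - x)) \<longlonglongrightarrow> 0" if a: "a \<in> lp p" for a
  proof (rule cauchy_limit_exists)
    fix e :: real assume e: "e > 0"
    have "Cauchy (\<lambda>n. \<Sum>i<n. \<bar>a i\<bar> powr p)"
      using a unfolding lp_def by (simp add: summable_iff_convergent Cauchy_convergent_iff)
    moreover have e': "0 < e / (C + 1)" using e C by simp
    ultimately obtain M where M: "\<And>m n. m \<ge> M \<Longrightarrow> n \<ge> M \<Longrightarrow>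
        \<bar>(\<Sum>i<m. \<bar>a i\<bar> powr p) - (\<Sum>i<n. \<bar>a i\<bar> powr p)\<bar> < e / (C + 1)"
      unfolding Cauchy_def dist_real_def by meson
    have ord: "\<kappa> (S a n - S a m) < e" if "m \<ge> M" "n \<ge> m" for m n
    proof -
      have split: "(\<Sum>i<n. f i) = (\<Sum>i<m. f i) + (\<Sum>i\<in>{m..<n}. f i)" for f :: "nat \<Rightarrow> 'c::comm_monoid_add"
        using sum.atLeastLessThan_concat[of 0 m n f] that by (simp add: lessThan_atLeast0)
      have "S a n - S a m = (\<Sum>i\<in>{m..<n}. a i *\<^sub>R u i)" unfolding S_def split by simp
      then have "\<kappa> (S a n - S a m) \<le> C * (\<Sum>i\<in>{m..<n}. \<bar>a i\<bar> powr p)" using up by simp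
      also have "(\<Sum>i\<in>{m..<n}. \<bar>a i\<bar> powr p) = (\<Sum>i<n. \<bar>a i\<bar> powr p) - (\<Sum>i<m. \<bar>a i\<bar> powr p)"
        unfolding split[of "\<lambda>i. \<bar>a i\<bar> powr p"] by simp
      also have "\<dots> \<le> e / (C + 1)" using M[of n m] that by simp
      also have "C * (e / (C + 1)) < e" using C e by (simp add: field_simps)
      finally show ?thesis using C by (simp add: mult_left_mono)
    qed
    have "\<kappa> (S a m - S a n) < e" if "m \<ge> M" "n \<ge> M" for m n
      using ord[of m n] ord[of n m] that sym[OF SE SE, of a m a n] by (cases "m \<le> n") auto
    then show "\<exists>M. \<forall>m\<ge>M. \<forall>n\<ge>M. \<kappa> (S a m - S a n) < e" by blast
  qed (rule SE)
  then have "\<forall>a\<in>lp p. \<exists>x. x \<in> E \<and> (\<lambda>n. \<kappa> (S a n - x)) \<longlonglongrightarrow> 0" by blast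
  then obtain f where f: "\<And>a. a \<in> lp p \<Longrightarrow> f a \<in> E" "\<And>a. a \<in> lp p \<Longrightarrow> (\<lambda>n. \<kappa> (S a n - f a)) \<longlonglongrightarrow> 0"
    by (metis bchoice)
  have lp: "subspace (lp p)" using p by (rule subspace_lp)
  have f_add: "f (a + b) = f a + f b" if "a \<in> lp p" "b \<in> lp p" for a b
  proof (rule limit_unique[OF SE])
    show "f (a + b) \<in> E" "(\<lambda>n. \<kappa> (S (a + b) n - f (a + b))) \<longlonglongrightarrow> 0"
      using f subspace_add[OF lp that] by auto
    show "f a + f b \<in> E" using f that by (intro subspace_add[OF E])
    have lim: "(\<lambda>n. \<kappa> (S a n - f a) + \<kappa> (S b n - f b)) \<longlonglongrightarrow> 0"
      using tendsto_add[OF f(2)[OF that(1)] f(2)[OF that(2)]] by simp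
    have "S (a + b) n - (f a + f b) = (S a n - f a) + (S b n - f b)" for n by (simp add: S_add)
    then have "\<kappa> (S (a + b) n - (f a + f b)) \<le> \<kappa> (S a n - f a) + \<kappa> (S b n - f b)" for n
      using add[OF subspace_diff[OF E SE f(1)] subspace_diff[OF E SE f(1)], OF that] by metis
    then show "(\<lambda>n. \<kappa> (S (a + b) n - (f a + f b))) \<longlonglongrightarrow> 0"
      using nonneg[OF subspace_diff[OF E SE \<open>f a + f b \<in> E\<close>]]
      by (intro tendsto_sandwich[OF _ _ tendsto_const lim]) (simp_all add: always_eventually)
  qed
  have f_scale: "f (t *\<^sub>R a) = t *\<^sub>R f a" if "a \<in> lp p" for t a
  proof (rule limit_unique[OF SE])
    show "f (t *\<^sub>R a) \<in> E" "(\<lambda>n. \<kappa> (S (t *\<^sub>R a) n - f (t *\<^sub>R a))) \<longlonglongrightarrow> 0"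
      using f subspace_scale[OF lp that] by auto
    show "t *\<^sub>R f a \<in> E" using f that by (intro subspace_scale[OF E])
    have "S (t *\<^sub>R a) n - t *\<^sub>R f a = t *\<^sub>R (S a n - f a)" for n by (simp only: S_scale scaleR_diff_right)
    then have "\<kappa> (S (t *\<^sub>R a) n - t *\<^sub>R f a) = \<bar>t\<bar> powr p * \<kappa> (S a n - f a)" for n
      using scale[OF subspace_diff[OF E SE f(1)[OF that]]] by simp
    then show "(\<lambda>n. \<kappa> (S (t *\<^sub>R a) n - t *\<^sub>R f a)) \<longlonglongrightarrow> 0"
      using tendsto_mult_left[OF f(2)[OF that], of "\<bar>t\<bar> powr p"] by simp
  qed
  have f_diff: "f (a - b) = f a - f b" if "a \<in> lp p" "b \<in> lp p" for a b
    using f_add[OF that(1) subspace_neg[OF lp that(2)]] f_scale[OF that(2), of "- 1"] by simp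
  have sums: "(\<lambda>n. \<Sum>i<n. \<bar>a i\<bar> powr p) \<longlonglongrightarrow> (\<Sum>i. \<bar>a i\<bar> powr p)" if "a \<in> lp p" for a
    using that unfolding lp_def by (simp add: summable_LIMSEQ)
  have \<kappa>f: "(\<lambda>n. \<kappa> (S a n)) \<longlonglongrightarrow> \<kappa> (f a)" if "a \<in> lp p" for a using SE f[OF that] by (rule \<kappa>_tendsto)
  have f_up: "\<kappa> (f a) \<le> C * (\<Sum>i. \<bar>a i\<bar> powr p)" if "a \<in> lp p" for a
    using up by (intro LIMSEQ_le[OF \<kappa>f[OF that] tendsto_mult_left[OF sums[OF that]]]) (auto simp: S_def)
  have f_low: "c * (\<Sum>i. \<bar>a i\<bar> powr p) \<le> \<kappa> (f a)" if "a \<in> lp p" for a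
    using low by (intro LIMSEQ_le[OF tendsto_mult_left[OF sums[OF that]] \<kappa>f[OF that]]) (auto simp: S_def)
  have sum0: "a = 0" if "a \<in> lp p" "(\<Sum>i. \<bar>a i\<bar> powr p) = 0" for a
  proof -
    have "\<forall>i. \<bar>a i\<bar> powr p = 0" using that by (subst (asm) suminf_eq_zero_iff) (auto simp: lp_def)
    then show ?thesis by (auto simp: fun_eq_iff)
  qed
  have inj: "inj_on f (lp p)"
  proof (rule inj_onI)
    fix a b assume ab: "a \<in> lp p" "b \<in> lp p" "f a = f b"
    have "f (a - b) = 0" using f_diff[OF ab(1,2)] ab(3) by simp
    then have "c * (\<Sum>i. \<bar>(a - b) i\<bar> powr p) \<le> 0" using f_low[OF subspace_diff[OF lp ab(1,2)]] zero by simp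
    moreover have "0 \<le> (\<Sum>i. \<bar>(a - b) i\<bar> powr p)"
      using subspace_diff[OF lp ab(1,2)] unfolding lp_def by (intro suminf_nonneg) auto
    ultimately have "(\<Sum>i. \<bar>(a - b) i\<bar> powr p) = 0" using c by (simp add: mult_le_0_iff)
    then have "a - b = 0" using sum0[OF subspace_diff[OF lp ab(1,2)]] by blast
    then show "a = b" by (simp only: right_minus_eq)
  qed
  define Z where "Z = f ` lp p"
  have ZE: "Z \<subseteq> E" unfolding Z_def using f(1) by blast
  have Z: "subspace Z" unfolding subspace_def
  proof (intro conjI ballI allI)
    have "f 0 = 0" using f_scale[OF subspace_0[OF lp], of 0] by simp
    then show "0 \<in> Z" unfolding Z_def using subspace_0[OF lp] by force
  next
    fix x y assume "x \<in> Z" "y \<in> Z"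
    then show "x + y \<in> Z" unfolding Z_def using f_add subspace_add[OF lp] by (auto simp: image_iff) metis
  next
    fix t x assume "x \<in> Z"
    then show "t *\<^sub>R x \<in> Z" unfolding Z_def using f_scale subspace_scale[OF lp] by (auto simp: image_iff) metis
  qed
  have norm_p: "lp_norm p a powr p = (\<Sum>i. \<bar>a i\<bar> powr p)" if "a \<in> lp p" for a
    using p that suminf_nonneg[of "\<lambda>i. \<bar>a i\<bar> powr p"] by (simp add: lp_norm_def lp_def powr_powr)
  have "isomorphism (lp p) (lp_norm p) Z N f"
  proof (rule isomorphismI[OF lp])
    show "f ` lp p = Z" by (simp add: Z_def)
    show "inj_on f (lp p)" by (rule inj)
    show "f (x + y) = f x + f y" if "x \<in> lp p" "y \<in> lp p" for x y using that by (rule f_add)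
    show "f (t *\<^sub>R x) = t *\<^sub>R f x" if "x \<in> lp p" for t x using that by (rule f_scale)
    fix a assume a: "a \<in> lp p"
    have s0: "0 \<le> (\<Sum>i. \<bar>a i\<bar> powr p)" using a unfolding lp_def by (intro suminf_nonneg) auto
    have "\<kappa> (f a) powr (1 / p) \<le> (C * (\<Sum>i. \<bar>a i\<bar> powr p)) powr (1 / p)"
      using f_up[OF a] nonneg[OF f(1)[OF a]] p by (intro powr_mono2) auto
    then show "N (f a) \<le> C powr (1 / p) * lp_norm p a"
      using N_eq[OF f(1)[OF a]] C s0 by (simp add: powr_mult lp_norm_def)
    have "(\<Sum>i. \<bar>a i\<bar> powr p) \<le> \<kappa> (f a) / c" using f_low[OF a] c by (simp add: field_simps)
    then have "lp_norm p a \<le> (\<kappa> (f a) / c) powr (1 / p)"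
      unfolding lp_norm_def using s0 p by (intro powr_mono2) auto
    then show "lp_norm p a \<le> (1 / c) powr (1 / p) * N (f a)"
      using N_eq[OF f(1)[OF a]] c nonneg[OF f(1)[OF a]] by (simp add: powr_divide)
  qed
  then have iso: "isomorphic_spaces (lp p) (lp_norm p) Z N" unfolding isomorphic_spaces_def by blast
  \<comment> \<open>Completeness of \<open>lp p\<close> in disguise: the lower estimate makes the
    coefficients converge coordinatewise, and bounds over finite sets of coordinates survive the
    limit.\<close>
  have "closedin metric.mtopology Z"
    unfolding metric.metric_closedin_iff_sequentially_closed
  proof (intro conjI allI impI)
    fix s x assume "range s \<subseteq> Z \<and> limitin metric.mtopology s x sequentially"
    then have s: "\<And>n. s n \<in> Z" and x: "x \<in> E" and lim: "\<And>e. e > 0 \<Longrightarrow> \<exists>M. \<forall>n\<ge>M. \<kappa> (s n - x) < e"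
      unfolding limitin_iff by blast+
    have sE: "s n \<in> E" for n using s ZE by blast
    have "\<forall>n. \<exists>a. a \<in> lp p \<and> s n = f a" using s unfolding Z_def by blast
    then obtain a where a: "\<And>n. a n \<in> lp p" "\<And>n. s n = f (a n)" by metis
    have fin_le: "c * (\<Sum>i\<in>I. \<bar>a n i - a m i\<bar> powr p) \<le> \<kappa> (s n - s m)" if "finite I" for I n m
    proof -
      have mem: "a n - a m \<in> lp p" using a(1) by (intro subspace_diff[OF lp])
      have "(\<Sum>i\<in>I. \<bar>(a n - a m) i\<bar> powr p) \<le> (\<Sum>i. \<bar>(a n - a m) i\<bar> powr p)"
        using mem that unfolding lp_def by (intro sum_le_suminf) auto
      then have "c * (\<Sum>i\<in>I. \<bar>(a n - a m) i\<bar> powr p) \<le> c * (\<Sum>i. \<bar>(a n - a m) i\<bar> powr p)"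
        using c by simp
      also have "\<dots> \<le> \<kappa> (f (a n - a m))" using mem by (rule f_low)
      finally show ?thesis using f_diff[OF a(1) a(1)] a(2) by simp
    qed
    have s_cauchy: "\<exists>M. \<forall>m\<ge>M. \<forall>n\<ge>M. \<kappa> (s n - s m) < e" if e: "e > 0" for e
    proof -
      obtain M where M: "\<forall>n\<ge>M. \<kappa> (s n - x) < e / 2" using lim[of "e / 2"] e by auto
      have "\<kappa> (s n - s m) < e" if "m \<ge> M" "n \<ge> M" for m n
      proof -
        have "\<kappa> (s n - s m) \<le> \<kappa> (s n - x) + \<kappa> (x - s m)" using sE x by (intro triangle)
        moreover have "\<kappa> (s n - x) < e / 2" "\<kappa> (s m - x) < e / 2" using M that by auto
        ultimately show ?thesis using sym[OF x sE, of m] by linarith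
      qed
      then show ?thesis by blast
    qed
    have "convergent (\<lambda>n. a n i)" for i
    proof (rule Cauchy_convergent, rule metric_CauchyI)
      fix e :: real assume e: "e > 0"
      then have "0 < c * e powr p" using c by simp
      then obtain M where M: "\<forall>m\<ge>M. \<forall>n\<ge>M. \<kappa> (s n - s m) < c * e powr p" using s_cauchy by blast
      have "\<bar>a n i - a m i\<bar> < e" if "m \<ge> M" "n \<ge> M" for m n
      proof (rule ccontr)
        assume "\<not> ?thesis"
        then have "e powr p \<le> \<bar>a n i - a m i\<bar> powr p" using e p by (intro powr_mono2) auto
        then have "c * e powr p \<le> c * \<bar>a n i - a m i\<bar> powr p" using c by simp
        moreover have "c * \<bar>a n i - a m i\<bar> powr p \<le> \<kappa> (s n - s m)" using fin_le[of "{i}" n m] by simp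
        moreover have "\<kappa> (s n - s m) < c * e powr p" using M that by blast
        ultimately show False by linarith
      qed
      then show "\<exists>M. \<forall>m\<ge>M. \<forall>n\<ge>M. dist (a m i) (a n i) < e"
        unfolding dist_real_def by (intro exI[of _ M]) (metis abs_minus_commute)
    qed
    then obtain b where b: "\<And>i. (\<lambda>n. a n i) \<longlonglongrightarrow> b i" unfolding convergent_def by metis
    have tail: "c * (\<Sum>i\<in>I. \<bar>a n i - b i\<bar> powr p) \<le> e"
      if "finite I" "\<And>m. m \<ge> M \<Longrightarrow> \<kappa> (s n - s m) < e" for I n e M
    proof (rule LIMSEQ_le_const2)
      show "(\<lambda>m. c * (\<Sum>i\<in>I. \<bar>a n i - a m i\<bar> powr p)) \<longlonglongrightarrow> c * (\<Sum>i\<in>I. \<bar>a n i - b i\<bar> powr p)"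
        using p by (intro tendsto_mult_left tendsto_sum tendsto_powr' tendsto_rabs tendsto_diff tendsto_const b) auto
      show "\<exists>N. \<forall>m\<ge>N. c * (\<Sum>i\<in>I. \<bar>a n i - a m i\<bar> powr p) \<le> e"
        using fin_le[OF that(1), of n] that(2) by (meson less_imp_le order.trans)
    qed
    have ab: "a n - b \<in> lp p \<and> c * (\<Sum>i. \<bar>(a n - b) i\<bar> powr p) \<le> e"
      if "\<And>m. m \<ge> M \<Longrightarrow> \<kappa> (s n - s m) < e" for n e M
    proof -
      have bound: "(\<Sum>i<k. \<bar>(a n - b) i\<bar> powr p) \<le> e / c" for k
        using tail[of "{..<k}" M n e] that c by (simp add: field_simps)
      have sm: "summable (\<lambda>i. \<bar>(a n - b) i\<bar> powr p)"
        using bound by (intro summableI_nonneg_bounded) auto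
      have "(\<Sum>i. \<bar>(a n - b) i\<bar> powr p) \<le> e / c" using sm bound by (intro suminf_le_const)
      then show ?thesis using sm c by (simp add: lp_def field_simps)
    qed
    have b_lp: "b \<in> lp p"
    proof -
      obtain M where M: "\<forall>m\<ge>M. \<forall>n\<ge>M. \<kappa> (s n - s m) < 1" using s_cauchy[of 1] by auto
      then have "a M - b \<in> lp p" using ab[of M M 1] by blast
      with a(1) have "a M - (a M - b) \<in> lp p" by (rule subspace_diff[OF lp])
      then show ?thesis by simp
    qed
    have lim_b: "(\<lambda>n. \<kappa> (s n - f b)) \<longlonglongrightarrow> 0"
    proof (subst tendsto_iff_less)
      show "\<forall>n. s n - f b \<in> E" using sE f(1)[OF b_lp] subspace_diff[OF E] by blast
      show "\<forall>e>0. \<exists>M. \<forall>n\<ge>M. \<kappa> (s n - f b) < e"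
      proof (intro allI impI)
        fix e :: real assume e: "e > 0"
        \<comment> \<open>Chosen so that \<open>C * (e' / c) < e\<close>, also when
          \<open>C = 0\<close>.\<close>
        define e' where "e' = c * e / (2 * (C + 1))"
        have e': "0 < e'" unfolding e'_def using c e C by simp
        obtain M where M: "\<forall>m\<ge>M. \<forall>n\<ge>M. \<kappa> (s n - s m) < e'" using s_cauchy[OF e'] by blast
        have "\<kappa> (s n - f b) < e" if "n \<ge> M" for n
        proof -
          have *: "a n - b \<in> lp p" "c * (\<Sum>i. \<bar>(a n - b) i\<bar> powr p) \<le> e'" using ab[of M n e'] M that by auto
          have "\<kappa> (s n - f b) \<le> C * (\<Sum>i. \<bar>(a n - b) i\<bar> powr p)"
            using f_up[OF *(1)] f_diff[OF a(1) b_lp] a(2) by simp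
          also have "\<dots> \<le> C * (e' / c)" using *(2) c C by (intro mult_left_mono) (auto simp: field_simps)
          also have "\<dots> = e * (C / (2 * (C + 1)))" unfolding e'_def using c by simp
          also have "\<dots> < e * 1" using e C by (intro mult_strict_left_mono) (auto simp: field_simps)
          finally show ?thesis by simp
        qed
        then show "\<exists>M. \<forall>n\<ge>M. \<kappa> (s n - f b) < e" by blast
      qed
    qed
    have lim_x: "(\<lambda>n. \<kappa> (s n - x)) \<longlonglongrightarrow> 0"
      using lim sE x subspace_diff[OF E] by (subst tendsto_iff_less) auto
    have "x = f b" using limit_unique[OF sE x lim_x f(1)[OF b_lp] lim_b] .
    then show "x \<in> Z" unfolding Z_def using b_lp by blast
  qed (rule ZE)
  then have "closed_subspace p E N Z" unfolding closed_subspace_def using Z by blast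
  moreover have "\<exists>a\<in>lp p. (\<lambda>n. \<kappa> ((\<Sum>i<n. a i *\<^sub>R u i) - z)) \<longlonglongrightarrow> 0" if "z \<in> Z" for z
    using that f(2) unfolding Z_def S_def by blast
  ultimately show ?thesis using that iso by blast
qed

end

text \<open>Boundedness of \<open>T\<close> carries the lower estimate from the images back to
  \<open>u\<close>, which gives the copy \<open>Z\<close>. On finite combinations, the automatic
  upper estimate for \<open>u\<close> against the lower one for the images bounds \<open>T\<close>
  from below, and this passes to \<open>Z\<close> by approximation.\<close>

lemma fixes_copyI:
  fixes E :: "'v::real_vector set" and F :: "'w::real_vector set" and u :: "nat \<Rightarrow> 'v"
  assumes E: "p_banach p E NE" and F: "p_banach p F NF" and T: "bounded_operator E NE F NF T"
    and u: "\<And>i. u i \<in> E" "\<And>i. NE (u i) powr p \<le> C" and c: "0 < c"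
    and low: "\<And>n a. c * (\<Sum>i<n. \<bar>a i\<bar> powr p) \<le> NF (\<Sum>i<n. a i *\<^sub>R T (u i)) powr p"
  shows "fixes_copy_of_lp p E NE F NF T"
proof -
  interpret E: p_banach p E NE by (rule E)
  interpret F: p_banach p F NF by (rule F)
  obtain L0 where L0: "\<forall>x\<in>E. NF (T x) \<le> L0 * NE x"
    using T unfolding bounded_operator_def by (elim conjE exE)
  define L where "L = max L0 1"
  have L: "0 < L" "NF (T x) \<le> L * NE x" if "x \<in> E" for x
  proof -
    have "L0 * NE x \<le> L * NE x" unfolding L_def using E.N_nonneg[OF that] by (intro mult_right_mono) auto
    then show "NF (T x) \<le> L * NE x" using L0 that by force
  qed (simp add: L_def)
  have L0': "0 < L" by (simp add: L_def)
  have TF: "T x \<in> F" and T_add: "T (x + y) = T x + T y" and T_scale: "T (t *\<^sub>R x) = t *\<^sub>R T x"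
    if "x \<in> E" "y \<in> E" for x y t
    using T that by (auto simp: bounded_operator_def)
  have T0: "T 0 = 0" using T_scale[OF subspace_0[OF E.E] subspace_0[OF E.E], of 0] by simp
  have T_diff: "T (x - y) = T x - T y" if "x \<in> E" "y \<in> E" for x y
    using T_add[OF that(1) subspace_neg[OF E.E that(2)]] T_scale[OF that(2,2), of "-1"] by simp
  have \<kappa>T: "F.\<kappa> (T x) \<le> L powr p * E.\<kappa> x" if "x \<in> E" for x
  proof -
    have "NF (T x) powr p \<le> (L * NE x) powr p"
      using L(2)[OF that] F.N_nonneg[OF TF[OF that that]] E.p by (intro powr_mono2) auto
    then show ?thesis using E.N_nonneg[OF that] L0' by (simp add: F.\<kappa>_def E.\<kappa>_def powr_mult)
  qed
  have Tsum: "T (\<Sum>i<n. a i *\<^sub>R u i) = (\<Sum>i<n. a i *\<^sub>R T (u i)) \<and> (\<Sum>i<n. a i *\<^sub>R u i) \<in> E" for n and a :: "nat \<Rightarrow> real"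
  proof (induction n)
    case (Suc n)
    have mem: "a n *\<^sub>R u n \<in> E" using u(1) by (rule subspace_scale[OF E.E])
    show ?case
      unfolding sum.lessThan_Suc using Suc T_add[OF conjunct2[OF Suc] mem] T_scale[OF u(1) u(1)]
        subspace_add[OF E.E conjunct2[OF Suc] mem] by simp
  qed (simp add: T0 subspace_0[OF E.E])
  have low_E: "c / L powr p * (\<Sum>i<n. \<bar>a i\<bar> powr p) \<le> E.\<kappa> (\<Sum>i<n. a i *\<^sub>R u i)" for n a
  proof -
    have "c * (\<Sum>i<n. \<bar>a i\<bar> powr p) \<le> F.\<kappa> (\<Sum>i<n. a i *\<^sub>R T (u i))"
      unfolding F.\<kappa>_def by (rule low)
    also have "(\<Sum>i<n. a i *\<^sub>R T (u i)) = T (\<Sum>i<n. a i *\<^sub>R u i)" using Tsum by simp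
    also have "F.\<kappa> \<dots> \<le> L powr p * E.\<kappa> (\<Sum>i<n. a i *\<^sub>R u i)" using Tsum by (intro \<kappa>T) blast
    finally have "c * (\<Sum>i<n. \<bar>a i\<bar> powr p) \<le> L powr p * E.\<kappa> (\<Sum>i<n. a i *\<^sub>R u i)" .
    then show ?thesis using L0' by (simp add: field_simps)
  qed
  have uC: "E.\<kappa> (u i) \<le> C" for i using u(2) by (simp add: E.\<kappa>_def)
  have cL: "0 < c / L powr p" using c L0' by simp
  obtain Z where Z: "closed_subspace p E NE Z" "isomorphic_spaces (lp p) (lp_norm p) Z NE"
    and rep: "\<And>z. z \<in> Z \<Longrightarrow> \<exists>a\<in>lp p. (\<lambda>n. E.\<kappa> ((\<Sum>i<n. a i *\<^sub>R u i) - z)) \<longlonglongrightarrow> 0"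
    by (rule E.lp_copy_exists[OF u(1) uC cL low_E]) (rule that)
  have C: "0 \<le> C" using u[of 0] by (meson order.trans powr_ge_zero)
  have ZE: "Z \<subseteq> E" and Zs: "subspace Z"
    using Z(1) closedin_subset[of E.metric.mtopology Z] by (auto simp: closed_subspace_def)
  have bound: "E.\<kappa> z \<le> C / c * F.\<kappa> (T z)" if z: "z \<in> Z" for z
  proof -
    obtain a where a: "a \<in> lp p" "(\<lambda>n. E.\<kappa> ((\<Sum>i<n. a i *\<^sub>R u i) - z)) \<longlonglongrightarrow> 0" using rep[OF z] by blast
    define s where "s n = (\<Sum>i<n. a i *\<^sub>R u i)" for n
    have sE: "s n \<in> E" and Ts: "T (s n) = (\<Sum>i<n. a i *\<^sub>R T (u i))" for n
      unfolding s_def using Tsum by auto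
    have zE: "z \<in> E" using z ZE by blast
    have lim: "(\<lambda>n. E.\<kappa> (s n - z)) \<longlonglongrightarrow> 0" using a(2) by (simp add: s_def)
    have Llim: "(\<lambda>n. L powr p * E.\<kappa> (s n - z)) \<longlonglongrightarrow> 0" using tendsto_mult_left[OF lim, of "L powr p"] by simp
    have "(\<lambda>n. F.\<kappa> (T (s n) - T z)) \<longlonglongrightarrow> 0"
    proof (rule tendsto_sandwich[OF _ _ tendsto_const Llim])
      show "\<forall>\<^sub>F n in sequentially. 0 \<le> F.\<kappa> (T (s n) - T z)" by (simp add: F.\<kappa>_def)
      show "\<forall>\<^sub>F n in sequentially. F.\<kappa> (T (s n) - T z) \<le> L powr p * E.\<kappa> (s n - z)"
        using \<kappa>T[OF subspace_diff[OF E.E sE zE]] T_diff[OF sE zE] by (simp add: always_eventually)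
    qed
    then have limF: "(\<lambda>n. C / c * F.\<kappa> (T (s n))) \<longlonglongrightarrow> C / c * F.\<kappa> (T z)"
      using TF[OF sE sE] TF[OF zE zE] by (intro tendsto_mult_left F.\<kappa>_tendsto) auto
    have limE: "(\<lambda>n. E.\<kappa> (s n)) \<longlonglongrightarrow> E.\<kappa> z" using sE zE lim by (rule E.\<kappa>_tendsto)
    have "E.\<kappa> (s n) \<le> C / c * F.\<kappa> (T (s n))" for n
    proof -
      have "E.\<kappa> (s n) \<le> (\<Sum>i<n. E.\<kappa> (a i *\<^sub>R u i))"
        unfolding s_def using subspace_scale[OF E.E u(1)] by (intro E.\<kappa>_sum_le) auto
      also have "\<dots> \<le> (\<Sum>i<n. \<bar>a i\<bar> powr p * C)"
        using u(1) uC by (intro sum_mono) (simp add: E.scale mult_left_mono)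
      also have "\<dots> = C * (\<Sum>i<n. \<bar>a i\<bar> powr p)" by (simp add: sum_distrib_left mult.commute)
      also have "\<dots> \<le> C * (F.\<kappa> (T (s n)) / c)"
      proof (rule mult_left_mono[OF _ C])
        have "c * (\<Sum>i<n. \<bar>a i\<bar> powr p) \<le> F.\<kappa> (T (s n))" unfolding Ts F.\<kappa>_def by (rule low)
        then show "(\<Sum>i<n. \<bar>a i\<bar> powr p) \<le> F.\<kappa> (T (s n)) / c" using c by (simp add: field_simps)
      qed
      finally show ?thesis by simp
    qed
    then show ?thesis by (intro LIMSEQ_le[OF limE limF]) auto
  qed
  have "isomorphism Z NE (T ` Z) NF T"
  proof (rule isomorphismI[OF Zs])
    show "inj_on T Z"
    proof (rule inj_onI)
      fix x y assume xy: "x \<in> Z" "y \<in> Z" "T x = T y"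
      have d: "x - y \<in> Z" using subspace_diff[OF Zs xy(1,2)] .
      have "T (x - y) = 0" using T_diff xy ZE by (simp add: subset_iff)
      then have "E.\<kappa> (x - y) \<le> 0" using bound[OF d] F.zero by simp
      then have "E.\<kappa> (x - y) = 0" using E.nonneg d ZE by (meson antisym subsetD)
      then show "x = y" using E.\<kappa>_zero_iff d ZE by (metis right_minus_eq subsetD)
    qed
    show "T (x + y) = T x + T y" if "x \<in> Z" "y \<in> Z" for x y using T_add that ZE by blast
    show "T (t *\<^sub>R x) = t *\<^sub>R T x" if "x \<in> Z" for t x using T_scale that ZE by blast
    show "NF (T x) \<le> L * NE x" if "x \<in> Z" for x using L(2) that ZE by blast
    show "NE x \<le> (C / c) powr (1 / p) * NF (T x)" if "x \<in> Z" for x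
    proof -
      have x: "x \<in> E" using that ZE by blast
      have "E.\<kappa> x powr (1 / p) \<le> (C / c * F.\<kappa> (T x)) powr (1 / p)"
        using bound[OF that] E.nonneg[OF x] E.p by (intro powr_mono2) auto
      also have "\<dots> = (C / c) powr (1 / p) * F.\<kappa> (T x) powr (1 / p)"
        by (rule powr_mult)
      finally show ?thesis using E.N_eq[OF x] F.N_eq[OF TF[OF x x]] by simp
    qed
  qed simp
  then have "isomorphic_embedding Z NE F NF T"
    unfolding isomorphic_embedding_def using TF ZE by blast
  with Z show ?thesis unfolding fixes_copy_of_lp_def by blast
qed

section \<open>Riesz's lemma and separated sequences\<close>

context p_banach
begin

text \<open>Coordinates are controlled without functionals: by induction \<open>b\<close> has
  positive distance from \<open>span B\<close>, and homogeneity turns this into a bound on the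
  coefficient of \<open>b\<close>. The coefficients of approximants of \<open>x\<close> are thus
  Cauchy, and subtracting their limit reduces the claim to \<open>B\<close>.\<close>

lemma finite_span_closed:
  assumes "finite B" "B \<subseteq> E" "x \<in> E" "\<And>e. 0 < e \<Longrightarrow> \<exists>y\<in>span B. \<kappa> (x - y) < e"
  shows "x \<in> span B"
  using assms
proof (induction B arbitrary: x rule: finite_induct)
  case empty
  have "\<kappa> x = 0"
  proof (rule ccontr)
    assume "\<kappa> x \<noteq> 0"
    then have "0 < \<kappa> x" using nonneg[of x] empty by simp
    then show False using empty(3)[of "\<kappa> x"] by simp
  qed
  then show ?case using \<kappa>_zero_iff empty by simp
next
  case (insert b B)
  have B: "span B \<subseteq> E" "b \<in> E" using insert.prems(1) span_minimal[OF _ E, of B] by auto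
  show ?case
  proof (cases "b \<in> span B")
    case True
    then have "span (insert b B) = span B" by (rule span_redundant)
    then show ?thesis using insert by auto
  next
    case False
    then have "\<not> (\<forall>e>0. \<exists>y\<in>span B. \<kappa> (b - y) < e)"
      using insert.IH[of b] insert.prems(1) by blast
    then have "\<exists>\<delta>>0. \<forall>y\<in>span B. \<delta> \<le> \<kappa> (b - y)" by (auto simp: not_less)
    then obtain \<delta> where \<delta>: "0 < \<delta>" "\<And>y. y \<in> span B \<Longrightarrow> \<delta> \<le> \<kappa> (b - y)" by blast
    have coord: "\<bar>t\<bar> powr p * \<delta> \<le> \<kappa> (y + t *\<^sub>R b)" if "y \<in> span B" for y t
    proof (cases "t = 0")
      case True
      then show ?thesis using nonneg[of y] that B by auto
    next
      case False
      have y: "(- inverse t) *\<^sub>R y \<in> span B" using that by (rule span_scale)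
      have eq: "y + t *\<^sub>R b = t *\<^sub>R (b - (- inverse t) *\<^sub>R y)" using False by (simp add: scaleR_add_right)
      have "b - (- inverse t) *\<^sub>R y \<in> E" using y B by (intro subspace_diff[OF E]) blast+
      then have "\<kappa> (y + t *\<^sub>R b) = \<bar>t\<bar> powr p * \<kappa> (b - (- inverse t) *\<^sub>R y)"
        unfolding eq by (rule scale)
      then show ?thesis using mult_left_mono[OF \<delta>(2)[OF y], of "\<bar>t\<bar> powr p"] by simp
    qed
    have "\<exists>y t. y \<in> span B \<and> \<kappa> (x - (y + t *\<^sub>R b)) < inverse (real (Suc n))" for n
    proof -
      obtain z where z: "z \<in> span (insert b B)" "\<kappa> (x - z) < inverse (real (Suc n))"
        using insert.prems(3)[of "inverse (real (Suc n))"] by auto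
      obtain t where "z - t *\<^sub>R b \<in> span B" using z(1) by (auto simp: span_insert)
      then show ?thesis using z(2) by (intro exI[of _ "z - t *\<^sub>R b"] exI[of _ t]) simp
    qed
    then obtain y t where yt: "\<And>n. y n \<in> span B" "\<And>n. \<kappa> (x - (y n + t n *\<^sub>R b)) < inverse (real (Suc n))"
      by metis
    have yE: "y n \<in> E" for n using yt(1) B by blast
    have zE: "y n + t n *\<^sub>R b \<in> E" for n using yE B subspace_add[OF E] subspace_scale[OF E] by blast
    have t_diff: "\<bar>t n - t m\<bar> powr p * \<delta> \<le> inverse (real (Suc n)) + inverse (real (Suc m))" for n m
    proof -
      have "\<bar>t n - t m\<bar> powr p * \<delta> \<le> \<kappa> ((y n - y m) + (t n - t m) *\<^sub>R b)"
        using yt(1) by (intro coord span_diff)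
      also have "(y n - y m) + (t n - t m) *\<^sub>R b = (y n + t n *\<^sub>R b) - (y m + t m *\<^sub>R b)"
        by (simp add: scaleR_diff_left)
      also have "\<kappa> \<dots> \<le> \<kappa> ((y n + t n *\<^sub>R b) - x) + \<kappa> (x - (y m + t m *\<^sub>R b))"
        using zE insert.prems(2) by (intro triangle)
      finally show ?thesis using yt(2)[of n] yt(2)[of m] sym[OF zE insert.prems(2), of n] by linarith
    qed
    have "Cauchy t"
    proof (rule metric_CauchyI)
      fix e :: real assume e: "e > 0"
      then have "0 < e powr p * \<delta> / 2" using \<delta> by simp
      then obtain M where M: "inverse (real (Suc M)) < e powr p * \<delta> / 2" using reals_Archimedean by blast
      have "\<bar>t n - t m\<bar> < e" if "n \<ge> M" "m \<ge> M" for n m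
      proof (rule ccontr)
        assume "\<not> ?thesis"
        then have "e powr p \<le> \<bar>t n - t m\<bar> powr p" using e p by (intro powr_mono2) auto
        then have "e powr p * \<delta> \<le> \<bar>t n - t m\<bar> powr p * \<delta>" using \<delta> by simp
        moreover have "inverse (real (Suc n)) \<le> inverse (real (Suc M))"
          "inverse (real (Suc m)) \<le> inverse (real (Suc M))" using that by auto
        ultimately show False using t_diff[of n m] M by linarith
      qed
      then show "\<exists>M. \<forall>m\<ge>M. \<forall>n\<ge>M. dist (t m) (t n) < e" unfolding dist_real_def by blast
    qed
    then obtain t0 where t0: "t \<longlonglongrightarrow> t0" using Cauchy_convergent convergent_def by blast
    have x'E: "x - t0 *\<^sub>R b \<in> E" using insert.prems(2) B subspace_diff[OF E] subspace_scale[OF E] by blast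
    have "x - t0 *\<^sub>R b \<in> span B"
    proof (rule insert.IH)
      show "B \<subseteq> E" "x - t0 *\<^sub>R b \<in> E" using insert.prems(1) x'E by auto
      fix e :: real assume e: "e > 0"
      have lim: "(\<lambda>n. inverse (real (Suc n)) + \<bar>t n - t0\<bar> powr p * \<kappa> b) \<longlonglongrightarrow> 0 + \<bar>t0 - t0\<bar> powr p * \<kappa> b"
        using p t0 by (intro tendsto_add LIMSEQ_inverse_real_of_nat tendsto_mult_right tendsto_powr'
            tendsto_rabs tendsto_diff tendsto_const) auto
      then have "\<forall>\<^sub>F n in sequentially. inverse (real (Suc n)) + \<bar>t n - t0\<bar> powr p * \<kappa> b < e"
        using e p by (intro order_tendstoD(2)[OF lim]) simp
      then obtain n where n: "inverse (real (Suc n)) + \<bar>t n - t0\<bar> powr p * \<kappa> b < e"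
        by (auto simp: eventually_sequentially)
      have eq: "(x - t0 *\<^sub>R b) - y n = (x - (y n + t n *\<^sub>R b)) + (t n - t0) *\<^sub>R b"
        by (simp add: scaleR_diff_left)
      have "\<kappa> ((x - t0 *\<^sub>R b) - y n) \<le> \<kappa> (x - (y n + t n *\<^sub>R b)) + \<kappa> ((t n - t0) *\<^sub>R b)"
        unfolding eq by (rule add[OF subspace_diff[OF E insert.prems(2) zE] subspace_scale[OF E B(2)]])
      also have "\<dots> < e" using yt(2)[of n] n scale[OF B(2), of "t n - t0"] by linarith
      finally show "\<exists>y\<in>span B. \<kappa> (x - t0 *\<^sub>R b - y) < e" using yt(1) by blast
    qed
    then show ?thesis by (auto simp: span_insert)
  qed
qed

text \<open>Riesz's lemma for the p-th power of the norm: \<open>y\<close> realises the distance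
  from \<open>x\<close> to the span within a factor 2, and normalising \<open>x - y\<close> leaves
  distance at least 1/2.\<close>

lemma riesz:
  assumes inf: "infinite_dimensional E" and B: "finite B" "B \<subseteq> E"
  shows "\<exists>e\<in>E. N e = 1 \<and> (\<forall>y\<in>span B. 1 / 2 \<le> \<kappa> (e - y))"
proof -
  have BE: "span B \<subseteq> E" using B E by (intro span_minimal)
  have "span B \<noteq> E" using inf B unfolding infinite_dimensional_def by blast
  then obtain x where x: "x \<in> E" "x \<notin> span B" using BE by blast
  define \<delta> where "\<delta> = (INF y\<in>span B. \<kappa> (x - y))"
  have nn: "0 \<le> \<kappa> (x - y)" if "y \<in> span B" for y using nonneg subspace_diff[OF E x(1)] that BE by blast
  have bdd: "bdd_below ((\<lambda>y. \<kappa> (x - y)) ` span B)" using nn by (intro bdd_belowI[of _ 0]) auto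
  have "\<not> (\<forall>e>0. \<exists>y\<in>span B. \<kappa> (x - y) < e)"
    using finite_span_closed[OF B x(1)] x(2) by blast
  then have "\<exists>e>0. \<forall>y\<in>span B. e \<le> \<kappa> (x - y)" by (auto simp: not_less)
  then obtain e0 where e0: "0 < e0" "\<And>y. y \<in> span B \<Longrightarrow> e0 \<le> \<kappa> (x - y)" by blast
  have "e0 \<le> \<delta>" unfolding \<delta>_def using e0(2) span_zero[of B] by (intro cINF_greatest) auto
  then have \<delta>: "0 < \<delta>" using e0(1) by simp
  then obtain y where y: "y \<in> span B" "\<kappa> (x - y) < 2 * \<delta>"
    using cINF_less_iff[OF _ bdd, of "2 * \<delta>"] span_zero[of B] unfolding \<delta>_def by auto
  have low: "\<delta> \<le> \<kappa> (x - z)" if "z \<in> span B" for z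
    unfolding \<delta>_def using bdd that by (intro cINF_lower)
  define v where "v = x - y"
  have v: "v \<in> E" unfolding v_def using x(1) y(1) BE subspace_diff[OF E] by blast
  have "0 < \<kappa> v" using low[OF y(1)] \<delta> by (simp add: v_def)
  then have Nv: "N v \<noteq> 0" using N_zero_iff[OF v] \<kappa>_zero_iff[OF v] by auto
  then have Nv: "0 < N v" using N_nonneg[OF v] by simp
  define e where "e = inverse (N v) *\<^sub>R v"
  have "e \<in> E" unfolding e_def using v by (rule subspace_scale[OF E])
  moreover have "N e = 1" unfolding e_def N_scale[OF v] using Nv by simp
  moreover have "1 / 2 \<le> \<kappa> (e - z)" if z: "z \<in> span B" for z
  proof -
    have mem: "y + N v *\<^sub>R z \<in> span B" using y(1) z by (intro span_add span_scale)
    have "e - z = inverse (N v) *\<^sub>R (x - (y + N v *\<^sub>R z))"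
      using Nv by (simp add: e_def v_def algebra_simps)
    then have "\<kappa> (e - z) = \<bar>inverse (N v)\<bar> powr p * \<kappa> (x - (y + N v *\<^sub>R z))"
      using scale subspace_diff[OF E x(1)] mem BE by (metis subsetD)
    also have "\<bar>inverse (N v)\<bar> powr p = 1 / \<kappa> v"
      using Nv by (simp add: \<kappa>_def inverse_eq_divide powr_divide)
    finally have eq: "\<kappa> (e - z) = \<kappa> (x - (y + N v *\<^sub>R z)) / \<kappa> v" by simp
    have "1 / 2 * \<kappa> v \<le> \<delta>" using y(2) by (simp add: v_def)
    also have "\<dots> \<le> \<kappa> (x - (y + N v *\<^sub>R z))" using low[OF mem] .
    finally show ?thesis unfolding eq using \<open>0 < \<kappa> v\<close> by (simp add: field_simps)
  qed
  ultimately show ?thesis by blast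
qed

lemma separated_sequence_exists:
  assumes inf: "infinite_dimensional E"
  obtains e where "\<And>n. e n \<in> E" "\<And>n::nat. N (e n) = 1" "\<And>n m. n \<noteq> m \<Longrightarrow> 1 / 2 \<le> \<kappa> (e n - e m)"
proof -
  define ch where "ch B = (SOME e. e \<in> E \<and> N e = 1 \<and> (\<forall>y\<in>span B. 1 / 2 \<le> \<kappa> (e - y)))" for B
  have ch: "ch B \<in> E \<and> N (ch B) = 1 \<and> (\<forall>y\<in>span B. 1 / 2 \<le> \<kappa> (ch B - y))" if "finite B" "B \<subseteq> E" for B
  proof -
    have "\<exists>e. e \<in> E \<and> N e = 1 \<and> (\<forall>y\<in>span B. 1 / 2 \<le> \<kappa> (e - y))" using riesz[OF inf that] by blast
    then show ?thesis unfolding ch_def by (rule someI_ex)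
  qed
  define Bs where "Bs = rec_nat {} (\<lambda>_ B. insert (ch B) B)"
  have Bs_0: "Bs 0 = {}" and Bs_Suc: "Bs (Suc n) = insert (ch (Bs n)) (Bs n)" for n by (simp_all add: Bs_def)
  have Bs: "finite (Bs n) \<and> Bs n \<subseteq> E" for n by (induction n) (use ch in \<open>auto simp: Bs_0 Bs_Suc\<close>)
  have mono: "Bs m \<subseteq> Bs n" if "m \<le> n" for m n
    using that by (rule lift_Suc_mono_le[rotated]) (auto simp: Bs_Suc)
  define e where "e n = ch (Bs n)" for n
  have e: "e n \<in> E" "N (e n) = 1" "\<And>y. y \<in> span (Bs n) \<Longrightarrow> 1 / 2 \<le> \<kappa> (e n - y)" for n
    unfolding e_def using ch[OF conjunct1[OF Bs] conjunct2[OF Bs]] by auto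
  have lt: "1 / 2 \<le> \<kappa> (e n - e m)" if "m < n" for m n
  proof (rule e(3))
    have "e m \<in> Bs (Suc m)" by (simp add: Bs_Suc e_def)
    then show "e m \<in> span (Bs n)" using mono[of "Suc m" n] that by (intro span_base) auto
  qed
  have "1 / 2 \<le> \<kappa> (e n - e m)" if "n \<noteq> m" for n m
    using lt[of m n] lt[of n m] that sym[OF e(1) e(1), of n m] by (cases "m < n") auto
  with e(1,2) show ?thesis by (rule that)
qed

text \<open>In a complete space the closure fails to be compact only if \<open>S\<close> is not
  totally bounded; greedily choosing points outside finitely many balls then gives the
  sequence.\<close>

lemma not_compact_separated:
  assumes S: "S \<subseteq> E" and nc: "\<not> compactin metric.mtopology (metric.mtopology closure_of S)"
  obtains s \<epsilon> where "0 < \<epsilon>" "\<And>n::nat. s n \<in> S" "\<And>n m. n \<noteq> m \<Longrightarrow> \<epsilon> \<le> \<kappa> (s n - s m)"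
proof -
  have "metric.mcomplete" using banach by (simp add: s_Banach_space_def)
  then have "\<not> metric.mtotally_bounded S"
    using metric.mtotally_bounded_eq_compact_closure_of S nc by blast
  then have "\<exists>\<epsilon>>0. \<forall>K. \<not> (finite K \<and> K \<subseteq> S \<and> S \<subseteq> (\<Union>x\<in>K. metric.mball x \<epsilon>))"
    unfolding metric.mtotally_bounded_def not_all not_imp not_ex .
  then obtain \<epsilon> where \<epsilon>: "0 < \<epsilon>"
    and ne': "\<forall>K. \<not> (finite K \<and> K \<subseteq> S \<and> S \<subseteq> (\<Union>x\<in>K. metric.mball x \<epsilon>))"
    by (elim exE conjE)
  have ne: "\<not> S \<subseteq> (\<Union>x\<in>K. metric.mball x \<epsilon>)" if "finite K" "K \<subseteq> S" for K
    using spec[OF ne', of K] that by (simp only: simp_thms)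
  define ch where "ch K = (SOME y. y \<in> S \<and> y \<notin> (\<Union>x\<in>K. metric.mball x \<epsilon>))" for K
  have ch: "ch K \<in> S \<and> ch K \<notin> (\<Union>x\<in>K. metric.mball x \<epsilon>)" if "finite K" "K \<subseteq> S" for K
  proof -
    have "\<exists>y. y \<in> S \<and> y \<notin> (\<Union>x\<in>K. metric.mball x \<epsilon>)" using ne[OF that] by blast
    then show ?thesis unfolding ch_def by (rule someI_ex)
  qed
  define Ks where "Ks = rec_nat {} (\<lambda>_ K. insert (ch K) K)"
  have Ks_0: "Ks 0 = {}" and Ks_Suc: "Ks (Suc n) = insert (ch (Ks n)) (Ks n)" for n by (simp_all add: Ks_def)
  have Ks: "finite (Ks n) \<and> Ks n \<subseteq> S" for n by (induction n) (use ch in \<open>auto simp: Ks_0 Ks_Suc\<close>)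
  have mono: "Ks m \<subseteq> Ks n" if "m \<le> n" for m n
    using that by (rule lift_Suc_mono_le[rotated]) (auto simp: Ks_Suc)
  define s where "s n = ch (Ks n)" for n
  have s: "s n \<in> S" "s n \<notin> (\<Union>x\<in>Ks n. metric.mball x \<epsilon>)" for n
    unfolding s_def using ch[OF conjunct1[OF Ks] conjunct2[OF Ks]] by auto
  have sE: "s n \<in> E" for n using s(1) S by blast
  have lt: "\<epsilon> \<le> \<kappa> (s m - s n)" if "m < n" for m n
  proof -
    have "s m \<in> Ks n" using mono[of "Suc m" n] that by (auto simp: Ks_Suc s_def)
    then have "s n \<notin> metric.mball (s m) \<epsilon>" using s(2)[of n] by blast
    then show ?thesis using dist_eq[OF sE sE] sE by (simp add: metric.in_mball not_less)
  qed
  have "\<epsilon> \<le> \<kappa> (s n - s m)" if "n \<noteq> m" for n m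
    using lt[of m n] lt[of n m] that sym[OF sE sE, of n m] by (cases "m < n") auto
  with \<epsilon> s(1) show ?thesis by (rule that)
qed

end

section \<open>The main theorem\<close>

lemma s_metric_space_mono:
  assumes d: "s_metric_space q M d" and p: "0 < p" "p \<le> q"
  shows "s_metric_space p M d"
proof -
  have q: "0 < q" "q \<le> 1" and nn: "\<And>x y. x \<in> M \<Longrightarrow> y \<in> M \<Longrightarrow> 0 \<le> d x y" and M: "Metric_space M (snowflake q M d)"
    using d by (auto simp: s_metric_space_def)
  interpret Metric_space M "snowflake q M d" by (rule M)
  have eq: "snowflake p M d x y = snowflake q M d x y powr (p / q)" for x y
    using q p by (simp add: snowflake_def powr_powr)
  have "Metric_space M (snowflake p M d)"
  proof
    show "0 \<le> snowflake p M d x y" for x y by (simp add: snowflake_def)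
    show "snowflake p M d x y = snowflake p M d y x" for x y unfolding eq commute[of x y] ..
    show "snowflake p M d x y = 0 \<longleftrightarrow> x = y" if "x \<in> M" "y \<in> M" for x y
      unfolding eq using zero[OF that] by simp
    show "snowflake p M d x z \<le> snowflake p M d x y + snowflake p M d y z"
      if "x \<in> M" "y \<in> M" "z \<in> M" for x y z
    proof -
      have "snowflake q M d x z powr (p / q) \<le> (snowflake q M d x y + snowflake q M d y z) powr (p / q)"
        using triangle[OF that] p q by (intro powr_mono2) auto
      also have "\<dots> \<le> snowflake q M d x y powr (p / q) + snowflake q M d y z powr (p / q)"
        using p q by (intro powr_subadditive) auto
      finally show ?thesis unfolding eq .
    qed
  qed
  then show ?thesis using p q nn by (simp add: s_metric_space_def)
qed

lemma sum_lessThan_shift: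
  fixes f :: "nat \<Rightarrow> 'c::comm_monoid_add"
  assumes "\<And>i. i < J \<Longrightarrow> f i = 0"
  shows "(\<Sum>i<J + n. f i) = (\<Sum>i<n. f (J + i))"
proof (induction n)
  case 0
  then show ?case using assms by simp
qed simp

text \<open>The common core of all three assertions, each of which supplies an operator and a
  bounded sequence with separated images. The images are perturbed into the dense copy of
  \<open>range boundary\<close>, where the norm is a transport cost, and the lower estimate obtained
  there is transferred back.\<close>

lemma free_space_fixes_lp:
  fixes M :: "'a set" and F :: "'f::real_vector set" and E :: "'e::real_vector set" and e :: "nat \<Rightarrow> 'e"
  assumes p: "0 < p" "p < q" "q \<le> 1" and M: "pointed_s_metric_space q M d b"
    and free: "is_Lipschitz_free p M d b F N \<delta>"
    and E: "p_banach p E NE" and T: "bounded_operator E NE F N T"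
    and e: "\<And>n. e n \<in> E" "\<And>n. NE (e n) \<le> 1" and \<epsilon>: "0 < \<epsilon>"
    and sep: "\<And>n m. n \<noteq> m \<Longrightarrow> \<epsilon> \<le> N (T (e n) - T (e m)) powr p"
  shows "fixes_copy_of_lp p E NE F N T"
proof -
  have b: "b \<in> M" and dq: "s_metric_space q M d" using M by (auto simp: pointed_s_metric_space_def)
  have dp: "s_metric_space p M d" using s_metric_space_mono[OF dq] p by simp
  define r where "r x = (if x \<in> M then x else b)" for x
  have rM: "r x \<in> M" for x using b by (simp add: r_def)
  interpret snowflake_space p q "\<lambda>x y. d (r x) (r y)"
    using s_metric_powr_pseudo_metric(1,2)[OF dq b] p unfolding r_def by unfold_locales auto
  have F: "p_banach p F N" using free by (simp add: p_banach_def is_Lipschitz_free_def)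
  interpret E: p_banach p E NE by (rule E)
  interpret F: p_banach p F N by (rule F)
  have \<delta>: "\<And>x. x \<in> M \<Longrightarrow> \<delta> x \<in> F" "\<delta> b = 0" "\<And>x y. x \<in> M \<Longrightarrow> y \<in> M \<Longrightarrow> N (\<delta> x - \<delta> y) = d x y"
    and dense: "s_topology p F N closure_of span (\<delta> ` M) = F"
    using free by (auto simp: is_Lipschitz_free_def)
  define L where "L = linear_extension (\<lambda>x. \<delta> (r x))"
  have fin: "finite {z. m z \<noteq> 0}" if "m \<in> range boundary" for m :: "'a \<Rightarrow> real"
    using that finite_support_boundary by auto
  have L_add: "L (x + y) = L x + L y" if "x \<in> range boundary" "y \<in> range boundary" for x y
    unfolding L_def using fin that by (intro linear_extension_add) auto
  have L_scale: "L (t *\<^sub>R x) = t *\<^sub>R L x" for t x unfolding L_def by (rule linear_extension_scaleR)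
  have L_diff: "L (x - y) = L x - L y" if "x \<in> range boundary" "y \<in> range boundary" for x y
    using L_add[OF that(1) subspace_neg[OF subspace_range_boundary that(2)]] L_scale[of "- 1" y] by simp
  have L_zero: "L 0 = 0" using L_scale[of 0 0] by simp
  \<comment> \<open>This bound needs only the triangle inequality; together with \<open>L_ge\<close>
    it identifies \<open>F.\<kappa>\<close> on the dense part with the transport cost.\<close>
  have LF: "L (boundary l) \<in> F \<and> F.\<kappa> (L (boundary l)) \<le> cost p \<rho> l" for l
  proof (induction l rule: flow_induct)
    case Nil
    show ?case unfolding boundary_Nil L_zero F.zero cost.simps using subspace_0[OF F.E] by blast
  next
    case (Cons a x y l)
    have Lpm: "L (point_mass x - point_mass y) = \<delta> (r x) - \<delta> (r y)"
      unfolding L_def by (rule linear_extension_diff_point_mass)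
    have mem: "point_mass x - point_mass y \<in> range boundary"
      by (rule range_eqI[of _ _ "[(1, x, y)]"]) simp
    have eq: "L (boundary ((a, x, y) # l)) = a *\<^sub>R (\<delta> (r x) - \<delta> (r y)) + L (boundary l)"
      unfolding boundary_Cons L_add[OF range_boundary_scaleR[OF mem] rangeI] L_scale Lpm ..
    have dF: "\<delta> (r x) - \<delta> (r y) \<in> F" using subspace_diff[OF F.E \<delta>(1)[OF rM] \<delta>(1)[OF rM]] .
    have aF: "a *\<^sub>R (\<delta> (r x) - \<delta> (r y)) \<in> F" using subspace_scale[OF F.E dF] .
    have "F.\<kappa> (\<delta> (r x) - \<delta> (r y)) = \<rho> x y" unfolding F.\<kappa>_def \<delta>(3)[OF rM rM] \<rho>_def ..
    then have \<kappa>a: "F.\<kappa> (a *\<^sub>R (\<delta> (r x) - \<delta> (r y))) = \<bar>a\<bar> powr p * \<rho> x y" using F.scale[OF dF] by simp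
    have "F.\<kappa> (a *\<^sub>R (\<delta> (r x) - \<delta> (r y)) + L (boundary l)) \<le> \<bar>a\<bar> powr p * \<rho> x y + cost p \<rho> l"
      using F.add[OF aF conjunct1[OF Cons]] conjunct2[OF Cons] \<kappa>a by linarith
    then show ?case unfolding eq cost.simps using subspace_add[OF F.E aF conjunct1[OF Cons]] by blast
  qed
  have LF': "L x \<in> F" if "x \<in> range boundary" for x using that LF by blast
  have L_le: "F.\<kappa> (L x) \<le> transport_cost p \<rho> x" if "x \<in> range boundary" for x
    unfolding transport_cost_def using that LF by (intro cINF_greatest) auto
  have L_ge: "transport_cost p \<rho> x \<le> F.\<kappa> (L x)" if x: "x \<in> range boundary" for x
  proof -
    obtain l where l: "x = boundary l" using x by blast
    have p1: "p \<le> 1" using p by simp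
    have \<rho>_eq: "\<rho> = (\<lambda>x y. d (r x) (r y) powr p)" by (intro ext) (rule \<rho>_def)
    have r_eq: "r = (\<lambda>x. if x \<in> M then x else b)" by (intro ext) (rule r_def)
    show ?thesis unfolding l L_def F.\<kappa>_def \<rho>_eq unfolding r_eq
      by (rule transport_cost_le_free_norm[OF p(1) p1 b dp free])
  qed
  have span: "span (\<delta> ` M) \<subseteq> L ` range boundary"
  proof (rule span_minimal)
    show "subspace (L ` range boundary)" unfolding subspace_def
    proof (intro conjI ballI allI)
      show "0 \<in> L ` range boundary" using L_zero subspace_0[OF subspace_range_boundary] by (metis image_eqI)
      show "v + w \<in> L ` range boundary" if vw: "v \<in> L ` range boundary" "w \<in> L ` range boundary" for v w
      proof -
        obtain x y where "x \<in> range boundary" "v = L x" "y \<in> range boundary" "w = L y" using vw by blast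
        then show ?thesis using L_add range_boundary_add by (metis image_eqI)
      qed
      show "t *\<^sub>R v \<in> L ` range boundary" if v: "v \<in> L ` range boundary" for t v
      proof -
        obtain x where "x \<in> range boundary" "v = L x" using v by blast
        then show ?thesis using L_scale range_boundary_scaleR by (metis image_eqI)
      qed
    qed
    show "\<delta> ` M \<subseteq> L ` range boundary"
    proof
      fix v assume "v \<in> \<delta> ` M"
      then obtain x where x: "x \<in> M" "v = \<delta> x" by blast
      have "L (boundary [(1, x, b)]) = \<delta> (r x) - \<delta> (r b)"
        using linear_extension_diff_point_mass[of "\<lambda>x. \<delta> (r x)" x b] by (simp add: L_def)
      also have "\<dots> = v" using x b \<delta>(2) by (simp add: r_def)
      finally show "v \<in> L ` range boundary" by (metis rangeI image_eqI)
    qed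
  qed
  have approx: "\<exists>x\<in>range boundary. F.\<kappa> (v - L x) < \<eta>" if v: "v \<in> F" and \<eta>: "0 < \<eta>" for v \<eta>
  proof -
    have "v \<in> F.metric.mtopology closure_of span (\<delta> ` M)" using dense v by simp
    then obtain y where y: "y \<in> span (\<delta> ` M)" "y \<in> F.metric.mball v \<eta>"
      unfolding F.metric.metric_closure_of using \<eta> by blast
    then obtain x where x: "x \<in> range boundary" "y = L x" using span by blast
    have "F.\<kappa> (v - y) < \<eta>" using y(2) F.dist_eq[OF v] by (auto simp: F.metric.in_mball)
    then show ?thesis using x by blast
  qed
  have TF: "T (e n) \<in> F" for n using T e(1) by (auto simp: bounded_operator_def)
  obtain C0 where C0: "\<forall>x\<in>E. N (T x) \<le> C0 * NE x"
    using T unfolding bounded_operator_def by (elim conjE exE)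
  define B0 where "B0 = (max C0 0) powr p"
  have T_bound: "F.\<kappa> (T (e n)) \<le> B0" for n
  proof -
    have "N (T (e n)) \<le> C0 * NE (e n)" using C0 e(1) by blast
    also have "\<dots> \<le> max C0 0 * NE (e n)" using E.N_nonneg[OF e(1)] by (intro mult_right_mono) auto
    also have "\<dots> \<le> max C0 0 * 1" using e(2) by (intro mult_left_mono) auto
    finally have "N (T (e n)) powr p \<le> (max C0 0) powr p"
      using F.N_nonneg[OF TF] p by (intro powr_mono2) auto
    then show ?thesis by (simp add: F.\<kappa>_def B0_def)
  qed
  \<comment> \<open>\<open>\<epsilon> / 4\<close> preserves half of the separation. The constant
    \<open>c\<close> of the lower estimate depends on the perturbed sequence and is not known yet,
    so the perturbations are made to tend to 0 and finitely many terms are dropped later.\<close>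
  define \<eta> where "\<eta> n = min (\<epsilon> / 4) (inverse (real (Suc n)))" for n
  have \<eta>: "0 < \<eta> n" "\<eta> n \<le> \<epsilon> / 4" "\<eta> n \<le> inverse (real (Suc n))" for n using \<epsilon> by (auto simp: \<eta>_def)
  have "\<forall>n. \<exists>x. x \<in> range boundary \<and> F.\<kappa> (T (e n) - L x) < \<eta> n" using approx[OF TF \<eta>(1)] by blast
  then obtain x where x: "\<And>n. x n \<in> range boundary" "\<And>n. F.\<kappa> (T (e n) - L (x n)) < \<eta> n" by metis
  have LxF: "L (x n) \<in> F" for n using LF' x(1) .
  have bounded: "transport_cost p \<rho> (x n) \<le> B0 + \<epsilon> / 4" for n
  proof -
    have "transport_cost p \<rho> (x n) \<le> F.\<kappa> (L (x n))" using x(1) by (rule L_ge)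
    also have "\<dots> \<le> F.\<kappa> (T (e n)) + F.\<kappa> (T (e n) - L (x n))"
      using F.abs_diff_le[OF TF LxF, of n n] by linarith
    finally show ?thesis using T_bound[of n] x(2)[of n] \<eta>(2)[of n] by linarith
  qed
  have separated: "\<epsilon> / 2 \<le> transport_cost p \<rho> (x n - x m)" if "n \<noteq> m" for n m
  proof -
    have "\<epsilon> \<le> F.\<kappa> (T (e n) - T (e m))" using sep[OF that] by (simp add: F.\<kappa>_def)
    also have "\<dots> \<le> F.\<kappa> (T (e n) - L (x n)) + F.\<kappa> (L (x n) - T (e m))" using TF LxF by (intro F.triangle)
    also have "F.\<kappa> (L (x n) - T (e m)) \<le> F.\<kappa> (L (x n) - L (x m)) + F.\<kappa> (L (x m) - T (e m))"
      using TF LxF by (intro F.triangle)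
    also have "F.\<kappa> (L (x m) - T (e m)) = F.\<kappa> (T (e m) - L (x m))" using TF LxF by (intro F.sym)
    finally have "\<epsilon> / 2 \<le> F.\<kappa> (L (x n) - L (x m))"
      using x(2)[of n] x(2)[of m] \<eta>(2)[of n] \<eta>(2)[of m] by linarith
    also have "\<dots> = F.\<kappa> (L (x n - x m))" using L_diff[OF x(1) x(1)] by simp
    also have "\<dots> \<le> transport_cost p \<rho> (x n - x m)" by (intro L_le range_boundary_diff x(1))
    finally show ?thesis .
  qed
  have "0 < \<epsilon> / 2" using \<epsilon> by simp
  from lower_p_estimate_separated[of x, OF x(1) bounded this separated]
  obtain s :: "nat \<Rightarrow> nat" and c where c: "0 < c"
    and low: "\<And>n a. c * (\<Sum>i<n. \<bar>a i\<bar> powr p) \<le> transport_cost p \<rho> (\<Sum>i<n. a i *\<^sub>R x (s i))" by blast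
  \<comment> \<open>The lower estimate itself forces injectivity: a repetition would give a
    vanishing combination with coefficients 1 and -1. Hence the perturbations tend to 0 along
    \<open>s\<close> as well.\<close>
  have inj_lt: "s i \<noteq> s j" if ij: "i < j" for i j
  proof
    assume eq: "s i = s j"
    define a where "a k = (if k = i then 1 else if k = j then - 1 else 0 :: real)" for k
    have "(\<Sum>k<Suc j. a k *\<^sub>R x (s k)) = (\<Sum>k\<in>{i, j}. a k *\<^sub>R x (s k))"
      using ij by (intro sum.mono_neutral_right) (auto simp: a_def)
    also have "\<dots> = a i *\<^sub>R x (s i) + a j *\<^sub>R x (s j)" using ij by (subst sum.insert) auto
    also have "\<dots> = 0" unfolding eq scaleR_add_left[symmetric] using ij by (simp add: a_def)
    finally have "c * (\<Sum>k<Suc j. \<bar>a k\<bar> powr p) \<le> 0"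
      using low[of a "Suc j"] transport_cost_zero[OF nonneg_costs(2), of p] by metis
    moreover have "\<bar>a j\<bar> powr p \<le> (\<Sum>k<Suc j. \<bar>a k\<bar> powr p)" by (intro member_le_sum) auto
    then have "1 \<le> (\<Sum>k<Suc j. \<bar>a k\<bar> powr p)" using ij by (simp add: a_def del: sum.lessThan_Suc)
    ultimately show False using c by (smt (verit) mult_pos_pos)
  qed
  have inj: "inj s"
  proof (rule injI)
    show "i = j" if "s i = s j" for i j using inj_lt[of i j] inj_lt[of j i] that by (cases i j rule: linorder_cases) auto
  qed
  have "0 < c / 2" using c by simp
  then obtain N0 where N0: "inverse (real (Suc N0)) < c / 2" using reals_Archimedean by blast
  have "finite (s -` {..<N0})" using inj by (intro finite_vimageI) auto
  then obtain J where J: "s -` {..<N0} \<subseteq> {..<J}" using finite_nat_bounded by blast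
  have \<eta>J: "\<eta> (s (J + i)) \<le> c / 2" for i
  proof -
    have "N0 \<le> s (J + i)" using J by (metis lessThan_iff not_add_less1 not_less subsetD vimage_eq)
    then have "inverse (real (Suc (s (J + i)))) \<le> inverse (real (Suc N0))" by simp
    then show ?thesis using \<eta>(3)[of "s (J + i)"] N0 by linarith
  qed
  have final: "c / 2 * (\<Sum>i<n. \<bar>a i\<bar> powr p) \<le> N (\<Sum>i<n. a i *\<^sub>R T (e (s (J + i)))) powr p" for n a
  proof -
    \<comment> \<open>Zeros on the \<open>J\<close> dropped terms, so that the estimate for the
      whole sequence applies to the tail.\<close>
    define a' where "a' i = (if i < J then 0 else a (i - J))" for i
    define X where "X n = (\<Sum>i<n. a i *\<^sub>R x (s (J + i)))" for n
    define Y where "Y = (\<Sum>i<n. a i *\<^sub>R T (e (s (J + i))))"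
    have "c * (\<Sum>i<J + n. \<bar>a' i\<bar> powr p) \<le> transport_cost p \<rho> (\<Sum>i<J + n. a' i *\<^sub>R x (s i))" by (rule low)
    also have "(\<Sum>i<J + n. a' i *\<^sub>R x (s i)) = X n"
      unfolding X_def by (subst sum_lessThan_shift) (auto simp: a'_def)
    also have "(\<Sum>i<J + n. \<bar>a' i\<bar> powr p) = (\<Sum>i<n. \<bar>a i\<bar> powr p)"
      by (subst sum_lessThan_shift) (auto simp: a'_def)
    finally have 1: "c * (\<Sum>i<n. \<bar>a i\<bar> powr p) \<le> transport_cost p \<rho> (X n)" .
    have X: "X k \<in> range boundary" for k
      unfolding X_def by (intro range_boundary_sum range_boundary_scaleR x(1))
    have LX: "L (X k) = (\<Sum>i<k. a i *\<^sub>R L (x (s (J + i))))" for k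
    proof (induction k)
      case (Suc k)
      have "X (Suc k) = X k + a k *\<^sub>R x (s (J + k))" by (simp only: X_def sum.lessThan_Suc)
      then have "L (X (Suc k)) = L (X k) + a k *\<^sub>R L (x (s (J + k)))"
        using L_add[OF X range_boundary_scaleR[OF x(1)]] L_scale by simp
      then show ?case using Suc by simp
    next
      case 0
      have X0: "X 0 = 0" by (simp only: X_def lessThan_0 sum.empty)
      show ?case unfolding X0 L_zero by simp
    qed
    \<comment> \<open>The total perturbation; p-subadditivity charges it with half of the lower
      bound.\<close>
    define D where "D = (\<Sum>i<n. a i *\<^sub>R (T (e (s (J + i))) - L (x (s (J + i)))))"
    have dF: "T (e k) - L (x k) \<in> F" for k using subspace_diff[OF F.E TF LxF] .
    have DF: "D \<in> F" unfolding D_def using subspace_scale[OF F.E dF] by (intro F.sum_mem)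
    have YF: "Y \<in> F" unfolding Y_def using subspace_scale[OF F.E TF] by (intro F.sum_mem)
    have "L (X n) = Y - D" unfolding LX Y_def D_def by (simp add: scaleR_diff_right sum_subtractf)
    then have "F.\<kappa> (L (X n)) \<le> F.\<kappa> Y + F.\<kappa> D" using F.diff[OF YF DF] by simp
    also have "F.\<kappa> D \<le> (\<Sum>i<n. F.\<kappa> (a i *\<^sub>R (T (e (s (J + i))) - L (x (s (J + i))))))"
      unfolding D_def using subspace_scale[OF F.E dF] by (intro F.\<kappa>_sum_le) auto
    also have "\<dots> \<le> (\<Sum>i<n. \<bar>a i\<bar> powr p * (c / 2))"
    proof (rule sum_mono)
      fix i
      have "F.\<kappa> (T (e (s (J + i))) - L (x (s (J + i)))) \<le> c / 2" using x(2)[of "s (J + i)"] \<eta>J[of i] by linarith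
      then show "F.\<kappa> (a i *\<^sub>R (T (e (s (J + i))) - L (x (s (J + i))))) \<le> \<bar>a i\<bar> powr p * (c / 2)"
        unfolding F.scale[OF dF] by (intro mult_left_mono) auto
    qed
    also have "\<dots> = c / 2 * (\<Sum>i<n. \<bar>a i\<bar> powr p)" by (simp add: sum_distrib_left mult.commute)
    finally have "c * (\<Sum>i<n. \<bar>a i\<bar> powr p) \<le> F.\<kappa> Y + c / 2 * (\<Sum>i<n. \<bar>a i\<bar> powr p)"
      using 1 L_ge[OF X, of n] by linarith
    then show ?thesis unfolding Y_def F.\<kappa>_def by simp
  qed
  show ?thesis
  proof (rule fixes_copyI[OF E F T, of "\<lambda>i. e (s (J + i))" 1 "c / 2"])
    show "NE (e (s (J + i))) powr p \<le> 1" for i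
      using e(2)[of "s (J + i)"] E.N_nonneg[OF e(1), of "s (J + i)"] p by (intro powr_le1) auto
  qed (use e(1) c final in auto)
qed

section \<open>Subspaces and change of exponent\<close>

lemma closed_subspace_p_banach:
  assumes F: "p_banach p F N" and W: "closed_subspace p F N W"
  shows "p_banach p W N"
proof -
  interpret F: p_banach p F N by (rule F)
  have Ws: "subspace W" and cl: "closedin F.metric.mtopology W" using W by (auto simp: closed_subspace_def)
  have WF: "W \<subseteq> F" using closedin_subset[OF cl] by simp
  have normed: "s_normed_space p W N"
    unfolding s_normed_space_def quasi_normed_space_def
  proof (intro conjI ballI allI)
    show "\<exists>C. \<forall>x\<in>W. \<forall>y\<in>W. N (x + y) \<le> C * (N x + N y)"
      using F.normed WF unfolding s_normed_space_def quasi_normed_space_def by (meson subsetD)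
    show "N (x + y) powr p \<le> N x powr p + N y powr p" if "x \<in> W" "y \<in> W" for x y
      using F.add[of x y] that WF by (auto simp: F.\<kappa>_def)
  qed (use F.p Ws F.N_nonneg F.N_zero_iff F.N_scale WF in auto)
  interpret W: Metric_space W "s_norm_dist p W N" using normed by (rule s_normed_space_Metric_space)
  have dist: "s_norm_dist p W N x y = F.\<kappa> (x - y)" if "x \<in> W" "y \<in> W" for x y
    using that by (simp add: snowflake_def F.\<kappa>_def)
  have "W.mcomplete" unfolding W.mcomplete_def
  proof (intro allI impI)
    fix s assume s: "W.MCauchy s"
    then have sW: "s n \<in> W" for n by (auto simp: W.MCauchy_def)
    then have sF: "s n \<in> F" for n using WF by blast
    have "\<exists>M. \<forall>m\<ge>M. \<forall>n\<ge>M. F.\<kappa> (s m - s n) < e" if "e > 0" for e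
    proof -
      have "\<exists>M. \<forall>m n. M \<le> m \<longrightarrow> M \<le> n \<longrightarrow> s_norm_dist p W N (s m) (s n) < e"
        using s that by (simp only: W.MCauchy_def)
      then obtain M where M: "\<forall>m n. M \<le> m \<longrightarrow> M \<le> n \<longrightarrow> F.\<kappa> (s m - s n) < e"
        unfolding dist[OF sW sW] by (elim exE)
      show ?thesis by (intro exI[of _ M] allI impI) (rule M[rule_format])
    qed
    from F.cauchy_limit_exists[OF sF this] obtain x where x: "x \<in> F" "(\<lambda>n. F.\<kappa> (s n - x)) \<longlonglongrightarrow> 0" by blast
    have "\<forall>n. s n - x \<in> F" using subspace_diff[OF F.E sF x(1)] by simp
    from F.tendsto_iff_less[OF this] x(2) have lim: "\<forall>e>0. \<exists>M. \<forall>n\<ge>M. F.\<kappa> (s n - x) < e" by simp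
    then have "limitin F.metric.mtopology s x sequentially"
      unfolding F.limitin_iff using x(1) sF by simp
    moreover have "range s \<subseteq> W" using sW by blast
    ultimately have xW: "x \<in> W"
      using cl unfolding F.metric.metric_closedin_iff_sequentially_closed by blast
    have "limitin W.mtopology s x sequentially"
      unfolding W.limit_metric_sequentially dist[OF sW xW] using lim xW sW by simp
    then show "\<exists>x. limitin W.mtopology s x sequentially" ..
  qed
  then show ?thesis using normed by (simp add: p_banach_def s_Banach_space_def)
qed

lemma s_Banach_space_mono:
  assumes Z: "s_Banach_space r Z NZ" and p: "0 < p" "p \<le> r"
  shows "s_Banach_space p Z NZ"
proof -
  have Zr: "p_banach r Z NZ" using Z by (simp add: p_banach_def)
  interpret r: p_banach r Z NZ by (rule Zr)
  have tri: "NZ (x + y) powr p \<le> NZ x powr p + NZ y powr p" if "x \<in> Z" "y \<in> Z" for x y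
  proof -
    have "(NZ (x + y) powr r) powr (p / r) \<le> (NZ x powr r + NZ y powr r) powr (p / r)"
      using r.add[OF that] r.p p by (intro powr_mono2) (auto simp: r.\<kappa>_def)
    also have "\<dots> \<le> (NZ x powr r) powr (p / r) + (NZ y powr r) powr (p / r)"
      using r.p p by (intro powr_subadditive) auto
    finally show ?thesis using r.p by (simp add: powr_powr)
  qed
  have normed: "s_normed_space p Z NZ"
    using r.normed tri p unfolding s_normed_space_def by auto
  interpret P: Metric_space Z "s_norm_dist p Z NZ" using normed by (rule s_normed_space_Metric_space)
  have dist: "s_norm_dist p Z NZ x y = r.\<kappa> (x - y) powr (p / r)" if "x \<in> Z" "y \<in> Z" for x y
    using that r.p by (simp add: snowflake_def r.\<kappa>_def powr_powr)
  have "P.mcomplete" unfolding P.mcomplete_def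
  proof (intro allI impI)
    fix s assume s: "P.MCauchy s"
    then have sZ: "s n \<in> Z" for n by (auto simp: P.MCauchy_def)
    have "\<exists>M. \<forall>m\<ge>M. \<forall>n\<ge>M. r.\<kappa> (s m - s n) < e" if e: "e > 0" for e
    proof -
      have "0 < e powr (p / r)" using e by simp
      then have "\<exists>M. \<forall>m n. M \<le> m \<longrightarrow> M \<le> n \<longrightarrow> s_norm_dist p Z NZ (s m) (s n) < e powr (p / r)"
        using s by (simp only: P.MCauchy_def)
      then obtain M where M: "\<forall>m n. M \<le> m \<longrightarrow> M \<le> n \<longrightarrow> r.\<kappa> (s m - s n) powr (p / r) < e powr (p / r)"
        unfolding dist[OF sZ sZ] by (elim exE)
      have "r.\<kappa> (s m - s n) < e" if "m \<ge> M" "n \<ge> M" for m n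
      proof (rule ccontr)
        assume "\<not> ?thesis"
        then have "e powr (p / r) \<le> r.\<kappa> (s m - s n) powr (p / r)"
          using e p r.p by (intro powr_mono2) auto
        then show False using M that by (meson not_less)
      qed
      then show ?thesis by blast
    qed
    from r.cauchy_limit_exists[OF sZ this] obtain x where x: "x \<in> Z" "(\<lambda>n. r.\<kappa> (s n - x)) \<longlonglongrightarrow> 0" by blast
    have "(\<lambda>n. r.\<kappa> (s n - x) powr (p / r)) \<longlonglongrightarrow> 0 powr (p / r)"
      using p r.p x(2) by (intro tendsto_powr' tendsto_const) (auto simp: r.\<kappa>_def)
    then have lim0: "(\<lambda>n. r.\<kappa> (s n - x) powr (p / r)) \<longlonglongrightarrow> 0" by simp
    have "\<exists>M. \<forall>n\<ge>M. r.\<kappa> (s n - x) powr (p / r) < e" if "e > 0" for e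
      using order_tendstoD(2)[OF lim0 that] by (simp add: eventually_sequentially)
    then have "limitin P.mtopology s x sequentially"
      unfolding P.limit_metric_sequentially dist[OF sZ x(1)] using x(1) sZ by simp
    then show "\<exists>x. limitin P.mtopology s x sequentially" ..
  qed
  then show ?thesis using normed by (simp add: s_Banach_space_def)
qed

text \<open>
  The \<open>\<ell>\<^sub>p\<close>-norm of the sum of the first \<open>n\<close> unit vectors is \<open>n powr (1 / p)\<close>, whereas an
  \<open>r\<close>-norm grows at most like \<open>n powr (1 / r)\<close>.
\<close>

lemma lp_not_isomorphic_r_normed:
  assumes Z: "s_Banach_space r Z NZ" and p: "0 < p" "p < r" and V: "V \<subseteq> Z"
    and iso: "isomorphic_spaces (lp p) (lp_norm p) V NZ"
  shows False
proof -
  have Zr: "p_banach r Z NZ" using Z by (simp add: p_banach_def)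
  interpret r: p_banach r Z NZ by (rule Zr)
  have p1: "p \<le> 1" using p r.p by simp
  have lp: "subspace (lp p)" using p(1) p1 by (rule subspace_lp)
  obtain S where S: "bounded_operator (lp p) (lp_norm p) V NZ S" "bij_betw S (lp p) V"
    "bounded_operator V NZ (lp p) (lp_norm p) (inv_into (lp p) S)"
    using iso by (auto simp: isomorphic_spaces_def isomorphism_def)
  obtain C where C: "\<forall>x\<in>lp p. NZ (S x) \<le> C * lp_norm p x"
    using S(1) unfolding bounded_operator_def by (elim conjE exE)
  obtain C' where C': "\<forall>x\<in>V. lp_norm p (inv_into (lp p) S x) \<le> C' * NZ x"
    using S(3) unfolding bounded_operator_def by (elim conjE exE)
  define u where "u k = (\<lambda>i::nat. of_bool (i < k) :: real)" for k :: nat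
  define e where "e k = (\<lambda>i::nat. of_bool (i = k) :: real)" for k :: nat
  have norm_u: "u k \<in> lp p \<and> lp_norm p (u k) = real k powr (1 / p)" for k
  proof -
    have "(\<lambda>i. \<bar>u k i\<bar> powr p) sums (\<Sum>i<k. \<bar>u k i\<bar> powr p)"
      by (rule sums_finite) (auto simp: u_def)
    moreover have "(\<Sum>i<k. \<bar>u k i\<bar> powr p) = real k" by (simp add: u_def)
    ultimately show ?thesis by (auto simp: lp_def lp_norm_def sums_iff)
  qed
  have norm_e: "e k \<in> lp p \<and> lp_norm p (e k) = 1" for k
  proof -
    have "(\<lambda>i. \<bar>e k i\<bar> powr p) sums (\<Sum>i\<in>{k}. \<bar>e k i\<bar> powr p)"
      by (rule sums_finite) (auto simp: e_def)
    moreover have "(\<Sum>i\<in>{k}. \<bar>e k i\<bar> powr p) = 1" by (simp add: e_def)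
    ultimately show ?thesis by (auto simp: lp_def lp_norm_def sums_iff)
  qed
  have u_Suc: "u (Suc k) = u k + e k" for k by (auto simp: u_def e_def fun_eq_iff)
  have SV: "S x \<in> V" if "x \<in> lp p" for x using S(2) that by (auto simp: bij_betw_def)
  have SZ: "S x \<in> Z" if "x \<in> lp p" for x using SV[OF that] V by blast
  have S_add: "S (x + y) = S x + S y" if "x \<in> lp p" "y \<in> lp p" for x y
    using S(1) that by (auto simp: bounded_operator_def)
  have S_scale: "S (t *\<^sub>R x) = t *\<^sub>R S x" if "x \<in> lp p" for t x
    using S(1) that by (auto simp: bounded_operator_def)
  define D where "D = max C 1"
  have D: "1 \<le> D" by (simp add: D_def)
  have \<kappa>e: "r.\<kappa> (S (e k)) \<le> D powr r" for k
  proof -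
    have "NZ (S (e k)) \<le> C * 1" using C norm_e[of k] by auto
    then have "NZ (S (e k)) \<le> D" by (simp add: D_def)
    then show ?thesis unfolding r.\<kappa>_def using r.N_nonneg[OF SZ] norm_e[of k] r.p by (intro powr_mono2) auto
  qed
  have \<kappa>u: "r.\<kappa> (S (u k)) \<le> real k * D powr r" for k
  proof (induction k)
    case 0
    have "u 0 = 0" by (simp add: u_def fun_eq_iff)
    then have "S (u 0) = 0" using S_scale[OF subspace_0[OF lp], of 0] by simp
    then show ?case using r.zero by simp
  next
    case (Suc k)
    have "r.\<kappa> (S (u (Suc k))) \<le> r.\<kappa> (S (u k)) + r.\<kappa> (S (e k))"
      unfolding u_Suc S_add[OF conjunct1[OF norm_u] conjunct1[OF norm_e]]
      using r.add[OF SZ SZ] norm_u norm_e by blast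
    then show ?case using Suc \<kappa>e[of k] by (simp add: algebra_simps)
  qed
  have bound: "real k powr (1 / p - 1 / r) \<le> max C' 0 * D" if k: "k > 0" for k
  proof -
    have uk: "u k \<in> lp p" using norm_u by blast
    have inv: "inv_into (lp p) S (S (u k)) = u k" using S(2) uk by (simp add: bij_betw_def inv_into_f_f)
    have "NZ (S (u k)) = r.\<kappa> (S (u k)) powr (1 / r)" using SZ[OF uk] by (rule r.N_eq)
    also have "\<dots> \<le> (real k * D powr r) powr (1 / r)"
      using \<kappa>u[of k] r.p by (intro powr_mono2) (auto simp: r.\<kappa>_def)
    also have "\<dots> = real k powr (1 / r) * D" using D r.p by (simp add: powr_mult powr_powr)
    finally have NSu: "NZ (S (u k)) \<le> real k powr (1 / r) * D" .
    have "real k powr (1 / p) = lp_norm p (u k)" using norm_u by simp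
    also have "\<dots> \<le> C' * NZ (S (u k))" using C' SV[OF uk] inv by metis
    also have "\<dots> \<le> max C' 0 * NZ (S (u k))" using r.N_nonneg[OF SZ[OF uk]] by (intro mult_right_mono) auto
    also have "\<dots> \<le> max C' 0 * (real k powr (1 / r) * D)" using NSu by (intro mult_left_mono) auto
    finally have "real k powr (1 / p) / real k powr (1 / r) \<le> max C' 0 * D"
      using k by (simp add: field_simps)
    then show ?thesis by (simp add: powr_diff)
  qed
  have "0 < 1 / p - 1 / r" using p by (simp add: field_simps)
  then have "filterlim (\<lambda>k. real k powr (1 / p - 1 / r)) at_top sequentially" by real_asymp
  then have "\<forall>\<^sub>F k in sequentially. max C' 0 * D + 1 \<le> real k powr (1 / p - 1 / r)"
    by (simp add: filterlim_at_top)
  then have "\<forall>\<^sub>F k in sequentially. max C' 0 * D + 1 \<le> real k powr (1 / p - 1 / r) \<and> k > 0"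
    using eventually_gt_at_top[of 0] by (rule eventually_conj)
  then obtain k where "max C' 0 * D + 1 \<le> real k powr (1 / p - 1 / r)" "k > 0"
    by (auto simp: eventually_sequentially)
  with bound[of k] show False by simp
qed

theorem theorem3:
  fixes p q :: real
    and M :: "'a set" and d :: "'a \<Rightarrow> 'a \<Rightarrow> real" and b :: 'a
    and F :: "'f::real_vector set" and N :: "'f \<Rightarrow> real" and \<delta> :: "'a \<Rightarrow> 'f"
  assumes "0 < p" and "p < q" and "q \<le> 1"
    and "pointed_s_metric_space q M d b"
    and "is_Lipschitz_free p M d b F N \<delta>"
  shows "lp_saturated p F N \<and>
    (\<forall>r (Z :: 'z::real_vector set) NZ.
       p < r \<and> r \<le> 1 \<and> s_Banach_space r Z NZ \<and> infinite_dimensional Z \<longrightarrow>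
       \<not> (\<exists>T. isomorphic_embedding Z NZ F N T)) \<and>
    (\<forall>(E :: 'e::real_vector set) NE T.
       s_Banach_space p E NE \<and> bounded_operator E NE F N T \<longrightarrow>
       compact_operator p E NE F N T \<or> fixes_copy_of_lp p E NE F N T)"
proof (intro conjI allI impI)
  have F: "p_banach p F N" using assms(5) by (simp add: p_banach_def is_Lipschitz_free_def)
  interpret F: p_banach p F N by (rule F)
  show "lp_saturated p F N"
    unfolding lp_saturated_def
  proof (intro allI impI)
    fix W assume W: "closed_subspace p F N W \<and> infinite_dimensional W"
    have Wb: "p_banach p W N" using closed_subspace_p_banach[OF F] W by blast
    interpret W: p_banach p W N by (rule Wb)
    have WF: "W \<subseteq> F" using W closedin_subset[of F.metric.mtopology W] by (auto simp: closed_subspace_def)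
    obtain e where e: "\<And>n. e n \<in> W" "\<And>n::nat. N (e n) = 1" "\<And>n m. n \<noteq> m \<Longrightarrow> 1 / 2 \<le> W.\<kappa> (e n - e m)"
      by (rule W.separated_sequence_exists[OF conjunct2[OF W]]) (rule that)
    \<comment> \<open>The inclusion of \<open>W\<close> is the operator to which the core result
      applies; the copy it fixes lies in \<open>W\<close>.\<close>
    have "bounded_operator W N F N (\<lambda>x. x)"
      unfolding bounded_operator_def using WF by (auto intro!: exI[of _ 1])
    then have "fixes_copy_of_lp p W N F N (\<lambda>x. x)"
      using free_space_fixes_lp[OF assms Wb, of "\<lambda>x. x" e "1 / 2"] e by (simp add: W.\<kappa>_def)
    then show "\<exists>Z. closed_subspace p W N Z \<and> isomorphic_spaces (lp p) (lp_norm p) Z N"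
      unfolding fixes_copy_of_lp_def by blast
  qed
next
  fix r and Z :: "'z set" and NZ
  assume Z: "p < r \<and> r \<le> 1 \<and> s_Banach_space r Z NZ \<and> infinite_dimensional Z"
  show "\<not> (\<exists>T. isomorphic_embedding Z NZ F N T)"
  proof
    assume "\<exists>T. isomorphic_embedding Z NZ F N T"
    then obtain T where T: "T ` Z \<subseteq> F" "bounded_operator Z NZ (T ` Z) N T" "bij_betw T Z (T ` Z)"
      "bounded_operator (T ` Z) N Z NZ (inv_into Z T)"
      unfolding isomorphic_embedding_def isomorphism_def by blast
    \<comment> \<open>With the smaller exponent \<open>Z\<close> becomes an admissible domain. The
      copy of \<open>lp p\<close> that the embedding must fix inside \<open>Z\<close> contradicts
      the growth of the \<open>r\<close>-norm.\<close>
    have Zb: "p_banach p Z NZ"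
      using s_Banach_space_mono[of r Z NZ p] Z assms(1) by (simp add: p_banach_def)
    interpret Z: p_banach p Z NZ by (rule Zb)
    obtain e where e: "\<And>n. e n \<in> Z" "\<And>n::nat. NZ (e n) = 1" "\<And>n m. n \<noteq> m \<Longrightarrow> 1 / 2 \<le> Z.\<kappa> (e n - e m)"
      by (rule Z.separated_sequence_exists) (use Z in blast, rule that)
    obtain C where C: "\<forall>x\<in>T ` Z. NZ (inv_into Z T x) \<le> C * N x"
      using T(4) unfolding bounded_operator_def by (elim conjE exE)
    have F: "p_banach p F N" using assms(5) by (simp add: p_banach_def is_Lipschitz_free_def)
    interpret F: p_banach p F N by (rule F)
    define D where "D = max C 1"
    have D: "0 < D" by (simp add: D_def)
    have low: "Z.\<kappa> x \<le> D powr p * N (T x) powr p" if x: "x \<in> Z" for x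
    proof -
      have Nn: "0 \<le> N (T x)" using F.N_nonneg T(1) x by blast
      have "inv_into Z T (T x) = x" using T(3) x by (simp add: bij_betw_def inv_into_f_f)
      then have "NZ x \<le> C * N (T x)" using C x by force
      also have "\<dots> \<le> D * N (T x)" using Nn by (intro mult_right_mono) (auto simp: D_def)
      finally have "NZ x powr p \<le> (D * N (T x)) powr p"
        using Z.N_nonneg[OF x] assms(1) by (intro powr_mono2) auto
      then show ?thesis by (simp add: Z.\<kappa>_def powr_mult)
    qed
    have T_diff: "T (x - y) = T x - T y" if xy: "x \<in> Z" "y \<in> Z" for x y
    proof -
      have add: "T (u + v) = T u + T v" and scale: "T (t *\<^sub>R u) = t *\<^sub>R T u" if "u \<in> Z" "v \<in> Z" for u v t
        using T(2) that by (auto simp: bounded_operator_def)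
      show ?thesis using add[OF xy(1) subspace_neg[OF Z.E xy(2)]] scale[OF xy(2,2), of "- 1"] by simp
    qed
    have "bounded_operator Z NZ F N T" using T(1,2) by (auto simp: bounded_operator_def)
    moreover have "1 / (2 * D powr p) \<le> N (T (e n) - T (e m)) powr p" if "n \<noteq> m" for n m
      using e(3)[OF that] low[OF subspace_diff[OF Z.E e(1) e(1)], of n m] T_diff[OF e(1) e(1), of n m] D
      by (simp add: field_simps)
    ultimately have "fixes_copy_of_lp p Z NZ F N T"
      using free_space_fixes_lp[OF assms Zb, of T e "1 / (2 * D powr p)"] e D by simp
    then obtain V where V: "closed_subspace p Z NZ V" "isomorphic_spaces (lp p) (lp_norm p) V NZ"
      unfolding fixes_copy_of_lp_def by blast
    have "V \<subseteq> Z" using V(1) closedin_subset[of Z.metric.mtopology V] by (auto simp: closed_subspace_def)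
    then show False using lp_not_isomorphic_r_normed[of r Z NZ p V] Z assms(1) V(2) by blast
  qed
next
  fix E :: "'e set" and NE T
  assume ET: "s_Banach_space p E NE \<and> bounded_operator E NE F N T"
  have F: "p_banach p F N" using assms(5) by (simp add: p_banach_def is_Lipschitz_free_def)
  interpret F: p_banach p F N by (rule F)
  have E: "p_banach p E NE" using ET by (simp add: p_banach_def)
  show "compact_operator p E NE F N T \<or> fixes_copy_of_lp p E NE F N T"
  proof (rule disjCI)
    assume nf: "\<not> fixes_copy_of_lp p E NE F N T"
    show "compact_operator p E NE F N T"
    proof (rule ccontr)
      assume nc: "\<not> compact_operator p E NE F N T"
      have SF: "T ` {x \<in> E. NE x \<le> 1} \<subseteq> F" using ET by (auto simp: bounded_operator_def)
      obtain s \<epsilon> where s: "0 < \<epsilon>" "\<And>n::nat. s n \<in> T ` {x \<in> E. NE x \<le> 1}"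
        "\<And>n m. n \<noteq> m \<Longrightarrow> \<epsilon> \<le> F.\<kappa> (s n - s m)"
        by (rule F.not_compact_separated[OF SF nc[unfolded compact_operator_def]]) (rule that)
      have "\<forall>n. \<exists>x. x \<in> E \<and> NE x \<le> 1 \<and> s n = T x" using s(2) by blast
      then obtain e where e: "\<And>n. e n \<in> E" "\<And>n. NE (e n) \<le> 1" "\<And>n. s n = T (e n)" by metis
      have "fixes_copy_of_lp p E NE F N T"
        using free_space_fixes_lp[OF assms E conjunct2[OF ET] e(1,2) s(1)] s(3) unfolding e(3) F.\<kappa>_def by blast
      with nf show False ..
    qed
  qed
qed

end
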